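(* Let $S$ be an inverse semigroup. Then the Stone groupoid of the Exel completion $\mathsf{T}(S)$ of $S$ is the tight groupoid $\mathsf{G}_{t}(S)$.
   Context: Conventions: inverse semigroups have a zero and homomorphisms preserve it; the order is the natural partial order, $\mathbf{d}(s)=s^{-1}s$, $\mathbf{r}(s)=ss^{-1}$, and $X^{\uparrow}$, $X^{\downarrow}$ denote the upward and downward closures of a subset $X$. A Boolean inverse semigroup is an inverse semigroup with joins of finite compatible sets over which multiplication distributes, whose idempotents form a (generalized, not necessarily unital) Boolean algebra. A finite subset $\{a_{1},\ldots,a_{m}\}\subseteq a^{\downarrow}$ is a cover of $a$ if for each $0\neq x\leq a$ there is $i$ with $x\wedge a_{i}\neq 0$. The Booleanization $\mathsf{B}(S)$ is the Boolean inverse semigroup together with the (injective) homomorphism $\beta\colon S\to\mathsf{B}(S)$ that is universal for homomorphisms from $S$ to Boolean inverse semigroups; identify $S$ with its image. An additive ideal is a semigroup ideal closed under binary compatible joins. The Cuntz–Krieger ideal $I$ of $\mathsf{B}(S)$ is the additive ideal generated by all elements $a\setminus(a_{1}\vee\cdots\vee a_{m})$ where $\{a_{1},\ldots,a_{m}\}$ is a cover of $a$. The Exel completion is $\mathsf{T}(S)=\mathsf{B}(S)/I$, the quotient by the congruence $(a,b)\in\varepsilon_{I}$ iff there is $c\leq a,b$ with $a\setminus c,\ b\setminus c\in I$. The Stone groupoid of a Boolean inverse semigroup $T$ is the set of ultrafilters of $T$ with product $A\cdot B=(AB)^{\uparrow}$ defined when $(A^{-1}A)^{\uparrow}=(BB^{-1})^{\uparrow}$,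 and topology with basis the sets of ultrafilters containing a fixed element $a\in T$. A proper filter of $S$ is a non-empty upward-closed, down-directed subset not containing $0$; it is tight if whenever $a\in A$ and $C$ is a cover of $a$ then $C\cap A\neq\varnothing$. The tight groupoid $\mathsf{G}_{t}(S)$ (Exel's tight groupoid) is the groupoid of tight filters of $S$ with the same partial product, equipped with the patch topology, whose basic open sets are the sets of tight filters containing $a$ but none of $a_{1},\ldots,a_{m}$ (for $a_{1},\ldots,a_{m}\leq a$). *)

theory Defs
  imports "HOL-Analysis.Analysis"
begin

record 'a isg =
  car :: "'a set"
  mul :: "'a \<Rightarrow> 'a \<Rightarrow> 'a"
  zer :: 'a

definition inverse_semigroup :: "'a isg \<Rightarrow> bool" where
  "inverse_semigroup S \<longleftrightarrow>
     zer S \<in> car S \<and>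
     (\<forall>x\<in>car S. \<forall>y\<in>car S. mul S x y \<in> car S) \<and>
     (\<forall>x\<in>car S. \<forall>y\<in>car S. \<forall>z\<in>car S. mul S (mul S x y) z = mul S x (mul S y z)) \<and>
     (\<forall>x\<in>car S. mul S (zer S) x = zer S \<and> mul S x (zer S) = zer S) \<and>
     (\<forall>x\<in>car S. \<exists>!y. y \<in> car S \<and> mul S (mul S x y) x = x \<and> mul S (mul S y x) y = y)"

definition inv :: "'a isg \<Rightarrow> 'a \<Rightarrow> 'a" where
  "inv S x = (THE y. y \<in> car S \<and> mul S (mul S x y) x = x \<and> mul S (mul S y x) y = y)"

definition dom :: "'a isg \<Rightarrow> 'a \<Rightarrow> 'a" where
  "dom S x = mul S (inv S x) x"

definition ran :: "'a isg \<Rightarrow> 'a \<Rightarrow> 'a" where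
  "ran S x = mul S x (inv S x)"

definition leq :: "'a isg \<Rightarrow> 'a \<Rightarrow> 'a \<Rightarrow> bool" where
  "leq S x y \<longleftrightarrow> x \<in> car S \<and> y \<in> car S \<and> x = mul S y (dom S x)"

definition idem :: "'a isg \<Rightarrow> 'a \<Rightarrow> bool" where
  "idem S e \<longleftrightarrow> e \<in> car S \<and> mul S e e = e"

definition hom :: "'a isg \<Rightarrow> 'b isg \<Rightarrow> ('a \<Rightarrow> 'b) \<Rightarrow> bool" where
  "hom S T h \<longleftrightarrow>
     (\<forall>x\<in>car S. h x \<in> car T) \<and>
     (\<forall>x\<in>car S. \<forall>y\<in>car S. h (mul S x y) = mul T (h x) (h y)) \<and>
     h (zer S) = zer T"

definition compatible :: "'a isg \<Rightarrow> 'a \<Rightarrow> 'a \<Rightarrow> bool" where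
  "compatible S a b \<longleftrightarrow> idem S (mul S (inv S a) b) \<and> idem S (mul S a (inv S b))"

definition is_join :: "'a isg \<Rightarrow> 'a set \<Rightarrow> 'a \<Rightarrow> bool" where
  "is_join S X j \<longleftrightarrow> j \<in> car S \<and> (\<forall>x\<in>X. leq S x j) \<and>
     (\<forall>u\<in>car S. (\<forall>x\<in>X. leq S x u) \<longrightarrow> leq S j u)"

definition join :: "'a isg \<Rightarrow> 'a set \<Rightarrow> 'a" where
  "join S X = (THE j. is_join S X j)"

definition boolean_isg :: "'a isg \<Rightarrow> bool" where
  "boolean_isg S \<longleftrightarrow> inverse_semigroup S \<and>
     (\<forall>X. finite X \<and> X \<subseteq> car S \<and> (\<forall>x\<in>X. \<forall>y\<in>X. compatible S x y) \<longrightarrow>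
        (\<exists>j. is_join S X j) \<and>
        (\<forall>s\<in>car S. is_join S (mul S s ` X) (mul S s (join S X)) \<and>
                    is_join S ((\<lambda>x. mul S x s) ` X) (mul S (join S X) s))) \<and>
     (\<forall>e f. idem S e \<and> idem S f \<and> leq S e f \<longrightarrow>
        (\<exists>g. idem S g \<and> mul S e g = zer S \<and> is_join S {e, g} f))"

definition morphism :: "'a isg \<Rightarrow> 'b isg \<Rightarrow> ('a \<Rightarrow> 'b) \<Rightarrow> bool" where
  "morphism S T h \<longleftrightarrow> hom S T h \<and>
     (\<forall>x\<in>car S. \<forall>y\<in>car S. compatible S x y \<longrightarrow> h (join S {x, y}) = join T {h x, h y})"

definition diff :: "'a isg \<Rightarrow> 'a \<Rightarrow> 'a \<Rightarrow> 'a" where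
  "diff S a b = (THE c. leq S c a \<and> mul S (dom S c) (dom S b) = zer S \<and>
                        mul S (ran S c) (ran S b) = zer S \<and> is_join S {b, c} a)"

definition cover :: "'a isg \<Rightarrow> 'a \<Rightarrow> 'a set \<Rightarrow> bool" where
  "cover S a C \<longleftrightarrow> a \<in> car S \<and> finite C \<and> (\<forall>c\<in>C. leq S c a) \<and>
     (\<forall>x. x \<noteq> zer S \<and> leq S x a \<longrightarrow>
        (\<exists>c\<in>C. \<exists>y. y \<noteq> zer S \<and> leq S y x \<and> leq S y c))"

definition proper_filter :: "'a isg \<Rightarrow> 'a set \<Rightarrow> bool" where
  "proper_filter S A \<longleftrightarrow> A \<subseteq> car S \<and> A \<noteq> {} \<and>
     (\<forall>a\<in>A. \<forall>b. leq S a b \<longrightarrow> b \<in> A) \<and>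
     (\<forall>a\<in>A. \<forall>b\<in>A. \<exists>c\<in>A. leq S c a \<and> leq S c b) \<and>
     zer S \<notin> A"

definition ultrafilter :: "'a isg \<Rightarrow> 'a set \<Rightarrow> bool" where
  "ultrafilter S A \<longleftrightarrow> proper_filter S A \<and>
     (\<forall>B. proper_filter S B \<and> A \<subseteq> B \<longrightarrow> B = A)"

definition tight_filter :: "'a isg \<Rightarrow> 'a set \<Rightarrow> bool" where
  "tight_filter S A \<longleftrightarrow> proper_filter S A \<and>
     (\<forall>a\<in>A. \<forall>C. cover S a C \<longrightarrow> C \<inter> A \<noteq> {})"

definition is_booleanization :: "'a isg \<Rightarrow> 'b isg \<Rightarrow> ('a \<Rightarrow> 'b) \<Rightarrow> bool" where
  "is_booleanization S B \<beta> \<longleftrightarrow> boolean_isg B \<and> hom S B \<beta> \<and> inj_on \<beta> (car S) \<and>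
     (\<forall>(T :: ('b \<times> nat) isg) \<theta>. boolean_isg T \<and> hom S T \<theta> \<longrightarrow>
        (\<exists>\<phi>. morphism B T \<phi> \<and> (\<forall>s\<in>car S. \<phi> (\<beta> s) = \<theta> s)) \<and>
        (\<forall>\<phi> \<psi>. morphism B T \<phi> \<and> (\<forall>s\<in>car S. \<phi> (\<beta> s) = \<theta> s) \<and>
                 morphism B T \<psi> \<and> (\<forall>s\<in>car S. \<psi> (\<beta> s) = \<theta> s) \<longrightarrow>
                 (\<forall>x\<in>car B. \<phi> x = \<psi> x)))"

definition additive_ideal :: "'a isg \<Rightarrow> 'a set \<Rightarrow> bool" where
  "additive_ideal B J \<longleftrightarrow> J \<subseteq> car B \<and>
     (\<forall>x\<in>J. \<forall>s\<in>car B. mul B s x \<in> J \<and> mul B x s \<in> J) \<and>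
     (\<forall>x\<in>J. \<forall>y\<in>J. compatible B x y \<longrightarrow> join B {x, y} \<in> J)"

definition CK_generators :: "'a isg \<Rightarrow> 'b isg \<Rightarrow> ('a \<Rightarrow> 'b) \<Rightarrow> 'b set" where
  "CK_generators S B \<beta> =
     {diff B (\<beta> a) (join B (\<beta> ` C)) | a C. a \<in> car S \<and> cover S a C}"

definition CK_ideal :: "'a isg \<Rightarrow> 'b isg \<Rightarrow> ('a \<Rightarrow> 'b) \<Rightarrow> 'b set" where
  "CK_ideal S B \<beta> = \<Inter>{J. additive_ideal B J \<and> CK_generators S B \<beta> \<subseteq> J}"

definition ideal_congruence :: "'b isg \<Rightarrow> 'b set \<Rightarrow> ('b \<times> 'b) set" where
  "ideal_congruence B I = {(a, b). a \<in> car B \<and> b \<in> car B \<and>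
      (\<exists>c. leq B c a \<and> leq B c b \<and> diff B a c \<in> I \<and> diff B b c \<in> I)}"

definition quotient_isg :: "'b isg \<Rightarrow> ('b \<times> 'b) set \<Rightarrow> 'b set isg" where
  "quotient_isg B R =
     \<lparr> car = car B // R,
       mul = (\<lambda>X Y. R `` {mul B (SOME x. x \<in> X) (SOME y. y \<in> Y)}),
       zer = R `` {zer B} \<rparr>"

definition exel_completion :: "'a isg \<Rightarrow> 'b isg \<Rightarrow> ('a \<Rightarrow> 'b) \<Rightarrow> 'b set isg" where
  "exel_completion S B \<beta> = quotient_isg B (ideal_congruence B (CK_ideal S B \<beta>))"

definition upclose :: "'a isg \<Rightarrow> 'a set \<Rightarrow> 'a set" where
  "upclose S X = {b. \<exists>a\<in>X. leq S a b}"

definition setmul :: "'a isg \<Rightarrow> 'a set \<Rightarrow> 'a set \<Rightarrow> 'a set" where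
  "setmul S X Y = {mul S x y | x y. x \<in> X \<and> y \<in> Y}"

definition setinv :: "'a isg \<Rightarrow> 'a set \<Rightarrow> 'a set" where
  "setinv S X = inv S ` X"

definition composable :: "'a isg \<Rightarrow> 'a set \<Rightarrow> 'a set \<Rightarrow> bool" where
  "composable S A B \<longleftrightarrow> upclose S (setmul S (setinv S A) A) = upclose S (setmul S B (setinv S B))"

definition gprod :: "'a isg \<Rightarrow> 'a set \<Rightarrow> 'a set \<Rightarrow> 'a set" where
  "gprod S A B = upclose S (setmul S A B)"

definition stone_topology :: "'a isg \<Rightarrow> 'a set topology" where
  "stone_topology T = topology_generated_by
     {{U. ultrafilter T U \<and> a \<in> U} | a. a \<in> car T}"

definition patch_topology :: "'a isg \<Rightarrow> 'a set topology" where
  "patch_topology S = topology_generated_by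
     {{A. tight_filter S A \<and> a \<in> A \<and> (\<forall>c\<in>C. c \<notin> A)} | a C.
        a \<in> car S \<and> finite C \<and> (\<forall>c\<in>C. leq S c a)}"

definition stone_tight_iso :: "'c isg \<Rightarrow> 'a isg \<Rightarrow> ('c set \<Rightarrow> 'a set) \<Rightarrow> bool" where
  "stone_tight_iso T S \<phi> \<longleftrightarrow>
     bij_betw \<phi> {U. ultrafilter T U} {A. tight_filter S A} \<and>
     (\<forall>U\<in>{U. ultrafilter T U}. \<forall>V\<in>{U. ultrafilter T U}.
        composable T U V \<longleftrightarrow> composable S (\<phi> U) (\<phi> V)) \<and>
     (\<forall>U\<in>{U. ultrafilter T U}. \<forall>V\<in>{U. ultrafilter T U}.
        composable T U V \<longrightarrow> \<phi> (gprod T U V) = gprod S (\<phi> U) (\<phi> V)) \<and>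
     homeomorphic_map (stone_topology T) (patch_topology S) \<phi>"

end

theory Submission
  imports Defs
begin

text \<open>
  Three dictionaries are composed. For an additive ideal \<open>I\<close> of \<open>B\<close>, ultrafilters of \<open>B/I\<close> are the join-prime
  filters of \<open>B\<close> that avoid \<open>I\<close>. For the Booleanization \<open>B\<close> of \<open>S\<close>, join-prime filters \<open>U\<close> of \<open>B\<close> are the
  proper filters \<open>{s. \<beta>(s) \<in> U}\<close> of \<open>S\<close>; and \<open>U\<close> avoids the Cuntz--Krieger ideal iff this filter is tight.

  The second dictionary needs two consequences of the universal property. Uniqueness of extensions, applied to the
  subsemigroup generated by \<open>\<beta>(S)\<close>, shows that every element of \<open>B\<close> is a finite join of elements \<open>\<beta>(s)e\<close> with \<open>e\<close> in
  the Boolean ring generated by \<open>\<beta>(E(S))\<close>. Existence, applied to the Wagner--Preston representation of \<open>S\<close> on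
  \<open>S - {0}\<close>, shows that \<open>B\<close> has no unforced relations: evaluating at the points \<open>h \<in> E(S)\<close>, if \<open>\<beta>(a)\<close> and \<open>\<beta>(b)\<close>
  agree on an idempotent of \<open>B\<close> whose domain contains \<open>h\<close>, then \<open>ah = bh\<close>. The test objects of the universal property
  are of bounded size, so the range of the representation is cut down to a closure of cardinality at most that of
  \<open>'b \<times> nat\<close>.
\<close>

section \<open>Inverse semigroups\<close>

text \<open>The delicate point is directedness of \<open>{s. \<beta> s \<in> U}\<close> for a
  join-prime filter \<open>U\<close>: elements \<open>\<beta> a\<close> and \<open>\<beta> b\<close>
  of \<open>U\<close> have a common lower bound in \<open>U\<close>, but it need not come from
  \<open>S\<close>. It is replaced by \<open>\<beta> (ah)\<close> with \<open>h\<close> an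
  idempotent of \<open>S\<close> lying in the domain of the lower bound; there the representation
  forces \<open>ah = bh\<close>.

  A point \<open>h\<close> sees \<open>\<beta> k\<close> exactly when \<open>h\<close> lies below
  \<open>k\<close>. A filter is therefore not a single point but a limit along a downward directed
  set of points, and every idempotent of \<open>B\<close> is eventually true or eventually false
  along that set. Read backwards, the same limit defines the join-prime filter of \<open>B\<close>
  attached to a filter of \<open>S\<close>.

  Avoiding the Cuntz--Krieger ideal is proved for all tight prime filters at once, because
  multiplication by an element of \<open>B\<close> replaces a filter by a translate. Translates
  carry the groupoid too: \<open>UV\<close> is the upward closure of \<open>uV\<close> for any
  \<open>u\<close> in \<open>U\<close>, and composability is an equality of two such products, so it
  is enough to preserve products and to be injective.\<close>

notation mul (infixl "\<cdot>\<index>" 70)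
notation leq (infix "\<sqsubseteq>\<index>" 50)
notation zer ("\<zero>\<index>")

text \<open>Commuting idempotents force uniqueness of inverses: if \<open>y\<close> and
  \<open>z\<close> are inverses of \<open>x\<close>, commuting \<open>yx\<close> with
  \<open>zx\<close> gives \<open>y = zxy\<close>, and commuting \<open>xy\<close> with
  \<open>xz\<close> turns this into \<open>z\<close>. Concrete models are checked through this rule,
  commutation being easier to verify than uniqueness.\<close>

lemma inverse_semigroupI:
  fixes S (structure)
  assumes z: "\<zero> \<in> car S" and c: "\<And>x y. \<lbrakk>x \<in> car S; y \<in> car S\<rbrakk> \<Longrightarrow> x \<cdot> y \<in> car S"
    and a: "\<And>x y z. \<lbrakk>x \<in> car S; y \<in> car S; z \<in> car S\<rbrakk> \<Longrightarrow> x \<cdot> y \<cdot> z = x \<cdot> (y \<cdot> z)"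
    and zz: "\<And>x. x \<in> car S \<Longrightarrow> \<zero> \<cdot> x = \<zero>" "\<And>x. x \<in> car S \<Longrightarrow> x \<cdot> \<zero> = \<zero>"
    and r: "\<And>x. x \<in> car S \<Longrightarrow> \<exists>y\<in>car S. x \<cdot> y \<cdot> x = x \<and> y \<cdot> x \<cdot> y = y"
    and i: "\<And>e f. \<lbrakk>e \<in> car S; f \<in> car S; e \<cdot> e = e; f \<cdot> f = f\<rbrakk> \<Longrightarrow> e \<cdot> f = f \<cdot> e"
  shows "inverse_semigroup S"
  unfolding inverse_semigroup_def
proof (intro conjI ballI)
  fix x assume x: "x \<in> car S"
  have uni: "y = z" if "y \<in> car S" "x \<cdot> y \<cdot> x = x" "y \<cdot> x \<cdot> y = y"
     "z \<in> car S" "x \<cdot> z \<cdot> x = x" "z \<cdot> x \<cdot> z = z" for y z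
  proof -
    have id: "(x \<cdot> y) \<cdot> (x \<cdot> z) = (x \<cdot> z) \<cdot> (x \<cdot> y)" "(y \<cdot> x) \<cdot> (z \<cdot> x) = (z \<cdot> x) \<cdot> (y \<cdot> x)"
      by (rule i; use that x c a in metis)+
    have "y = (y \<cdot> x) \<cdot> (z \<cdot> x) \<cdot> y" using that x c a by metis
    also have "\<dots> = z \<cdot> x \<cdot> y" using that x c a id(2) by metis
    also have "\<dots> = z \<cdot> ((x \<cdot> z) \<cdot> (x \<cdot> y))" using that x c a by metis
    also have "\<dots> = z" using that x c a id(1) by metis
    finally show ?thesis .
  qed
  show "\<exists>!y. y \<in> car S \<and> x \<cdot> y \<cdot> x = x \<and> y \<cdot> x \<cdot> y = y"
    using r[OF x] uni by blast
qed (use assms in auto)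

locale isg =
  fixes S :: "'a isg" (structure)
  assumes isg: "inverse_semigroup S"
begin

lemma zer_car [simp]: "\<zero> \<in> car S"
  and mul_car [simp]: "\<lbrakk>x \<in> car S; y \<in> car S\<rbrakk> \<Longrightarrow> x \<cdot> y \<in> car S"
  and mul_assoc: "\<lbrakk>x \<in> car S; y \<in> car S; z \<in> car S\<rbrakk> \<Longrightarrow> x \<cdot> y \<cdot> z = x \<cdot> (y \<cdot> z)"
  and zer_mul [simp]: "x \<in> car S \<Longrightarrow> \<zero> \<cdot> x = \<zero>"
  and mul_zer [simp]: "x \<in> car S \<Longrightarrow> x \<cdot> \<zero> = \<zero>"
  using isg unfolding inverse_semigroup_def by auto

lemma ex1_inv: "x \<in> car S \<Longrightarrow> \<exists>!y. y \<in> car S \<and> x \<cdot> y \<cdot> x = x \<and> y \<cdot> x \<cdot> y = y"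
  using isg unfolding inverse_semigroup_def by simp

lemma inv_props:
  assumes "x \<in> car S"
  shows inv_car [simp]: "inv S x \<in> car S"
    and mul_inv_mul: "x \<cdot> inv S x \<cdot> x = x"
    and inv_mul_inv: "inv S x \<cdot> x \<cdot> inv S x = inv S x"
  using theI'[OF ex1_inv[OF assms]] unfolding inv_def by auto

lemma inv_eqI: "\<lbrakk>x \<in> car S; y \<in> car S; x \<cdot> y \<cdot> x = x; y \<cdot> x \<cdot> y = y\<rbrakk> \<Longrightarrow> inv S x = y"
  using the1_equality[OF ex1_inv, of x y] unfolding inv_def by auto

lemma inv_inv [simp]: "x \<in> car S \<Longrightarrow> inv S (inv S x) = x"
  by (rule inv_eqI) (auto simp: mul_inv_mul inv_mul_inv)

lemma idem_car [simp]: "idem S e \<Longrightarrow> e \<in> car S"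
  and idem_idem: "idem S e \<Longrightarrow> e \<cdot> e = e"
  unfolding idem_def by auto

lemma idem_inv: "idem S e \<Longrightarrow> inv S e = e"
  by (rule inv_eqI) (auto simp: idem_idem)

text \<open>The inverse \<open>x\<close> of \<open>ef\<close> satisfies \<open>x = fxe\<close>,
  because \<open>fxe\<close> is an inverse of \<open>ef\<close> as well. In that form it is visibly
  idempotent, hence its own inverse, hence equal to \<open>ef\<close>.\<close>

lemma idem_mul:
  assumes "idem S e" "idem S f" shows "idem S (e \<cdot> f)"
proof -
  note [simp] = idem_car[OF assms(1)] idem_car[OF assms(2)]
  let ?x = "inv S (e \<cdot> f)"
  have ee: "e \<cdot> e = e" "f \<cdot> f = f" using assms idem_idem by auto
  then have ee': "e \<cdot> (e \<cdot> w) = e \<cdot> w" "f \<cdot> (f \<cdot> w) = f \<cdot> w" if "w \<in> car S" for w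
    by (metis \<open>e \<in> car S\<close> \<open>f \<in> car S\<close> mul_assoc that)+
  have x: "?x \<in> car S" by simp
  have 1: "e \<cdot> (f \<cdot> (?x \<cdot> (e \<cdot> f))) = e \<cdot> f" using mul_inv_mul[of "e \<cdot> f"] by (simp add: mul_assoc)
  have 2: "?x \<cdot> (e \<cdot> (f \<cdot> ?x)) = ?x" using inv_mul_inv[of "e \<cdot> f"] by (simp add: mul_assoc)
  have xx: "?x \<cdot> (e \<cdot> (f \<cdot> (?x \<cdot> w))) = ?x \<cdot> w" if "w \<in> car S" for w
    using arg_cong[OF 2, of "\<lambda>u. u \<cdot> w"] that by (simp add: mul_assoc)
  have "inv S (e \<cdot> f) = f \<cdot> ?x \<cdot> e"
    by (rule inv_eqI) (simp_all add: mul_assoc ee' 1 xx x)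
  then have fxe: "?x = f \<cdot> ?x \<cdot> e" .
  have "?x \<cdot> ?x = (f \<cdot> ?x \<cdot> e) \<cdot> (f \<cdot> ?x \<cdot> e)" using fxe by simp
  also have "\<dots> = f \<cdot> ?x \<cdot> e" by (simp add: mul_assoc xx)
  finally have "idem S ?x" using fxe unfolding idem_def by simp
  then have "inv S ?x = ?x" by (rule idem_inv)
  then have "?x = e \<cdot> f" by simp
  with \<open>idem S ?x\<close> show ?thesis by simp
qed

text \<open>Since \<open>ef\<close> is idempotent it is its own inverse; but \<open>fe\<close> is
  also an inverse of \<open>ef\<close>.\<close>

lemma idem_commute:
  assumes "idem S e" "idem S f" shows "e \<cdot> f = f \<cdot> e"
proof -
  note [simp] = idem_car[OF assms(1)] idem_car[OF assms(2)]
  have ee: "e \<cdot> e = e" "f \<cdot> f = f" using assms idem_idem by auto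
  then have ee': "e \<cdot> (e \<cdot> w) = e \<cdot> w" "f \<cdot> (f \<cdot> w) = f \<cdot> w" if "w \<in> car S" for w
    by (metis \<open>e \<in> car S\<close> \<open>f \<in> car S\<close> mul_assoc that)+
  have ef: "e \<cdot> (f \<cdot> (e \<cdot> f)) = e \<cdot> f" "f \<cdot> (e \<cdot> (f \<cdot> e)) = f \<cdot> e"
    using idem_idem[OF idem_mul[OF assms]] idem_idem[OF idem_mul[OF assms(2,1)]] by (simp_all add: mul_assoc)
  have "inv S (e \<cdot> f) = f \<cdot> e"
    by (rule inv_eqI) (simp_all add: mul_assoc ee' ef)
  with idem_inv[OF idem_mul[OF assms]] show ?thesis by simp
qed

lemma idem_left_commute:
  "\<lbrakk>idem S e; idem S f; w \<in> car S\<rbrakk> \<Longrightarrow> e \<cdot> (f \<cdot> w) = f \<cdot> (e \<cdot> w)"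
  by (metis idem_car idem_commute mul_assoc)

lemma idem_zer [simp]: "idem S \<zero>" unfolding idem_def by simp

lemma inv_zer [simp]: "inv S \<zero> = \<zero>" by (simp add: idem_inv)

lemma dom_idem [simp]: "x \<in> car S \<Longrightarrow> idem S (dom S x)"
  and ran_idem [simp]: "x \<in> car S \<Longrightarrow> idem S (ran S x)"
  unfolding dom_def ran_def idem_def using inv_props by (auto simp: mul_assoc)

lemma dom_car: "x \<in> car S \<Longrightarrow> dom S x \<in> car S"
  and ran_car: "x \<in> car S \<Longrightarrow> ran S x \<in> car S"
  by auto

lemma mul_dom [simp]: "x \<in> car S \<Longrightarrow> x \<cdot> dom S x = x"
  and ran_mul [simp]: "x \<in> car S \<Longrightarrow> ran S x \<cdot> x = x"
  unfolding dom_def ran_def using inv_props by (auto simp: mul_assoc)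

lemma inv_mul:
  assumes [simp]: "x \<in> car S" "y \<in> car S" shows "inv S (x \<cdot> y) = inv S y \<cdot> inv S x"
proof (rule inv_eqI)
  have c: "ran S y \<cdot> dom S x = dom S x \<cdot> ran S y" by (simp add: idem_commute)
  have "x \<cdot> y \<cdot> (inv S y \<cdot> inv S x) \<cdot> (x \<cdot> y) = x \<cdot> (ran S y \<cdot> dom S x) \<cdot> y"
    by (simp add: mul_assoc dom_def ran_def)
  also have "\<dots> = (x \<cdot> dom S x) \<cdot> (ran S y \<cdot> y)" unfolding c by (simp only: mul_assoc assms dom_car ran_car mul_car)
  finally show "x \<cdot> y \<cdot> (inv S y \<cdot> inv S x) \<cdot> (x \<cdot> y) = x \<cdot> y" by simp
  have "inv S y \<cdot> inv S x \<cdot> (x \<cdot> y) \<cdot> (inv S y \<cdot> inv S x) = inv S y \<cdot> (dom S x \<cdot> ran S y) \<cdot> inv S x"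
    by (simp add: mul_assoc dom_def ran_def)
  also have "\<dots> = (inv S y \<cdot> y \<cdot> inv S y) \<cdot> (inv S x \<cdot> x \<cdot> inv S x)"
    unfolding c[symmetric] by (simp add: mul_assoc dom_def ran_def)
  finally show "inv S y \<cdot> inv S x \<cdot> (x \<cdot> y) \<cdot> (inv S y \<cdot> inv S x) = inv S y \<cdot> inv S x" by (simp add: inv_mul_inv)
qed auto

lemma dom_inv [simp]: "x \<in> car S \<Longrightarrow> dom S (inv S x) = ran S x"
  unfolding dom_def ran_def by auto

lemma dom_of_idem [simp]: "idem S e \<Longrightarrow> dom S e = e"
  unfolding dom_def by (simp_all add: idem_inv idem_idem)

lemma conj_idem:
  assumes e: "idem S e" and [simp]: "x \<in> car S" shows "idem S (inv S x \<cdot> e \<cdot> x)"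
proof -
  have "(inv S x \<cdot> e \<cdot> x) \<cdot> (inv S x \<cdot> e \<cdot> x) = inv S x \<cdot> (e \<cdot> (ran S x \<cdot> (e \<cdot> x)))"
    using e by (simp add: mul_assoc ran_def)
  also have "\<dots> = inv S x \<cdot> (e \<cdot> (e \<cdot> (ran S x \<cdot> x)))"
    using e idem_left_commute[of "ran S x" e x] by simp
  also have "\<dots> = inv S x \<cdot> ((e \<cdot> e) \<cdot> x)" using e by (simp add: mul_assoc)
  also have "\<dots> = inv S x \<cdot> e \<cdot> x" using e by (simp add: idem_idem mul_assoc)
  finally show ?thesis using e unfolding idem_def by simp
qed

text \<open>The substitute for commuting \<open>e\<close> with \<open>x\<close>: an idempotent
  changes sides at the price of a conjugation.\<close>

lemma idem_push:
  assumes e: "idem S e" and [simp]: "x \<in> car S" shows "e \<cdot> x = x \<cdot> (inv S x \<cdot> e \<cdot> x)"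
proof -
  have "x \<cdot> (inv S x \<cdot> e \<cdot> x) = ran S x \<cdot> (e \<cdot> x)" using e by (simp add: mul_assoc ran_def)
  also have "\<dots> = e \<cdot> (ran S x \<cdot> x)" using e by (intro idem_left_commute) auto
  finally show ?thesis by simp
qed

lemma idem_push':
  assumes e: "idem S e" and [simp]: "x \<in> car S" shows "x \<cdot> e = (x \<cdot> e \<cdot> inv S x) \<cdot> x"
proof -
  have "(x \<cdot> e \<cdot> inv S x) \<cdot> x = x \<cdot> (e \<cdot> dom S x)" using e by (simp add: mul_assoc dom_def)
  also have "\<dots> = x \<cdot> dom S x \<cdot> e" using e idem_commute[of e "dom S x"] by (simp add: mul_assoc del: mul_dom)
  finally show ?thesis by simp
qed

lemma dom_mul_idem:
  assumes e: "idem S e" and [simp]: "x \<in> car S" shows "dom S (x \<cdot> e) = dom S x \<cdot> e"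
proof -
  have "dom S (x \<cdot> e) = e \<cdot> (dom S x \<cdot> e)"
    using e unfolding dom_def by (simp add: inv_mul idem_inv mul_assoc)
  also have "\<dots> = dom S x \<cdot> (e \<cdot> e)" using e by (simp add: idem_left_commute)
  finally show ?thesis using e by (simp add: idem_idem)
qed

lemma dom_mul: "\<lbrakk>x \<in> car S; y \<in> car S\<rbrakk> \<Longrightarrow> dom S (x \<cdot> y) = inv S y \<cdot> dom S x \<cdot> y"
  by (simp add: dom_def inv_mul mul_assoc)

section \<open>The natural partial order\<close>

lemma leq_car: "x \<sqsubseteq> y \<Longrightarrow> x \<in> car S" "x \<sqsubseteq> y \<Longrightarrow> y \<in> car S"
  unfolding leq_def by auto

lemma leqD: "x \<sqsubseteq> y \<Longrightarrow> x = y \<cdot> dom S x" unfolding leq_def by auto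

lemma leqI:
  assumes e: "idem S e" and [simp]: "y \<in> car S" shows "y \<cdot> e \<sqsubseteq> y"
proof -
  have "y \<cdot> (dom S y \<cdot> e) = y \<cdot> dom S y \<cdot> e"
    using e by (simp only: mul_assoc assms dom_car idem_car)
  then show ?thesis using e unfolding leq_def by (simp add: dom_mul_idem)
qed

lemma leqI': "\<lbrakk>idem S e; y \<in> car S\<rbrakk> \<Longrightarrow> e \<cdot> y \<sqsubseteq> y"
  using idem_push[of e y] leqI[OF conj_idem[of e y]] by simp

lemma leq_dom_mul: "x \<sqsubseteq> y \<Longrightarrow> y \<cdot> dom S x = x" using leqD by simp

text \<open>The order is defined by restriction on the right. Conjugating the restricting idempotent
  to the left gives the dual form, from which stability of the order under inversion
  follows.\<close>

lemma leq_ran_mul: assumes "x \<sqsubseteq> y" shows "ran S x \<cdot> y = x"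
proof -
  note [simp] = leq_car[OF assms]
  have x: "x = y \<cdot> dom S x" using assms by (rule leqD)
  have "ran S x = y \<cdot> dom S x \<cdot> inv S y"
    by (subst x, subst ran_def, simp add: inv_mul idem_inv mul_assoc dom_mul_idem idem_left_commute)
      (metis \<open>x \<in> car S\<close> \<open>y \<in> car S\<close> dom_car dom_idem idem_idem inv_car mul_assoc)
  then show ?thesis using idem_push'[of "dom S x" y] x by simp
qed

lemma leq_refl [simp]: "x \<in> car S \<Longrightarrow> x \<sqsubseteq> x" unfolding leq_def by simp

lemma leq_trans [trans]: assumes "x \<sqsubseteq> y" "y \<sqsubseteq> z" shows "x \<sqsubseteq> z"
proof -
  note [simp] = leq_car[OF assms(1)] leq_car[OF assms(2)]
  have "x = z \<cdot> (dom S y \<cdot> dom S x)"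
    using leqD[OF assms(1)] leqD[OF assms(2)] by (metis \<open>x \<in> car S\<close> \<open>y \<in> car S\<close> \<open>z \<in> car S\<close> dom_car mul_assoc)
  then show ?thesis using leqI[OF idem_mul, of "dom S y" "dom S x" z] by simp
qed

lemma leq_inv: assumes "x \<sqsubseteq> y" shows "inv S x \<sqsubseteq> inv S y"
proof -
  note [simp] = leq_car[OF assms]
  have "inv S x = inv S y \<cdot> ran S x"
    using arg_cong[OF leq_ran_mul[OF assms], of "inv S"] by (simp add: inv_mul idem_inv)
  then show ?thesis using leqI[of "ran S x" "inv S y"] by simp
qed

lemma leq_mul: assumes "x \<sqsubseteq> y" "u \<sqsubseteq> v" shows "x \<cdot> u \<sqsubseteq> y \<cdot> v"
proof -
  note [simp] = leq_car[OF assms(1)] leq_car[OF assms(2)]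
  have "x \<cdot> u = ran S x \<cdot> y \<cdot> u" using leq_ran_mul[OF assms(1)] by simp
  also have "\<dots> = ran S x \<cdot> (y \<cdot> u)" by (simp add: mul_assoc)
  finally have 1: "x \<cdot> u \<sqsubseteq> y \<cdot> u" using leqI' by simp
  have "y \<cdot> u = y \<cdot> (v \<cdot> dom S u)" using leqD[OF assms(2)] by simp
  also have "\<dots> = y \<cdot> v \<cdot> dom S u" by (simp add: mul_assoc)
  finally have "y \<cdot> u \<sqsubseteq> y \<cdot> v" using leqI by simp
  with 1 show ?thesis by (rule leq_trans)
qed

lemma leq_mul_left: "\<lbrakk>x \<sqsubseteq> y; s \<in> car S\<rbrakk> \<Longrightarrow> s \<cdot> x \<sqsubseteq> s \<cdot> y"
  and leq_mul_right: "\<lbrakk>x \<sqsubseteq> y; s \<in> car S\<rbrakk> \<Longrightarrow> x \<cdot> s \<sqsubseteq> y \<cdot> s"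
  using leq_mul by auto

lemma leq_dom: "x \<sqsubseteq> y \<Longrightarrow> dom S x \<sqsubseteq> dom S y"
  unfolding dom_def by (intro leq_mul leq_inv)

lemma leq_antisym: assumes "x \<sqsubseteq> y" "y \<sqsubseteq> x" shows "x = y"
proof -
  note [simp] = leq_car[OF assms(1)]
  have "dom S x = dom S y \<cdot> dom S x" "dom S y = dom S x \<cdot> dom S y"
    using leqD[OF leq_dom[OF assms(1)]] leqD[OF leq_dom[OF assms(2)]] by auto
  then have "dom S x = dom S y" using idem_commute[of "dom S x" "dom S y"] by simp
  then show ?thesis using leqD[OF assms(1)] by simp
qed

lemma zer_leq [simp]: "x \<in> car S \<Longrightarrow> \<zero> \<sqsubseteq> x"
  using leqI[of \<zero> x] by simp

lemma leq_zer: "x \<sqsubseteq> \<zero> \<Longrightarrow> x = \<zero>"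
  using leqD leq_car by fastforce

lemma leq_idem: "\<lbrakk>x \<sqsubseteq> e; idem S e\<rbrakk> \<Longrightarrow> idem S x"
  using leqD[of x e] idem_mul[of e "dom S x"] leq_car[of x e] by simp

lemma idem_leq_iff: "\<lbrakk>idem S e; idem S f\<rbrakk> \<Longrightarrow> e \<sqsubseteq> f \<longleftrightarrow> f \<cdot> e = e"
  unfolding leq_def by auto

lemma idem_leq_iff': "\<lbrakk>idem S e; idem S f\<rbrakk> \<Longrightarrow> e \<sqsubseteq> f \<longleftrightarrow> e \<cdot> f = e"
  by (simp add: idem_leq_iff idem_commute)

lemma idem_glb:
  assumes "idem S e" "idem S f" "x \<sqsubseteq> e" "x \<sqsubseteq> f" shows "x \<sqsubseteq> e \<cdot> f"
  using leq_mul[OF assms(3,4)] leq_idem[OF assms(3,1)] idem_idem by auto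

lemma idem_mul_leq: "\<lbrakk>idem S e; idem S f\<rbrakk> \<Longrightarrow> e \<cdot> f \<sqsubseteq> e" "\<lbrakk>idem S e; idem S f\<rbrakk> \<Longrightarrow> e \<cdot> f \<sqsubseteq> f"
  by (auto intro: leqI leqI')

lemma dom_absorb: "\<lbrakk>x \<in> car S; idem S e; dom S x \<sqsubseteq> e\<rbrakk> \<Longrightarrow> x \<cdot> e = x"
  by (metis dom_idem idem_car idem_leq_iff' mul_assoc mul_dom)

lemma leq_mulI: "\<lbrakk>x \<sqsubseteq> y; idem S e; dom S x \<sqsubseteq> e\<rbrakk> \<Longrightarrow> x \<sqsubseteq> y \<cdot> e"
  using leq_mul_right[of x y e] dom_absorb[of x e] leq_car(1)[of x y] by simp

lemma dom_mul_leq: "\<lbrakk>x \<in> car S; y \<in> car S\<rbrakk> \<Longrightarrow> dom S (x \<cdot> y) \<sqsubseteq> dom S y"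
proof -
  assume [simp]: "x \<in> car S" "y \<in> car S"
  have "inv S y \<cdot> (dom S x \<cdot> y) \<sqsubseteq> inv S y \<cdot> y" by (intro leq_mul_left leqI') auto
  then show ?thesis by (simp add: dom_mul) (simp add: dom_def mul_assoc)
qed

section \<open>Compatibility and joins\<close>

lemma compatible_sym: "\<lbrakk>x \<in> car S; y \<in> car S; compatible S x y\<rbrakk> \<Longrightarrow> compatible S y x"
  unfolding compatible_def
  by (metis idem_inv inv_car inv_inv inv_mul)

text \<open>Both products lie below \<open>dom S z\<close> or \<open>ran S z\<close>, and everything
  below an idempotent is idempotent.\<close>

lemma bounded_compatible: assumes "x \<sqsubseteq> z" "y \<sqsubseteq> z" shows "compatible S x y"
proof -
  note [simp] = leq_car[OF assms(1)]
  have "inv S x \<cdot> y \<sqsubseteq> inv S z \<cdot> z" "x \<cdot> inv S y \<sqsubseteq> z \<cdot> inv S z"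
    using assms by (auto intro: leq_mul leq_inv)
  then show ?thesis unfolding compatible_def
    by (metis \<open>z \<in> car S\<close> dom_def dom_idem leq_idem ran_def ran_idem)
qed

lemma is_join_unique: "\<lbrakk>is_join S X j; is_join S X k\<rbrakk> \<Longrightarrow> j = k"
  unfolding is_join_def by (blast intro: leq_antisym)

lemma join_eq: "is_join S X j \<Longrightarrow> join S X = j"
  unfolding join_def by (blast intro: is_join_unique)

lemma is_join_car: "is_join S X j \<Longrightarrow> j \<in> car S"
  and is_join_upper: "\<lbrakk>is_join S X j; x \<in> X\<rbrakk> \<Longrightarrow> x \<sqsubseteq> j"
  unfolding is_join_def by auto

lemma is_join_least: "\<lbrakk>is_join S X j; u \<in> car S; \<And>x. x \<in> X \<Longrightarrow> x \<sqsubseteq> u\<rbrakk> \<Longrightarrow> j \<sqsubseteq> u"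
  unfolding is_join_def by auto

lemma is_join2: "is_join S {x, y} z \<Longrightarrow> x \<sqsubseteq> z" "is_join S {x, y} z \<Longrightarrow> y \<sqsubseteq> z"
  unfolding is_join_def by auto

lemma is_join2_least: "\<lbrakk>is_join S {x, y} z; x \<sqsubseteq> u; y \<sqsubseteq> u\<rbrakk> \<Longrightarrow> z \<sqsubseteq> u"
  unfolding is_join_def using leq_car by auto

lemma is_join_empty: "is_join S {} \<zero>" unfolding is_join_def by auto

lemma is_join_zer: "x \<in> car S \<Longrightarrow> is_join S {x, \<zero>} x" unfolding is_join_def by auto

lemma is_join_absorb: "x \<sqsubseteq> y \<Longrightarrow> is_join S {x, y} y" unfolding is_join_def using leq_car by auto

lemma is_join_insert:
  assumes "is_join S F j'" "is_join S {x, j'} j" shows "is_join S (insert x F) j"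
  using assms unfolding is_join_def by (auto intro: leq_trans)

lemma is_join_inv:
  assumes "X \<subseteq> car S" "is_join S X j" shows "is_join S (inv S ` X) (inv S j)"
  unfolding is_join_def
proof (intro conjI ballI impI)
  show "inv S j \<in> car S" using assms is_join_car by auto
  show "y \<sqsubseteq> inv S j" if "y \<in> inv S ` X" for y using that assms unfolding is_join_def by (auto intro: leq_inv)
  show "inv S j \<sqsubseteq> u" if u: "u \<in> car S" "\<forall>x\<in>inv S ` X. x \<sqsubseteq> u" for u
  proof -
    have "x \<sqsubseteq> inv S u" if "x \<in> X" for x
      using leq_inv[of "inv S x" u] u that assms(1) by force
    then have "j \<sqsubseteq> inv S u" using is_join_least[OF assms(2)] u by simp
    then show ?thesis using leq_inv u by fastforce
  qed
qed

text \<open>Each idempotent \<open>y\<close> equals \<open>dom S y\<close>, so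
  \<open>dom S k\<close> is an upper bound of \<open>Y\<close> and \<open>k\<close> lies below an
  idempotent.\<close>

lemma idem_join:
  assumes "\<And>y. y \<in> Y \<Longrightarrow> idem S y" "is_join S Y k" shows "idem S k"
proof -
  have k: "k \<in> car S" using assms(2) by (rule is_join_car)
  have "k \<sqsubseteq> dom S k"
    using is_join_least[OF assms(2), of "dom S k"] k leq_dom[OF is_join_upper[OF assms(2)]] assms(1)
    by fastforce
  then show ?thesis using k by (blast intro: leq_idem dom_idem)
qed

end

section \<open>Boolean inverse semigroups\<close>

context isg begin

text \<open>Adding \<open>x\<close> to a set with join \<open>j'\<close> requires \<open>x\<close>
  and \<open>j'\<close> to be compatible. Distributivity, carried along in the induction, exhibits
  \<open>inv S x \<cdot> j'\<close> as a join of idempotents, hence as an idempotent.\<close>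

lemma finite_join_distrib:
  assumes bin: "\<And>x y. \<lbrakk>x \<in> car S; y \<in> car S; compatible S x y\<rbrakk> \<Longrightarrow>
      \<exists>z. is_join S {x, y} z \<and> (\<forall>s\<in>car S. is_join S {s \<cdot> x, s \<cdot> y} (s \<cdot> z) \<and> is_join S {x \<cdot> s, y \<cdot> s} (z \<cdot> s))"
    and "finite X" "X \<subseteq> car S" "\<forall>x\<in>X. \<forall>y\<in>X. compatible S x y"
  shows "\<exists>j. is_join S X j \<and> (\<forall>s\<in>car S. is_join S (mul S s ` X) (s \<cdot> j) \<and> is_join S ((\<lambda>x. x \<cdot> s) ` X) (j \<cdot> s))"
  using assms(2-)
proof (induction X rule: finite_induct)
  case empty
  show ?case by (rule exI[of _ \<zero>]) (auto simp: is_join_empty)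
next
  case (insert x F)
  then obtain j' where j': "is_join S F j'"
    and d: "\<And>s. s \<in> car S \<Longrightarrow> is_join S (mul S s ` F) (s \<cdot> j')"
    and d': "\<And>s. s \<in> car S \<Longrightarrow> is_join S ((\<lambda>x. x \<cdot> s) ` F) (j' \<cdot> s)" by auto
  have [simp]: "x \<in> car S" "j' \<in> car S" using insert.prems j' is_join_car by auto
  have F: "F \<subseteq> car S" using insert.prems by auto
  have "idem S (inv S x \<cdot> j')"
    by (rule idem_join[OF _ d]) (use insert.prems in \<open>auto simp: compatible_def\<close>)
  moreover have "idem S (j' \<cdot> inv S x)"
    by (rule idem_join[OF _ d'])
      (use insert.prems in \<open>auto simp: compatible_def\<close>)
  then have "idem S (x \<cdot> inv S j')"
    using idem_inv[of "j' \<cdot> inv S x"] by (simp add: inv_mul)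
  ultimately have "compatible S x j'" by (simp add: compatible_def)
  then obtain z where z: "is_join S {x, j'} z"
    and zd: "\<forall>s\<in>car S. is_join S {s \<cdot> x, s \<cdot> j'} (s \<cdot> z) \<and> is_join S {x \<cdot> s, j' \<cdot> s} (z \<cdot> s)"
    using bin[of x j'] by auto
  show ?case
    using is_join_insert[OF j' z] is_join_insert[OF d] is_join_insert[OF d'] zd by auto
qed

lemma boolean_isgI:
  assumes bin: "\<And>x y. \<lbrakk>x \<in> car S; y \<in> car S; compatible S x y\<rbrakk> \<Longrightarrow>
      \<exists>z. is_join S {x, y} z \<and> (\<forall>s\<in>car S. is_join S {s \<cdot> x, s \<cdot> y} (s \<cdot> z) \<and> is_join S {x \<cdot> s, y \<cdot> s} (z \<cdot> s))"
    and compl: "\<And>e f. \<lbrakk>idem S e; idem S f; e \<sqsubseteq> f\<rbrakk> \<Longrightarrow> \<exists>g. idem S g \<and> e \<cdot> g = \<zero> \<and> is_join S {e, g} f"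
  shows "boolean_isg S"
  unfolding boolean_isg_def
proof (intro conjI allI impI)
  fix X assume "finite X \<and> X \<subseteq> car S \<and> (\<forall>x\<in>X. \<forall>y\<in>X. compatible S x y)"
  then obtain j where j: "is_join S X j"
    and "\<forall>s\<in>car S. is_join S (mul S s ` X) (s \<cdot> j) \<and> is_join S ((\<lambda>x. x \<cdot> s) ` X) (j \<cdot> s)"
    using finite_join_distrib[OF bin, of X] by blast
  then show "\<exists>j. is_join S X j"
    "\<forall>s\<in>car S. is_join S (mul S s ` X) (s \<cdot> join S X) \<and> is_join S ((\<lambda>x. x \<cdot> s) ` X) (join S X \<cdot> s)"
    using join_eq[OF j] by auto
qed (use isg compl in auto)

end

locale bisg = fixes S :: "'a isg" (structure) assumes bisg: "boolean_isg S"

sublocale bisg \<subseteq> isg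
  using bisg unfolding boolean_isg_def by unfold_locales auto

context bisg begin

lemma is_join_exists:
  "\<lbrakk>finite X; X \<subseteq> car S; \<And>x y. x \<in> X \<Longrightarrow> y \<in> X \<Longrightarrow> compatible S x y\<rbrakk> \<Longrightarrow> is_join S X (join S X)"
  using bisg unfolding boolean_isg_def by (metis join_eq)

lemma compatible_refl: "x \<in> car S \<Longrightarrow> compatible S x x"
  using bounded_compatible[of x x x] by simp

lemma is_join2_exists:
  assumes "x \<in> car S" "y \<in> car S" "compatible S x y"
  shows "is_join S {x, y} (join S {x, y})"
  by (rule is_join_exists) (use assms compatible_refl compatible_sym in auto)

lemma bounded_join_exists:
  "\<lbrakk>finite X; \<And>x. x \<in> X \<Longrightarrow> x \<sqsubseteq> z\<rbrakk> \<Longrightarrow> is_join S X (join S X)"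
  by (rule is_join_exists) (auto intro: leq_car bounded_compatible)

lemma is_join2_exists_bounded: "\<lbrakk>x \<sqsubseteq> z; y \<sqsubseteq> z\<rbrakk> \<Longrightarrow> \<exists>j. is_join S {x, y} j \<and> j \<sqsubseteq> z"
  using bounded_join_exists[of "{x,y}" z] is_join_least[of "{x,y}" "join S {x,y}" z] leq_car(2) by blast

lemma is_join_distrib:
  assumes j: "is_join S X j" and "finite X" and s: "s \<in> car S"
  shows is_join_mul: "is_join S (mul S s ` X) (s \<cdot> j)"
    and is_join_mul': "is_join S ((\<lambda>x. x \<cdot> s) ` X) (j \<cdot> s)"
proof -
  have "X \<subseteq> car S" "\<forall>x\<in>X. \<forall>y\<in>X. compatible S x y"
    using is_join_upper[OF j] leq_car bounded_compatible by blast+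
  then show "is_join S (mul S s ` X) (s \<cdot> j)" "is_join S ((\<lambda>x. x \<cdot> s) ` X) (j \<cdot> s)"
    using bisg assms join_eq[OF j] unfolding boolean_isg_def by auto
qed

lemma is_join2_mul: "\<lbrakk>is_join S {x, y} z; s \<in> car S\<rbrakk> \<Longrightarrow> is_join S {s \<cdot> x, s \<cdot> y} (s \<cdot> z)"
  and is_join2_mul': "\<lbrakk>is_join S {x, y} z; s \<in> car S\<rbrakk> \<Longrightarrow> is_join S {x \<cdot> s, y \<cdot> s} (z \<cdot> s)"
  using is_join_mul[of "{x,y}" z s] is_join_mul'[of "{x,y}" z s] by auto

lemma is_join2_inv:
  assumes "is_join S {x, y} z" shows "is_join S {inv S x, inv S y} (inv S z)"
  using is_join_inv[of "{x,y}" z] assms is_join2[OF assms] leq_car by auto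

text \<open>On elements below \<open>z\<close>, left multiplication by \<open>inv S z\<close> is the
  same as \<open>dom S\<close>; distributivity then carries the join over to the domains.\<close>

lemma is_join2_dom:
  assumes j: "is_join S {x, y} z" shows "is_join S {dom S x, dom S y} (dom S z)"
proof -
  have x: "x \<sqsubseteq> z" "y \<sqsubseteq> z" using is_join2[OF j] .
  note [simp] = leq_car[OF x(1)] leq_car[OF x(2)]
  have eq: "inv S z \<cdot> w = dom S w" if "w \<sqsubseteq> z" for w
  proof -
    note [simp] = leq_car[OF that]
    have w: "w = z \<cdot> dom S w" using that by (rule leqD)
    have "inv S z \<cdot> w = dom S z \<cdot> dom S w" by (subst w) (simp add: dom_def mul_assoc)
    then show ?thesis using leqD[OF leq_dom[OF that]] by simp
  qed
  show ?thesis using is_join2_mul[OF j, of "inv S z"] eq[OF x(1)] eq[OF x(2)] eq[of z] by simp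
qed

lemma complement_exists:
  assumes "idem S e" "idem S f" "e \<sqsubseteq> f"
  shows "\<exists>g. idem S g \<and> e \<cdot> g = \<zero> \<and> is_join S {e, g} f"
  using bisg assms unfolding boolean_isg_def by blast

text \<open>The definite description in \<open>diff\<close> needs a unique witness. It is
  \<open>a \<cdot> g\<close>, where \<open>g\<close> is the complement of \<open>dom S b\<close> in
  \<open>dom S a\<close>, which the Boolean algebra of idempotents provides.\<close>

lemma diff_props:
  assumes ba: "b \<sqsubseteq> a"
  shows diff_leq: "diff S a b \<sqsubseteq> a" and diff_dom: "dom S (diff S a b) \<cdot> dom S b = \<zero>"
    and diff_join: "is_join S {b, diff S a b} a"
proof -
  note [simp] = leq_car[OF ba]
  let ?P = "\<lambda>c. c \<sqsubseteq> a \<and> dom S c \<cdot> dom S b = \<zero> \<and> ran S c \<cdot> ran S b = \<zero> \<and> is_join S {b, c} a"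
  obtain g where g: "idem S g" "dom S b \<cdot> g = \<zero>" and j: "is_join S {dom S b, g} (dom S a)"
    using complement_exists[OF dom_idem dom_idem leq_dom[OF ba]] by auto
  have gc [simp]: "g \<in> car S" using g by simp
  have ga: "g \<sqsubseteq> dom S a" using is_join2[OF j] by simp
  have dg: "dom S (a \<cdot> g) = g" using g ga by (simp add: dom_mul_idem idem_leq_iff)
  have "ran S (a \<cdot> g) \<cdot> ran S b = a \<cdot> g \<cdot> (inv S (a \<cdot> g) \<cdot> b) \<cdot> inv S b"
    by (simp add: ran_def mul_assoc)
  also have "inv S (a \<cdot> g) \<cdot> b = inv S (a \<cdot> g) \<cdot> (a \<cdot> dom S b)" using leqD[OF ba] by simp
  also have "\<dots> = g \<cdot> (dom S a \<cdot> dom S b)" using g by (simp add: inv_mul idem_inv dom_def mul_assoc)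
  also have "\<dots> = \<zero>" using g leqD[OF leq_dom[OF ba]] by (simp add: idem_commute[of g "dom S b"])
  finally have r: "ran S (a \<cdot> g) \<cdot> ran S b = \<zero>" by simp
  have ex: "?P (a \<cdot> g)"
    using is_join2_mul[OF j, of a] leqD[OF ba] g r dg leqI[of g a]
    by (simp add: idem_commute[of g "dom S b"])
  \<comment> \<open>Restricting \<open>a\<close>, the join of \<open>b\<close> and \<open>d\<close>,
    to the domain of \<open>c\<close> kills \<open>b\<close> and leaves
    \<open>c = d \<cdot> dom S c\<close>. Exchanging the roles shows that two candidates
    coincide.\<close>
  have uni: "c \<sqsubseteq> d" if c: "?P c" and d: "?P d" for c d
  proof -
    have [simp]: "c \<in> car S" "d \<in> car S" using c d leq_car by auto
    have "is_join S {b \<cdot> dom S c, d \<cdot> dom S c} (a \<cdot> dom S c)" using is_join2_mul'[of b d a "dom S c"] d by simp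
    moreover have "b \<cdot> dom S c = b \<cdot> (dom S b \<cdot> dom S c)" by (simp add: mul_assoc[symmetric])
    moreover have "dom S b \<cdot> dom S c = \<zero>" using c by (simp add: idem_commute[of "dom S b"])
    ultimately have "is_join S {\<zero>, d \<cdot> dom S c} c" using c leqD[of c a] by simp
    then have "c = d \<cdot> dom S c" using is_join_unique[of "{\<zero>, d \<cdot> dom S c}"] is_join_zer[of "d \<cdot> dom S c"] by (simp add: insert_commute)
    then show ?thesis using leqI[of "dom S c" d] by simp
  qed
  have "?P (diff S a b)" unfolding diff_def
    by (rule theI[of ?P, OF ex]) (use uni ex leq_antisym in blast)
  then show "diff S a b \<sqsubseteq> a" "dom S (diff S a b) \<cdot> dom S b = \<zero>" "is_join S {b, diff S a b} a" by auto
qed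

lemma diff_car: "b \<sqsubseteq> a \<Longrightarrow> diff S a b \<in> car S" using diff_leq leq_car by blast

lemma disjoint_dom_bounded:
  assumes "x \<in> car S" "y \<in> car S" "dom S x \<cdot> dom S y = \<zero>" "z \<sqsubseteq> x" "z \<sqsubseteq> y" shows "z = \<zero>"
proof -
  have "dom S z \<sqsubseteq> dom S x \<cdot> dom S y" using assms by (intro idem_glb leq_dom) auto
  then have "dom S z = \<zero>" using assms(3) leq_zer by simp
  then show ?thesis using leqD[OF assms(4)] assms(1) by simp
qed

text \<open>On the domain of the difference, \<open>c\<close> vanishes, so there \<open>a\<close>
  agrees with \<open>u\<close>. Hence any decomposition of \<open>a\<close> bounds
  \<open>diff\<close>, which is how membership of differences in an ideal is obtained.\<close>

lemma diff_leq_join: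
  assumes j: "is_join S {c, u} a" shows "diff S a c \<sqsubseteq> u"
proof -
  have c: "c \<sqsubseteq> a" and u: "u \<sqsubseteq> a" using is_join2[OF j] by auto
  note [simp] = leq_car[OF c] leq_car[OF u] diff_car[OF c]
  let ?d = "diff S a c"
  have "is_join S {c \<cdot> dom S ?d, u \<cdot> dom S ?d} (a \<cdot> dom S ?d)" by (rule is_join2_mul'[OF j]) simp
  moreover have "c \<cdot> dom S ?d = c \<cdot> (dom S c \<cdot> dom S ?d)" by (simp add: mul_assoc[symmetric])
  moreover have "dom S c \<cdot> dom S ?d = \<zero>" using diff_dom[OF c] by (simp add: idem_commute[of "dom S c"])
  ultimately have "is_join S {\<zero>, u \<cdot> dom S ?d} ?d" using leqD[OF diff_leq[OF c]] by simp
  then have "?d = u \<cdot> dom S ?d" using is_join_unique[of "{\<zero>, u \<cdot> dom S ?d}"] is_join_zer[of "u \<cdot> dom S ?d"] by (simp add: insert_commute)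
  then show ?thesis using leqI[of "dom S ?d" u] by simp
qed

lemma diff_eqI:
  assumes j: "is_join S {b, c} a" and d: "dom S c \<cdot> dom S b = \<zero>"
  shows "diff S a b = c"
proof (rule leq_antisym)
  show "diff S a b \<sqsubseteq> c" by (rule diff_leq_join[OF j])
  have b: "b \<sqsubseteq> a" and c: "c \<sqsubseteq> a" using is_join2[OF j] by auto
  note [simp] = leq_car[OF b] leq_car[OF c] diff_car[OF b]
  let ?d = "diff S a b"
  have "is_join S {b \<cdot> dom S c, ?d \<cdot> dom S c} (a \<cdot> dom S c)" by (rule is_join2_mul'[OF diff_join[OF b]]) simp
  moreover have "b \<cdot> dom S c = b \<cdot> (dom S b \<cdot> dom S c)" by (simp add: mul_assoc[symmetric])
  moreover have "dom S b \<cdot> dom S c = \<zero>" using d by (simp add: idem_commute[of "dom S b"])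
  ultimately have "is_join S {\<zero>, ?d \<cdot> dom S c} c" using leqD[OF c] by simp
  then have "c = ?d \<cdot> dom S c" using is_join_unique[of "{\<zero>, ?d \<cdot> dom S c}"] is_join_zer[of "?d \<cdot> dom S c"] by (simp add: insert_commute)
  then show "c \<sqsubseteq> ?d" using leqI[of "dom S c" ?d] by simp
qed

end

section \<open>Subsemigroups\<close>

lemma isg_car_cong:
  fixes S :: "'a isg"
  assumes S: "isg S" and Z: "Z \<subseteq> car S" and T: "T = \<lparr>car = Z, mul = mul S, zer = zer S\<rparr>"
    and z: "zer S \<in> Z" and m: "\<And>x y. x \<in> Z \<Longrightarrow> y \<in> Z \<Longrightarrow> mul S x y \<in> Z"
    and i: "\<And>x. x \<in> Z \<Longrightarrow> inv S x \<in> Z"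
  shows "isg T" "\<And>x. x \<in> Z \<Longrightarrow> inv T x = inv S x"
    "\<And>x y. leq T x y \<longleftrightarrow> x \<in> Z \<and> y \<in> Z \<and> leq S x y"
    "\<And>x y. \<lbrakk>x \<in> Z; y \<in> Z\<rbrakk> \<Longrightarrow> compatible T x y \<longleftrightarrow> compatible S x y"
    "\<And>x. idem T x \<longleftrightarrow> x \<in> Z \<and> idem S x"
    "\<And>X z. \<lbrakk>X \<subseteq> Z; z \<in> Z; is_join S X z\<rbrakk> \<Longrightarrow> is_join T X z"
proof -
  interpret S: isg S by fact
  have [simp]: "car T = Z" "zer T = zer S" "mul T = mul S" using T by auto
  have Zc: "x \<in> Z \<Longrightarrow> x \<in> car S" for x using Z by auto
  show T': "isg T"
  proof (unfold_locales, rule inverse_semigroupI)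
    fix x assume "x \<in> car T"
    then have "x \<in> Z" by simp
    then show "\<exists>y\<in>car T. mul T (mul T x y) x = x \<and> mul T (mul T y x) y = y"
      using i Zc S.mul_inv_mul S.inv_mul_inv by (intro bexI[of _ "inv S x"]) auto
  next
    fix e f assume "e \<in> car T" "f \<in> car T" "mul T e e = e" "mul T f f = f"
    then have "idem S e" "idem S f" unfolding idem_def using Zc by auto
    then show "mul T e f = mul T f e" using S.idem_commute by simp
  qed (use z m Zc S.mul_assoc in auto)
  interpret T: isg T by fact
  show inv: "inv T x = inv S x" if "x \<in> Z" for x
    by (rule T.inv_eqI) (use that i Zc S.mul_inv_mul S.inv_mul_inv in auto)
  show id: "idem T x \<longleftrightarrow> x \<in> Z \<and> idem S x" for x
    unfolding idem_def using Zc by auto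
  show leq: "leq T x y \<longleftrightarrow> x \<in> Z \<and> y \<in> Z \<and> leq S x y" for x y
    unfolding leq_def dom_def using Zc inv by auto
  show "compatible T x y \<longleftrightarrow> compatible S x y" if "x \<in> Z" "y \<in> Z" for x y
    unfolding compatible_def using that id i m inv by auto
  \<comment> \<open>Joins pass from \<open>S\<close> to the subsemigroup only when they lie in it; a
    join computed inside \<open>Z\<close> may be larger than the join in \<open>S\<close>.\<close>
  show "is_join T X z" if "X \<subseteq> Z" "z \<in> Z" "is_join S X z" for X z
    using that Zc unfolding is_join_def leq by auto
qed

text \<open>Closure under the joins of \<open>S\<close> makes joins in \<open>Z\<close> agree with
  those of \<open>S\<close>. Differences are demanded of idempotents, since that is where
  \<open>boolean_isg\<close> asks for complements.\<close>

lemma (in bisg) sub_boolean: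
  assumes Z: "Z \<subseteq> car S" and T: "T = \<lparr>car = Z, mul = mul S, zer = \<zero>\<rparr>"
    and z: "\<zero> \<in> Z" and m: "\<And>x y. x \<in> Z \<Longrightarrow> y \<in> Z \<Longrightarrow> x \<cdot> y \<in> Z"
    and i: "\<And>x. x \<in> Z \<Longrightarrow> inv S x \<in> Z"
    and j: "\<And>x y z. \<lbrakk>x \<in> Z; y \<in> Z; is_join S {x, y} z\<rbrakk> \<Longrightarrow> z \<in> Z"
    and d: "\<And>e f. \<lbrakk>e \<in> Z; f \<in> Z; idem S e; idem S f; e \<sqsubseteq> f\<rbrakk> \<Longrightarrow> diff S f e \<in> Z"
  shows "boolean_isg T" "\<And>x y. \<lbrakk>x \<in> Z; y \<in> Z; compatible S x y\<rbrakk> \<Longrightarrow> join T {x, y} = join S {x, y}"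
proof -
  note sub = isg_car_cong[OF isg_axioms Z T z m i]
  interpret T: isg T using sub(1) by blast
  have [simp]: "car T = Z" "zer T = \<zero>" "mul T = mul S" using T by auto
  have Zc: "x \<in> Z \<Longrightarrow> x \<in> car S" for x using Z by auto
  have jT: "is_join T {x, y} z" if "is_join S {x, y} z" "x \<in> Z" "y \<in> Z" for x y z
    by (rule sub(6)) (use that j[of x y z] in auto)
  show "join T {x, y} = join S {x, y}" if "x \<in> Z" "y \<in> Z" "compatible S x y" for x y
    using T.join_eq[OF jT[OF is_join2_exists]] that Zc by simp
  show "boolean_isg T"
  proof (rule T.boolean_isgI)
    fix x y assume xy: "x \<in> car T" "y \<in> car T" "compatible T x y"
    then have x: "x \<in> Z" "y \<in> Z" "compatible S x y" using sub(4) by auto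
    then have j0: "is_join S {x, y} (join S {x, y})" using Zc is_join2_exists by auto
    show "\<exists>z. is_join T {x, y} z \<and> (\<forall>s\<in>car T. is_join T {mul T s x, mul T s y} (mul T s z) \<and>
        is_join T {mul T x s, mul T y s} (mul T z s))"
      using jT[OF j0] jT[OF is_join2_mul[OF j0]] jT[OF is_join2_mul'[OF j0]] x m Zc by auto
  next
    fix e f assume "idem T e" "idem T f" "leq T e f"
    then have ef: "e \<in> Z" "f \<in> Z" "idem S e" "idem S f" "e \<sqsubseteq> f" using sub(3,5) by auto
    let ?g = "diff S f e"
    have g: "idem S ?g" "?g \<in> Z" using leq_idem[OF diff_leq] d ef by auto
    moreover have "e \<cdot> ?g = \<zero>" using diff_dom[OF ef(5)] ef g by (simp add: idem_commute)
    ultimately show "\<exists>g. idem T g \<and> mul T e g = zer T \<and> is_join T {e, g} f"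
      using sub(5)[of ?g] jT[OF diff_join[OF ef(5)]] ef by auto
  qed
qed

section \<open>Homomorphisms and transport of structure\<close>

locale isg_hom = S: isg S + T: isg T for S :: "'a isg" and T :: "'b isg" +
  fixes h :: "'a \<Rightarrow> 'b"
  assumes hom: "hom S T h"
begin

lemma hom_car [simp]: "x \<in> car S \<Longrightarrow> h x \<in> car T"
  and hom_mul: "\<lbrakk>x \<in> car S; y \<in> car S\<rbrakk> \<Longrightarrow> h (mul S x y) = mul T (h x) (h y)"
  and hom_zer [simp]: "h (zer S) = zer T"
  using hom unfolding hom_def by auto

lemma hom_inv: "x \<in> car S \<Longrightarrow> h (inv S x) = inv T (h x)"
  by (rule T.inv_eqI[symmetric]) (simp_all add: hom_mul[symmetric] S.mul_inv_mul S.inv_mul_inv)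

lemma hom_dom: "x \<in> car S \<Longrightarrow> h (dom S x) = dom T (h x)"
  by (simp add: dom_def hom_mul hom_inv)

lemma hom_leq: "leq S x y \<Longrightarrow> leq T (h x) (h y)"
  unfolding leq_def by (metis hom_car hom_dom hom_mul S.dom_car)

lemma hom_idem: "idem S e \<Longrightarrow> idem T (h e)"
  unfolding idem_def by (metis hom_car hom_mul)

lemma hom_compatible: "\<lbrakk>x \<in> car S; y \<in> car S; compatible S x y\<rbrakk> \<Longrightarrow> compatible T (h x) (h y)"
  unfolding compatible_def using hom_idem hom_mul hom_inv by (metis S.inv_car)

end

section \<open>Copies along injections, and test objects of bounded size\<close>

definition transport :: "('a \<Rightarrow> 'b) \<Rightarrow> 'a isg \<Rightarrow> 'b isg" where
  "transport f S = \<lparr>car = f ` car S,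
     mul = (\<lambda>x y. f (mul S (the_inv_into (car S) f x) (the_inv_into (car S) f y))), zer = f (zer S)\<rparr>"

context isg begin

lemma transport_isg:
  assumes f: "inj_on f (car S)"
  shows "isg (transport f S)" "hom S (transport f S) f"
proof -
  let ?T = "transport f S"
  have [simp]: "car ?T = f ` car S" "zer ?T = f \<zero>" by (simp_all add: transport_def)
  have [simp]: "mul ?T (f x) (f y) = f (x \<cdot> y)" if "x \<in> car S" "y \<in> car S" for x y
    using that f by (simp add: transport_def the_inv_into_f_f)
  have [simp]: "f x = f y \<longleftrightarrow> x = y" if "x \<in> car S" "y \<in> car S" for x y
    using f that by (auto dest: inj_onD)
  show "isg ?T"
  proof (unfold_locales, rule inverse_semigroupI)
    fix e g assume "e \<in> car ?T" "g \<in> car ?T" "mul ?T e e = e" "mul ?T g g = g"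
    then obtain x y where xy: "x \<in> car S" "e = f x" "y \<in> car S" "g = f y" by auto
    then have "idem S x" "idem S y"
      using \<open>mul ?T e e = e\<close> \<open>mul ?T g g = g\<close> unfolding idem_def by auto
    then show "mul ?T e g = mul ?T g e" using xy idem_commute[of x y] by simp
  next
    fix y assume "y \<in> car ?T"
    then obtain x where "x \<in> car S" "y = f x" by auto
    then show "\<exists>z\<in>car ?T. mul ?T (mul ?T y z) y = y \<and> mul ?T (mul ?T z y) z = z"
      by (intro bexI[of _ "f (inv S x)"]) (auto simp: mul_inv_mul inv_mul_inv)
  qed (auto simp: mul_assoc)
  show "hom S ?T f" unfolding hom_def by simp
qed

lemma transport_leq:
  assumes f: "inj_on f (car S)" and "x \<in> car S" "y \<in> car S"
  shows "leq (transport f S) (f x) (f y) \<longleftrightarrow> x \<sqsubseteq> y"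
proof -
  interpret h: isg_hom S "transport f S" f
    using transport_isg[OF f] by (intro isg_hom.intro isg_axioms isg_hom_axioms.intro)
  have "f x = f (y \<cdot> dom S x) \<longleftrightarrow> x = y \<cdot> dom S x" using assms by (auto dest: inj_onD)
  then show ?thesis unfolding leq_def using assms h.hom_dom h.hom_mul by simp
qed

lemma transport_is_join:
  assumes f: "inj_on f (car S)" and X: "X \<subseteq> car S" and j: "is_join S X j"
  shows "is_join (transport f S) (f ` X) (f j)"
proof -
  have "car (transport f S) = f ` car S" by (simp add: transport_def)
  then show ?thesis
    using j X transport_leq[OF f] unfolding is_join_def by (auto simp: subset_iff)
qed

end

lemma (in bisg) transport_boolean:
  assumes f: "inj_on f (car S)"
  shows "boolean_isg (transport f S)"
    "\<And>x y. \<lbrakk>x \<in> car S; y \<in> car S; compatible S x y\<rbrakk> \<Longrightarrow> join (transport f S) {f x, f y} = f (join S {x, y})"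
proof -
  let ?T = "transport f S"
  interpret h: isg_hom S ?T f
    by (rule isg_hom.intro[OF isg_axioms transport_isg(1)[OF f] isg_hom_axioms.intro[OF transport_isg(2)[OF f]]])
  have [simp]: "car ?T = f ` car S" unfolding transport_def by (rule isg.select_convs)
  have inj: "f x = f y \<longleftrightarrow> x = y" if "x \<in> car S" "y \<in> car S" for x y
    using f that by (auto dest: inj_onD)
  have id: "idem S x" if "x \<in> car S" "idem ?T (f x)" for x
    using that inj[of "x \<cdot> x" x] h.hom_mul[of x x] unfolding idem_def by simp
  have comp: "compatible S x y" if "x \<in> car S" "y \<in> car S" "compatible ?T (f x) (f y)" for x y
    using that id unfolding compatible_def by (simp flip: h.hom_inv h.hom_mul)
  have jT: "is_join ?T {f x, f y} (f z)" if "is_join S {x, y} z" for x y z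
    using transport_is_join[OF f _ that] is_join2[OF that] leq_car by auto
  show "join ?T {f x, f y} = f (join S {x, y})" if "x \<in> car S" "y \<in> car S" "compatible S x y" for x y
    using h.T.join_eq[OF jT[OF is_join2_exists[OF that]]] .
  show "boolean_isg ?T"
  proof (rule h.T.boolean_isgI)
    fix a b assume "a \<in> car ?T" "b \<in> car ?T" "compatible ?T a b"
    then obtain x y where xy: "x \<in> car S" "a = f x" "y \<in> car S" "b = f y" "compatible S x y"
      using comp by auto
    then have j: "is_join S {x, y} (join S {x, y})" using is_join2_exists by blast
    then show "\<exists>z. is_join ?T {a, b} z \<and> (\<forall>s\<in>car ?T. is_join ?T {mul ?T s a, mul ?T s b} (mul ?T s z) \<and>
        is_join ?T {mul ?T a s, mul ?T b s} (mul ?T z s))"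
      using jT[OF j] jT[OF is_join2_mul[OF j]] jT[OF is_join2_mul'[OF j]] xy is_join_car[OF j]
      by (intro exI[of _ "f (join S {x, y})"]) (auto simp flip: h.hom_mul)
  next
    fix e g assume eg: "idem ?T e" "idem ?T g" "leq ?T e g"
    then have "e \<in> f ` car S" "g \<in> f ` car S" using h.T.idem_car[of e] h.T.idem_car[of g] by auto
    then obtain x y where xy: "x \<in> car S" "e = f x" "y \<in> car S" "g = f y" by auto
    then have "idem S x" "idem S y" "x \<sqsubseteq> y" using id eg transport_leq[OF f, of x y] by auto
    then obtain k where k: "idem S k" "x \<cdot> k = \<zero>" "is_join S {x, k} y" using complement_exists by blast
    then show "\<exists>k. idem ?T k \<and> mul ?T e k = zer ?T \<and> is_join ?T {e, k} g"
      using jT[OF k(3)] h.hom_idem[OF k(1)] xy h.hom_mul[of x k] by auto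
  qed
qed

text \<open>The test objects of the universal property live on \<open>'b \<times> nat\<close>; an arbitrary Boolean inverse
  semigroup can be used as soon as it is small enough to be copied there.\<close>
lemma booleanization_universal:
  fixes S :: "'a isg" and B :: "'b isg" and T :: "'c isg"
  assumes S: "inverse_semigroup S" and B: "is_booleanization S B \<beta>" and T: "boolean_isg T" and \<theta>: "hom S T \<theta>"
    and small: "car T \<lesssim> (UNIV :: ('b \<times> nat) set)"
  shows booleanization_extend: "\<exists>\<phi>. morphism B T \<phi> \<and> (\<forall>s\<in>car S. \<phi> (\<beta> s) = \<theta> s)"
    and booleanization_unique: "\<And>\<phi> \<psi> x. \<lbrakk>morphism B T \<phi>; \<And>s. s \<in> car S \<Longrightarrow> \<phi> (\<beta> s) = \<theta> s;
       morphism B T \<psi>; \<And>s. s \<in> car S \<Longrightarrow> \<psi> (\<beta> s) = \<theta> s; x \<in> car B\<rbrakk> \<Longrightarrow> \<phi> x = \<psi> x"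
proof -
  interpret T: bisg T using T by unfold_locales
  interpret B: bisg B using B by unfold_locales (simp add: is_booleanization_def)
  obtain f :: "'c \<Rightarrow> 'b \<times> nat" where f: "inj_on f (car T)" using small unfolding lepoll_def by blast
  let ?T = "transport f T" and ?g = "the_inv_into (car T) f"
  interpret h: isg_hom T ?T f
    by (rule isg_hom.intro[OF T.isg_axioms T.transport_isg(1)[OF f] isg_hom_axioms.intro[OF T.transport_isg(2)[OF f]]])
  have gf [simp]: "?g (f x) = x" if "x \<in> car T" for x using f that by (rule the_inv_into_f_f)
  have carT [simp]: "car ?T = f ` car T" unfolding transport_def by (rule isg.select_convs)
  have bT: "boolean_isg ?T" by (rule T.transport_boolean[OF f])
  have homT: "hom S ?T (f \<circ> \<theta>)" using \<theta> h.hom_mul unfolding hom_def by auto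
  have univ: "\<And>(T :: ('b \<times> nat) isg) \<theta>. boolean_isg T \<Longrightarrow> hom S T \<theta> \<Longrightarrow>
        (\<exists>\<phi>. morphism B T \<phi> \<and> (\<forall>s\<in>car S. \<phi> (\<beta> s) = \<theta> s)) \<and>
        (\<forall>\<phi> \<psi>. morphism B T \<phi> \<and> (\<forall>s\<in>car S. \<phi> (\<beta> s) = \<theta> s) \<and>
                 morphism B T \<psi> \<and> (\<forall>s\<in>car S. \<psi> (\<beta> s) = \<theta> s) \<longrightarrow>
                 (\<forall>x\<in>car B. \<phi> x = \<psi> x))"
    using B unfolding is_booleanization_def by blast
  have mor: "morphism B ?T (f \<circ> \<phi>)" if "morphism B T \<phi>" for \<phi>
  proof -
    interpret p: isg_hom B T \<phi> using that by unfold_locales (simp add: morphism_def)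
    have "hom B ?T (f \<circ> \<phi>)" using p.hom_mul h.hom_mul unfolding hom_def by auto
    then show ?thesis
      using that T.transport_boolean(2)[OF f] p.hom_compatible unfolding morphism_def by auto
  qed
  obtain \<Phi> where \<Phi>: "morphism B ?T \<Phi>" "\<forall>s\<in>car S. \<Phi> (\<beta> s) = f (\<theta> s)"
    using univ[OF bT homT] by auto
  interpret P: isg_hom B ?T \<Phi> using \<Phi> by unfold_locales (simp add: morphism_def)
  have P: "\<exists>y\<in>car T. \<Phi> x = f y" if "x \<in> car B" for x using P.hom_car[OF that] by auto
  have "hom B T (?g \<circ> \<Phi>)"
    unfolding hom_def
  proof (intro conjI ballI)
    fix x y assume xy: "x \<in> car B" "y \<in> car B"
    then obtain u v where uv: "u \<in> car T" "\<Phi> x = f u" "v \<in> car T" "\<Phi> y = f v" using P by blast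
    then show "(?g \<circ> \<Phi>) (mul B x y) = mul T ((?g \<circ> \<Phi>) x) ((?g \<circ> \<Phi>) y)"
      using xy by (simp add: P.hom_mul h.hom_mul[symmetric])
  qed (use P in \<open>force simp flip: h.hom_zer\<close>)+
  then interpret p: isg_hom B T "?g \<circ> \<Phi>" by unfold_locales
  have "morphism B T (?g \<circ> \<Phi>)"
    unfolding morphism_def
  proof (intro conjI ballI impI p.hom)
    fix x y assume xy: "x \<in> car B" "y \<in> car B" "compatible B x y"
    then obtain u v where uv: "u \<in> car T" "\<Phi> x = f u" "v \<in> car T" "\<Phi> y = f v" using P by blast
    have c: "compatible T u v" using p.hom_compatible[OF xy] uv by simp
    have "\<Phi> (join B {x, y}) = f (join T {u, v})"
      using \<Phi>(1) xy uv T.transport_boolean(2)[OF f _ _ c] unfolding morphism_def by simp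
    then show "(?g \<circ> \<Phi>) (join B {x, y}) = join T {(?g \<circ> \<Phi>) x, (?g \<circ> \<Phi>) y}"
      using uv T.is_join_car[OF T.is_join2_exists[OF _ _ c]] by simp
  qed
  moreover have "\<forall>s\<in>car S. (?g \<circ> \<Phi>) (\<beta> s) = \<theta> s" using \<Phi>(2) \<theta> unfolding hom_def by auto
  ultimately show "\<exists>\<phi>. morphism B T \<phi> \<and> (\<forall>s\<in>car S. \<phi> (\<beta> s) = \<theta> s)" by blast
  show "\<phi> x = \<psi> x" if "morphism B T \<phi>" "\<And>s. s \<in> car S \<Longrightarrow> \<phi> (\<beta> s) = \<theta> s"
       "morphism B T \<psi>" "\<And>s. s \<in> car S \<Longrightarrow> \<psi> (\<beta> s) = \<theta> s" "x \<in> car B" for \<phi> \<psi> x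
  proof -
    have "\<forall>x\<in>car B. (f \<circ> \<phi>) x = (f \<circ> \<psi>) x"
      using univ[OF bT homT, THEN conjunct2, THEN spec, THEN spec, THEN mp, of "f \<circ> \<phi>" "f \<circ> \<psi>"]
        mor[OF that(1)] mor[OF that(3)] that(2,4) by simp
    moreover have "\<phi> x \<in> car T" "\<psi> x \<in> car T" using that unfolding morphism_def hom_def by auto
    ultimately show ?thesis using f that(5) by (auto dest: inj_onD)
  qed
qed

section \<open>Partial bijections\<close>

text \<open>The symmetric inverse monoid, with partial bijections as relations. As
  \<open>s O r\<close> runs \<open>s\<close> first, the product is composition of functions,
  matching the left action in \<open>wagner_preston\<close>.\<close>

definition pbij :: "('a \<times> 'a) set isg" where
  "pbij = \<lparr>car = {r. single_valued r \<and> single_valued (r\<inverse>)}, mul = (\<lambda>r s. s O r), zer = {}\<rparr>"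

lemma pbij_simps [simp]:
  "r \<in> car pbij \<longleftrightarrow> single_valued r \<and> single_valued (r\<inverse>)"
  "mul pbij r s = s O r" "zer pbij = {}"
  by (auto simp: pbij_def)

lemma pbij_regular: "\<lbrakk>single_valued r; single_valued (r\<inverse>)\<rbrakk> \<Longrightarrow> r O r\<inverse> O r = r"
proof (intro equalityI subsetI)
  fix p assume "single_valued (r\<inverse>)" "p \<in> r O r\<inverse> O r"
  then show "p \<in> r" unfolding single_valued_def by (cases p) blast
next
  fix p assume "p \<in> r"
  then show "p \<in> r O r\<inverse> O r" by (cases p) blast
qed

lemma pbij_idem:
  assumes "single_valued r" "single_valued (r\<inverse>)" "r O r = r" shows "r \<subseteq> Id"
proof clarify
  fix x y assume xy: "(x, y) \<in> r"
  then obtain z where "(x, z) \<in> r" "(z, y) \<in> r" using assms(3) by blast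
  then show "x = y" using assms(1,2) xy unfolding single_valued_def by blast
qed

interpretation PB: isg "pbij :: ('a \<times> 'a) set isg"
proof (unfold_locales, rule inverse_semigroupI)
  fix x :: "('a \<times> 'a) set" assume "x \<in> car pbij"
  then show "\<exists>y\<in>car pbij. mul pbij (mul pbij x y) x = x \<and>
      mul pbij (mul pbij y x) y = y"
    using pbij_regular[of x] pbij_regular[of "x\<inverse>"]
    by (intro bexI[of _ "x\<inverse>"]) (auto simp: O_assoc)
next
  fix e f :: "('a \<times> 'a) set"
  assume "e \<in> car pbij" "f \<in> car pbij"
    "mul pbij e e = e" "mul pbij f f = f"
  then have "e \<subseteq> Id" "f \<subseteq> Id" using pbij_idem by auto
  then show "mul pbij e f = mul pbij f e" by auto
next
  fix r s :: "('a \<times> 'a) set" assume "r \<in> car pbij" "s \<in> car pbij"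
  then show "mul pbij r s \<in> car pbij"
    by (simp add: single_valued_relcomp converse_relcomp)
qed (auto simp: O_assoc)

lemma PB_inv: "r \<in> car pbij \<Longrightarrow> inv pbij r = r\<inverse>"
  by (rule PB.inv_eqI)
    (use pbij_regular[of r] pbij_regular[of "r\<inverse>"] in \<open>auto simp: O_assoc\<close>)

lemma PB_idem: "idem pbij r \<longleftrightarrow> r \<subseteq> Id"
proof
  assume "r \<subseteq> Id"
  then show "idem pbij r" unfolding idem_def by (auto simp: single_valued_def)
qed (auto simp: idem_def dest!: pbij_idem)

lemma PB_leq: "leq pbij r s \<longleftrightarrow>
  r \<in> car pbij \<and> s \<in> car pbij \<and> r \<subseteq> s"
proof -
  have "r = mul pbij s (dom pbij r) \<longleftrightarrow> r \<subseteq> s"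
    if "r \<in> car pbij" "s \<in> car pbij"
  proof -
    have sv: "single_valued s" "single_valued (s\<inverse>)" "single_valued r" "single_valued (r\<inverse>)" using that by auto
    have eq: "mul pbij s (dom pbij r) = (r O r\<inverse>) O s"
      using that by (simp add: dom_def PB_inv)
    have id: "r O r\<inverse> \<subseteq> Id" using sv(4) unfolding single_valued_def by blast
    have "(r O r\<inverse>) O s \<subseteq> r" if rs: "r \<subseteq> s"
    proof
      fix p assume "p \<in> (r O r\<inverse>) O s"
      then obtain x y z w where p: "p = (x, w)" "(x, y) \<in> r" "(z, y) \<in> r" "(z, w) \<in> s" by auto
      then have "x = z" using id by auto
      then have "y = w" using single_valuedD[OF sv(1), of x y w] p rs by auto
      then show "p \<in> r" using p by simp
    qed
    moreover have "r \<subseteq> (r O r\<inverse>) O s" if "r \<subseteq> s"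
    proof (rule subrelI)
      fix x y assume "(x, y) \<in> r"
      then show "(x, y) \<in> (r O r\<inverse>) O s" using that by (intro relcompI[of x x] relcompI[of x y]) auto
    qed
    moreover have "(r O r\<inverse>) O s \<subseteq> s" using id by auto
    ultimately show ?thesis unfolding eq by blast
  qed
  then show ?thesis unfolding leq_def by blast
qed

text \<open>The order on partial bijections is inclusion, so a union that is itself a partial
  bijection is the least upper bound.\<close>

lemma PB_is_join:
  assumes "r \<in> car pbij" "s \<in> car pbij" "r \<union> s \<in> car pbij"
  shows "is_join pbij {r, s} (r \<union> s)"
  using assms unfolding is_join_def PB_leq by auto

lemma PB_compatible:
  assumes "r \<in> car pbij" "s \<in> car pbij"
  shows "compatible pbij r s \<longleftrightarrow> r \<union> s \<in> car pbij"
proof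
  assume "compatible pbij r s"
  then have "s O r\<inverse> \<subseteq> Id" "s\<inverse> O r \<subseteq> Id"
    using assms unfolding compatible_def by (simp_all add: PB_inv PB_idem)
  then have rs: "\<And>x y z. (x, y) \<in> s \<Longrightarrow> (z, y) \<in> r \<Longrightarrow> x = z"
    and sr: "\<And>x y z. (x, y) \<in> s \<Longrightarrow> (x, z) \<in> r \<Longrightarrow> y = z"
    by auto
  have "single_valued (r \<union> s)"
    using assms sr unfolding pbij_simps by (intro single_valuedI) (metis UnE single_valuedD)
  moreover have "single_valued ((r \<union> s)\<inverse>)"
    using assms rs unfolding pbij_simps by (intro single_valuedI) (metis UnE single_valuedD converse_iff)
  ultimately show "r \<union> s \<in> car pbij" by simp
next
  assume "r \<union> s \<in> car pbij"
  then show "compatible pbij r s"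
    using assms by (intro PB.bounded_compatible[of _ "r \<union> s"]) (auto simp: PB_leq)
qed

interpretation PB: bisg "pbij :: ('a \<times> 'a) set isg"
proof (unfold_locales, rule PB.boolean_isgI)
  fix r s :: "('a \<times> 'a) set"
  assume rs: "r \<in> car pbij" "s \<in> car pbij" "compatible pbij r s"
  then have u: "r \<union> s \<in> car pbij" using PB_compatible by blast
  have m: "r O s \<in> car pbij" if "r \<in> car pbij" "s \<in> car pbij"
    for r s :: "('a \<times> 'a) set" using PB.mul_car[OF that(2,1)] by simp
  have "is_join pbij {r O t, s O t} ((r \<union> s) O t)"
    "is_join pbij {t O r, t O s} (t O (r \<union> s))" if t: "t \<in> car pbij" for t
    unfolding relcomp_distrib relcomp_distrib2
    using m[OF rs(1) t] m[OF rs(2) t] m[OF u t] m[OF t rs(1)] m[OF t rs(2)] m[OF t u]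
    by (intro PB_is_join; simp only: relcomp_distrib relcomp_distrib2)+
  then show "\<exists>z. is_join pbij {r, s} z \<and> (\<forall>t\<in>car pbij.
      is_join pbij {mul pbij t r, mul pbij t s} (mul pbij t z) \<and>
      is_join pbij {mul pbij r t, mul pbij s t} (mul pbij z t))"
    using PB_is_join[OF rs(1,2) u] by (intro exI[of _ "r \<union> s"]) simp
next
  fix e f :: "('a \<times> 'a) set"
  assume "idem pbij e" "idem pbij f" "leq pbij e f"
  then have ef: "e \<subseteq> Id" "f \<subseteq> Id" "e \<subseteq> f" by (auto simp: PB_idem PB_leq)
  then have "f - e \<subseteq> Id" by blast
  moreover have "(f - e) O e = {}" using ef by blast
  moreover have "is_join pbij {e, f - e} f"
    using PB_is_join[of e "f - e"] ef \<open>f - e \<subseteq> Id\<close>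
    by (metis PB.idem_car PB_idem Un_Diff_cancel sup.order_iff sup_commute)
  ultimately show "\<exists>g. idem pbij g \<and> mul pbij e g = zer pbij \<and> is_join pbij {e, g} f"
    by (intro exI[of _ "f - e"]) (auto simp: PB_idem)
qed

lemma closure_lepoll:
  includes cardinal_syntax
  fixes X :: "'a set" and K :: "'b set"
  assumes X: "X \<lesssim> K" and K: "infinite K" and F: "finite F"
  shows "\<exists>Z. X \<subseteq> Z \<and> Z \<lesssim> K \<and> (\<forall>f\<in>F. \<forall>x\<in>Z. \<forall>y\<in>Z. f x y \<in> Z)"
proof -
  have le: "A \<lesssim> K \<longleftrightarrow> |A| \<le>o |K|" for A :: "'c set"
    unfolding lepoll_def card_of_ordLeq[symmetric] by blast
  define st where "st Y = Y \<union> (\<Union>f\<in>F. (\<lambda>(x, y). f x y) ` (Y \<times> Y))" for Y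
  define Z where "Z n = (st ^^ n) X" for n
  have finK: "|F| \<le>o |K|" using finite_lepoll_infinite[OF K F] le by blast
  have st: "|st Y| \<le>o |K|" if "|Y| \<le>o |K|" for Y
  proof -
    have "|Y \<times> Y| \<le>o |K|" using K that by (simp add: card_of_Sigma_ordLeq_infinite)
    then have "\<forall>f\<in>F. |(\<lambda>(x, y). f x y) ` (Y \<times> Y)| \<le>o |K|"
      using card_of_image ordLeq_transitive by blast
    then have "|\<Union>f\<in>F. (\<lambda>(x, y). f x y) ` (Y \<times> Y)| \<le>o |K|"
      by (rule card_of_UNION_ordLeq_infinite[OF K finK])
    then show ?thesis unfolding st_def using that K card_of_Un_ordLeq_infinite_Field[of "|K|"] card_of_Card_order
      by (metis Field_card_of)
  qed
  have Zn: "\<forall>n\<in>UNIV. |Z n| \<le>o |K|"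
  proof
    fix n show "|Z n| \<le>o |K|" unfolding Z_def using X le by (induction n) (auto intro: st)
  qed
  have "|UNIV :: nat set| \<le>o |K|" using K infinite_iff_card_of_nat by blast
  then have small: "(\<Union>n. Z n) \<lesssim> K" unfolding le by (rule card_of_UNION_ordLeq_infinite[OF K _ Zn])
  have mono: "Z m \<subseteq> Z n" if "m \<le> n" for m n
    using that by (induction rule: dec_induct) (auto simp: Z_def st_def)
  have "f x y \<in> (\<Union>n. Z n)" if f: "f \<in> F" "x \<in> (\<Union>n. Z n)" "y \<in> (\<Union>n. Z n)" for f x y
  proof -
    obtain m n where "x \<in> Z m" "y \<in> Z n" using f by blast
    then have "x \<in> Z (max m n)" "y \<in> Z (max m n)" using mono[of m "max m n"] mono[of n "max m n"] by auto
    then have "f x y \<in> Z (Suc (max m n))" using f(1) unfolding Z_def st_def by force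
    then show ?thesis by blast
  qed
  moreover have "X \<subseteq> (\<Union>n. Z n)" by (auto simp: Z_def intro!: exI[of _ 0])
  ultimately show ?thesis using small by blast
qed

section \<open>Consequences of the universal property of the Booleanization\<close>

locale isg_hom_bisg = B: bisg B + isg_hom S B \<beta>
  for S :: "'a isg" and B :: "'b isg" and \<beta> :: "'a \<Rightarrow> 'b"
begin

text \<open>Closing \<open>generated\<close> under binary joins alone suffices: products, inverses and relative complements follow.\<close>

inductive_set gen_idems :: "'b set" where
  base: "idem S e \<Longrightarrow> \<beta> e \<in> gen_idems"
| meet: "\<lbrakk>e \<in> gen_idems; f \<in> gen_idems\<rbrakk> \<Longrightarrow> mul B e f \<in> gen_idems"
| join: "\<lbrakk>e \<in> gen_idems; f \<in> gen_idems; is_join B {e, f} g\<rbrakk> \<Longrightarrow> g \<in> gen_idems"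
| diff: "\<lbrakk>e \<in> gen_idems; f \<in> gen_idems; leq B e f\<rbrakk> \<Longrightarrow> diff B f e \<in> gen_idems"

inductive_set generated :: "'b set" where
  base: "\<lbrakk>s \<in> car S; e \<in> gen_idems\<rbrakk> \<Longrightarrow> mul B (\<beta> s) e \<in> generated"
| join: "\<lbrakk>x \<in> generated; y \<in> generated; is_join B {x, y} z\<rbrakk> \<Longrightarrow> z \<in> generated"

lemma gen_idems_idem [simp]: "e \<in> gen_idems \<Longrightarrow> idem B e"
proof (induction rule: gen_idems.induct)
  case (diff e f)
  then show ?case using B.leq_idem[OF B.diff_leq] by blast
qed (auto intro: hom_idem B.idem_mul B.idem_join[of "{_, _}"])

lemma gen_idems_car [simp]: "e \<in> gen_idems \<Longrightarrow> e \<in> car B"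
  by (rule B.idem_car) (rule gen_idems_idem)

lemma gen_idems_conj:
  assumes s [simp]: "s \<in> car S"
  shows "e \<in> gen_idems \<Longrightarrow> mul B (mul B (inv B (\<beta> s)) e) (\<beta> s) \<in> gen_idems"
proof (induction rule: gen_idems.induct)
  case (base e)
  then show ?case using gen_idems.base[OF S.conj_idem[OF base s]] by (simp add: hom_mul hom_inv)
next
  case (meet e f)
  let ?c = "\<lambda>e. mul B (mul B (inv B (\<beta> s)) e) (\<beta> s)"
  have "mul B (?c e) (?c f) = mul B (inv B (\<beta> s)) (mul B e (mul B (ran B (\<beta> s)) (mul B f (\<beta> s))))"
    using meet by (simp add: B.mul_assoc ran_def)
  also have "\<dots> = mul B (inv B (\<beta> s)) (mul B e (mul B f (mul B (ran B (\<beta> s)) (\<beta> s))))"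
    using meet by (subst B.idem_left_commute) auto
  also have "\<dots> = ?c (mul B e f)" using meet by (simp add: B.mul_assoc)
  finally show ?case using gen_idems.meet[OF meet(3,4)] by simp
next
  case (join e f g)
  then show ?case
    using gen_idems.join[OF join(4,5) B.is_join2_mul'[OF B.is_join2_mul[OF join(3)]]] by simp
next
  case (diff e f)
  let ?c = "\<lambda>e. mul B (mul B (inv B (\<beta> s)) e) (\<beta> s)" and ?d = "diff B f e"
  have d: "idem B ?d" "mul B ?d e = zer B"
    using diff B.leq_idem[OF B.diff_leq[OF diff(3)]] B.diff_dom[OF diff(3)] by auto
  have j: "is_join B {?c e, ?c ?d} (?c f)"
    by (intro B.is_join2_mul' B.is_join2_mul B.diff_join diff) auto
  have "mul B (?c ?d) (?c e) = mul B (inv B (\<beta> s)) (mul B ?d (mul B (ran B (\<beta> s)) (mul B e (\<beta> s))))"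
    using diff d by (simp add: B.mul_assoc ran_def)
  also have "\<dots> = mul B (inv B (\<beta> s)) (mul B (mul B ?d e) (mul B (ran B (\<beta> s)) (\<beta> s)))"
    using diff d(1) by (subst B.idem_left_commute) (auto simp: B.mul_assoc)
  also have "\<dots> = zer B" using d by simp
  finally have "mul B (dom B (?c ?d)) (dom B (?c e)) = zer B"
    using B.conj_idem[of ?d "\<beta> s"] B.conj_idem[of e "\<beta> s"] d diff by simp
  then have "diff B (?c f) (?c e) = ?c ?d" by (rule B.diff_eqI[OF j])
  then show ?case using gen_idems.diff[OF diff(4,5)] B.is_join2(1)[OF j] by simp
qed

lemma generated_car [simp]: "x \<in> generated \<Longrightarrow> x \<in> car B"
  by (induction rule: generated.induct) (auto dest: B.is_join_car)

lemma generated_mul_idem: "x \<in> generated \<Longrightarrow> f \<in> gen_idems \<Longrightarrow> mul B x f \<in> generated"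
proof (induction rule: generated.induct)
  case (base s e)
  then show ?case using generated.base[OF base(1) gen_idems.meet] by (simp add: B.mul_assoc)
next
  case (join x y z)
  then show ?case using generated.join B.is_join2_mul' gen_idems_car by blast
qed

lemma generated_mul_base:
  "x \<in> generated \<Longrightarrow> t \<in> car S \<Longrightarrow> mul B x (\<beta> t) \<in> generated"
proof (induction rule: generated.induct)
  case (base s e)
  then have "mul B (mul B (\<beta> s) e) (\<beta> t) = mul B (\<beta> (mul S s t)) (mul B (mul B (inv B (\<beta> t)) e) (\<beta> t))"
    using B.idem_push[of e "\<beta> t"] by (simp add: B.mul_assoc hom_mul)
  then show ?case using generated.base[OF _ gen_idems_conj] base by simp
next
  case (join x y z)
  then show ?case using generated.join B.is_join2_mul' hom_car by blast
qed

lemma generated_mul: "y \<in> generated \<Longrightarrow> x \<in> generated \<Longrightarrow> mul B x y \<in> generated"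
proof (induction rule: generated.induct)
  case (base s e)
  then show ?case using generated_mul_idem[OF generated_mul_base, of x s e] by (simp add: B.mul_assoc)
next
  case (join u v z)
  then show ?case using generated.join B.is_join2_mul generated_car by blast
qed

lemma generated_inv: "x \<in> generated \<Longrightarrow> inv B x \<in> generated"
proof (induction rule: generated.induct)
  case (base s e)
  have "inv B (mul B (\<beta> s) e) = mul B (\<beta> (inv S s)) (mul B (mul B (inv B (\<beta> (inv S s))) e) (\<beta> (inv S s)))"
    using base B.idem_push[of e "\<beta> (inv S s)"] by (simp add: B.inv_mul B.idem_inv hom_inv)
  then show ?case using generated.base[OF _ gen_idems_conj, of "inv S s" "inv S s" e] base by simp
next
  case (join x y z)
  then show ?case using generated.join B.is_join2_inv by blast
qed

lemma generated_dom: "x \<in> generated \<Longrightarrow> dom B x \<in> gen_idems"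
proof (induction rule: generated.induct)
  case (base s e)
  then show ?case
    using gen_idems.meet[OF gen_idems.base[of "dom S s"], of e] by (simp add: B.dom_mul_idem hom_dom)
next
  case (join x y z)
  then show ?case using gen_idems.join B.is_join2_dom by blast
qed

lemma gen_idems_generated: "e \<in> gen_idems \<Longrightarrow> e \<in> generated"
proof (induction rule: gen_idems.induct)
  case (base e)
  then show ?case using generated.base[of e "\<beta> e"] gen_idems.base[of e] B.idem_idem[of "\<beta> e"] by simp
next
  case (diff e f)
  then have "mul B f (diff B f e) = diff B f e"
    using B.leq_idem[OF B.diff_leq[OF diff(3)]] B.diff_leq[OF diff(3)] by (simp add: B.idem_leq_iff)
  then show ?case using generated_mul_idem[OF diff(5) gen_idems.diff[OF diff(1-3)]] by simp
qed (auto intro: generated_mul generated.join)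

lemma generated_base: "s \<in> car S \<Longrightarrow> \<beta> s \<in> generated"
  using generated.base[of s "\<beta> (dom S s)"] gen_idems.base[of "dom S s"]
  by (simp flip: hom_mul)

lemma sub_generated:
  defines "T \<equiv> \<lparr>car = generated, mul = mul B, zer = zer B\<rparr>"
  shows "boolean_isg T" "\<And>x y. \<lbrakk>x \<in> generated; y \<in> generated; compatible B x y\<rbrakk> \<Longrightarrow> join T {x, y} = join B {x, y}"
proof -
  have zer: "zer B \<in> generated" using generated_base[of "zer S"] by simp
  have "diff B f e \<in> generated" if "e \<in> generated" "f \<in> generated" "idem B e" "idem B f" "leq B e f" for e f
    using gen_idems_generated[OF gen_idems.diff] that generated_dom[of e] generated_dom[of f] by simp
  note sub = B.sub_boolean[OF _ refl zer generated_mul generated_inv generated.join this]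
  show "boolean_isg T" unfolding T_def by (rule sub) auto
  show "join T {x, y} = join B {x, y}" if "x \<in> generated" "y \<in> generated" "compatible B x y" for x y
    unfolding T_def by (rule sub) (use that in auto)
qed

end

locale booleanization = S: isg S for S :: "'a isg" +
  fixes B :: "'b isg" and \<beta> :: "'a \<Rightarrow> 'b"
  assumes bool: "is_booleanization S B \<beta>"

sublocale booleanization \<subseteq> isg_hom_bisg S B \<beta>
proof -
  interpret B: bisg B using bool by unfold_locales (simp add: is_booleanization_def)
  show "isg_hom_bisg S B \<beta>" using bool by unfold_locales (simp add: is_booleanization_def)
qed

context booleanization begin

lemma generated_eq: assumes "x \<in> car B" shows "x \<in> generated"
proof -
  let ?T = "\<lparr>car = generated, mul = mul B, zer = zer B\<rparr>"
  have lep: "X \<lesssim> (UNIV :: ('b \<times> nat) set)" for X :: "'b set"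
    unfolding lepoll_def by (rule exI[of _ "\<lambda>x. (x, 0)"]) (auto simp: inj_on_def)
  have "hom S ?T \<beta>" using generated_base hom_mul unfolding hom_def by auto
  then obtain \<phi> where \<phi>: "morphism B ?T \<phi>" "\<forall>s\<in>car S. \<phi> (\<beta> s) = \<beta> s"
    using booleanization_extend[OF S.isg bool sub_generated(1) _ lep, of \<beta>] by auto
  have gen: "\<phi> x \<in> generated" if "x \<in> car B" for x using \<phi>(1) that unfolding morphism_def hom_def by simp
  have hom\<phi>: "hom B B \<phi>" using \<phi>(1) gen unfolding morphism_def hom_def by simp
  then interpret p: isg_hom B B \<phi> by unfold_locales
  have mor: "morphism B B \<phi>"
    using \<phi>(1) hom\<phi> gen p.hom_compatible sub_generated(2) unfolding morphism_def by simp
  have "morphism B B (\<lambda>x. x)" unfolding morphism_def hom_def by simp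
  then have "\<phi> x = x"
    using booleanization_unique[OF S.isg bool B.bisg hom lep mor _ _ _ assms, of "\<lambda>x. x"] \<phi>(2) by simp
  then show ?thesis using gen[OF assms] by simp
qed

lemma idem_gen: "idem B e \<Longrightarrow> e \<in> gen_idems"
  using generated_dom[OF generated_eq, of e] by simp

end

definition (in isg) wagner_preston :: "'a \<Rightarrow> ('a \<times> 'a) set" where
  "wagner_preston s = {(t, s \<cdot> t) | t. t \<in> car S \<and> t \<noteq> \<zero> \<and> dom S s \<cdot> t = t}"

lemma (in isg) wagner_preston_iff:
  "(t, u) \<in> wagner_preston s \<longleftrightarrow> t \<in> car S \<and> t \<noteq> \<zero> \<and> dom S s \<cdot> t = t \<and> u = s \<cdot> t"
  unfolding wagner_preston_def by auto

lemma (in isg) wagner_preston_hom: "hom S pbij wagner_preston"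
  unfolding hom_def
proof (intro conjI ballI)
  have inj: "t = inv S s \<cdot> (s \<cdot> t)" if "s \<in> car S" "t \<in> car S" "dom S s \<cdot> t = t" for s t
    using that by (simp add: dom_def mul_assoc)
  show "wagner_preston s \<in> car pbij" if "s \<in> car S" for s
  proof -
    have "t = inv S s \<cdot> u" if "(t, u) \<in> wagner_preston s" for t u
      using that inj[of s t] \<open>s \<in> car S\<close> unfolding wagner_preston_iff by blast
    then have "single_valued ((wagner_preston s)\<inverse>)" by (intro single_valuedI) (metis converseD)
    moreover have "single_valued (wagner_preston s)" by (rule single_valuedI) (simp add: wagner_preston_iff)
    ultimately show ?thesis by simp
  qed
  show "wagner_preston (s \<cdot> t) = mul pbij (wagner_preston s) (wagner_preston t)"
    if [simp]: "s \<in> car S" "t \<in> car S" for s t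
  proof -
    have eq: "dom S (s \<cdot> t) \<cdot> u = u \<and> u \<noteq> \<zero> \<longleftrightarrow>
      dom S t \<cdot> u = u \<and> u \<noteq> \<zero> \<and> t \<cdot> u \<noteq> \<zero> \<and> dom S s \<cdot> (t \<cdot> u) = t \<cdot> u" if [simp]: "u \<in> car S" for u
    proof (intro iffI conjI; (elim conjE)?)
      assume a: "dom S (s \<cdot> t) \<cdot> u = u" "u \<noteq> \<zero>"
      have "dom S (s \<cdot> t) \<sqsubseteq> dom S t" by (rule dom_mul_leq) auto
      then have "dom S t \<cdot> dom S (s \<cdot> t) = dom S (s \<cdot> t)" by (simp add: idem_leq_iff)
      then show 1: "dom S t \<cdot> u = u" using a(1) by (metis dom_car mul_assoc mul_car that \<open>s \<in> car S\<close> \<open>t \<in> car S\<close>)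
      show "u \<noteq> \<zero>" by fact
      show "t \<cdot> u \<noteq> \<zero>"
      proof
        assume "t \<cdot> u = \<zero>"
        then show False using inj[of t u] 1 a(2) by simp
      qed
      have "t \<cdot> dom S (s \<cdot> t) = dom S s \<cdot> t"
        using idem_push[of "dom S s" t] by (simp add: dom_mul)
      then show "dom S s \<cdot> (t \<cdot> u) = t \<cdot> u" using a(1) by (metis dom_car mul_assoc mul_car that \<open>s \<in> car S\<close> \<open>t \<in> car S\<close>)
    next
      assume a: "dom S t \<cdot> u = u" "dom S s \<cdot> (t \<cdot> u) = t \<cdot> u"
      have "dom S (s \<cdot> t) \<cdot> u = inv S t \<cdot> (dom S s \<cdot> (t \<cdot> u))" by (simp add: dom_mul mul_assoc)
      also have "\<dots> = u" using a by (simp add: dom_def mul_assoc)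
      finally show "dom S (s \<cdot> t) \<cdot> u = u" .
    qed
    have "(u, v) \<in> wagner_preston (s \<cdot> t) \<longleftrightarrow> (u, v) \<in> wagner_preston t O wagner_preston s" for u v
    proof -
      have "(u, v) \<in> wagner_preston t O wagner_preston s \<longleftrightarrow>
          (u, t \<cdot> u) \<in> wagner_preston t \<and> (t \<cdot> u, v) \<in> wagner_preston s"
        by (auto simp: wagner_preston_iff)
      then show ?thesis using eq[of u] unfolding wagner_preston_iff by (auto simp: mul_assoc)
    qed
    then show ?thesis by auto
  qed
qed (auto simp: wagner_preston_def dom_of_idem)

context booleanization begin

lemma representation_exists:
  "\<exists>\<psi>. hom B pbij \<psi> \<and> (\<forall>s\<in>car S. \<psi> (\<beta> s) = S.wagner_preston s) \<and>
     (\<forall>x y z. is_join B {x, y} z \<longrightarrow> \<psi> z = \<psi> x \<union> \<psi> y)"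
proof -
  let ?K = "UNIV :: ('b \<times> nat) set" and ?w = S.wagner_preston
  let ?F = "{(\<lambda>r s. s O r), (\<lambda>r s. r\<inverse>), (\<union>), (-)} :: (('a \<times> 'a) set \<Rightarrow> ('a \<times> 'a) set \<Rightarrow> ('a \<times> 'a) set) set"
  interpret w: isg_hom S pbij ?w by unfold_locales (rule S.wagner_preston_hom)
  have "?w ` car S \<lesssim> car S" by (rule image_lepoll)
  also have "car S \<lesssim> ?K" unfolding lepoll_def
    using bool by (intro exI[of _ "\<lambda>s. (\<beta> s, 0)"]) (auto simp: is_booleanization_def inj_on_def)
  finally have "?w ` car S \<lesssim> ?K" .
  moreover have "infinite ?K" by (simp add: finite_prod)
  ultimately obtain Z where Z: "?w ` car S \<subseteq> Z" "Z \<lesssim> ?K" "\<forall>f\<in>?F. \<forall>x\<in>Z. \<forall>y\<in>Z. f x y \<in> Z"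
    using closure_lepoll[of "?w ` car S" ?K ?F] by blast
  define Y where "Y = Z \<inter> car pbij"
  let ?T = "\<lparr>car = Y, mul = mul pbij, zer = zer pbij\<rparr> :: ('a \<times> 'a) set isg"
  have wY: "?w s \<in> Y" if "s \<in> car S" for s using that Z(1) w.hom_car[OF that] unfolding Y_def by blast
  have join: "z = x \<union> y" if j: "is_join pbij {x, y} z" for x y z :: "('a \<times> 'a) set"
  proof -
    note xy = PB.is_join2[OF j]
    have "x \<union> y \<in> car pbij"
      using PB_compatible PB.leq_car(1)[OF xy(1)] PB.leq_car(1)[OF xy(2)] PB.bounded_compatible[OF xy] by blast
    then show ?thesis using PB.is_join_unique[OF j PB_is_join] PB.leq_car(1)[OF xy(1)] PB.leq_car(1)[OF xy(2)] by blast
  qed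
  have diff: "diff pbij f e = f - e" if "idem pbij e" "idem pbij f" "leq pbij e f" for e f
  proof (rule PB.diff_eqI)
    have "idem pbij (f - e)" "e \<subseteq> f" using that by (auto simp: PB_idem PB_leq)
    then show "is_join pbij {e, f - e} f"
      using PB_is_join[of e "f - e"] that PB.idem_car by (metis Un_Diff_cancel sup.absorb2)
    show "mul pbij (dom pbij (f - e)) (dom pbij e) = zer pbij"
      using \<open>idem pbij (f - e)\<close> that by (auto simp: PB_idem)
  qed
  have T: "boolean_isg ?T" "\<And>x y. \<lbrakk>x \<in> Y; y \<in> Y; compatible pbij x y\<rbrakk> \<Longrightarrow> join ?T {x, y} = join pbij {x, y}"
  proof -
    have zY: "zer pbij \<in> Y" using wY[of "zer S"] by simp
    have "x\<inverse> \<in> Z" if "x \<in> Z" for x using Z(3) that by auto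
    moreover have "x O y \<in> Z" "x \<union> y \<in> Z" "x - y \<in> Z" if "x \<in> Z" "y \<in> Z" for x y
      using Z(3) that by auto
    ultimately have cl: "mul pbij x y \<in> Y" "inv pbij x \<in> Y"
      "is_join pbij {x, y} z \<Longrightarrow> z \<in> Y"
      "\<lbrakk>idem pbij x; idem pbij y; leq pbij x y\<rbrakk> \<Longrightarrow> diff pbij y x \<in> Y"
      if "x \<in> Y" "y \<in> Y" for x y z
      using that unfolding Y_def
      using PB_inv[of x] PB.mul_car[of x y] PB.inv_car[of x] PB.is_join_car[of "{x,y}" z] join[of x y z] diff[of x y] PB.diff_car[of x y]
      by (simp_all del: pbij_simps(1))
    note sub = PB.sub_boolean[OF _ refl zY cl(1) cl(2) cl(3) cl(4)]
    show "boolean_isg ?T" by (rule sub) (auto simp: Y_def)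
    show "join ?T {x, y} = join pbij {x, y}" if "x \<in> Y" "y \<in> Y" "compatible pbij x y" for x y
      by (rule sub) (use that in \<open>auto simp: Y_def\<close>)
  qed
  have "Y \<lesssim> ?K" by (rule lepoll_trans[OF subset_imp_lepoll Z(2)]) (simp add: Y_def)
  moreover have "hom S ?T ?w" using wY w.hom_mul unfolding hom_def by auto
  ultimately obtain \<psi> where \<psi>: "morphism B ?T \<psi>" "\<forall>s\<in>car S. \<psi> (\<beta> s) = ?w s"
    using booleanization_extend[OF S.isg bool T(1), of ?w] by auto
  have Y: "\<psi> x \<in> Y" if "x \<in> car B" for x using \<psi>(1) that unfolding morphism_def hom_def by simp
  then have hom\<psi>: "hom B pbij \<psi>" using \<psi>(1) unfolding morphism_def hom_def Y_def by simp
  then interpret p: isg_hom B pbij \<psi> by unfold_locales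
  have "\<psi> z = \<psi> x \<union> \<psi> y" if j: "is_join B {x, y} z" for x y z
  proof -
    note xy = B.is_join2[OF j]
    note c = B.leq_car(1)[OF xy(1)] B.leq_car(1)[OF xy(2)]
    have "\<psi> z = join ?T {\<psi> x, \<psi> y}"
      using \<psi>(1) c B.bounded_compatible[OF xy] B.join_eq[OF j] unfolding morphism_def by metis
    also have "\<dots> = join pbij {\<psi> x, \<psi> y}"
      using Y c p.hom_compatible[OF c B.bounded_compatible[OF xy]] by (intro T(2)) auto
    finally show ?thesis
      using join[OF PB.is_join2_exists[OF _ _ p.hom_compatible[OF c B.bounded_compatible[OF xy]]]] p.hom_car c by metis
  qed
  then show ?thesis using hom\<psi> \<psi>(2) by blast
qed

end

section \<open>Filters and their groupoid\<close>

context isg begin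

lemma filter_car: "\<lbrakk>proper_filter S A; a \<in> A\<rbrakk> \<Longrightarrow> a \<in> car S"
  and filter_up: "\<lbrakk>proper_filter S A; a \<in> A; a \<sqsubseteq> b\<rbrakk> \<Longrightarrow> b \<in> A"
  and filter_directed: "\<lbrakk>proper_filter S A; a \<in> A; b \<in> A\<rbrakk> \<Longrightarrow> \<exists>c\<in>A. c \<sqsubseteq> a \<and> c \<sqsubseteq> b"
  and filter_zer: "proper_filter S A \<Longrightarrow> \<zero> \<notin> A"
  and filter_nonempty: "proper_filter S A \<Longrightarrow> \<exists>a. a \<in> A"
  unfolding proper_filter_def by blast+

lemma ultrafilter_filter: "ultrafilter S A \<Longrightarrow> proper_filter S A"
  and tight_filter_filter: "tight_filter S A \<Longrightarrow> proper_filter S A"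
  unfolding ultrafilter_def tight_filter_def by auto

lemma ultrafilter_maximal: "\<lbrakk>ultrafilter S A; proper_filter S F; A \<subseteq> F\<rbrakk> \<Longrightarrow> F = A"
  unfolding ultrafilter_def by blast

lemma filter_left_idem:
  assumes A: "proper_filter S A" and e: "idem S e" and a0: "a0 \<in> A" "e \<cdot> a0 \<in> A" and a: "a \<in> A"
  shows "e \<cdot> a \<in> A"
proof -
  note [simp] = filter_car[OF A a0(1)] filter_car[OF A a] idem_car[OF e]
  obtain c where c: "c \<in> A" "c \<sqsubseteq> e \<cdot> a0" "c \<sqsubseteq> a" using filter_directed[OF A a0(2) a] by blast
  have [simp]: "c \<in> car S" using c leq_car by blast
  have "e \<cdot> c = e \<cdot> (e \<cdot> a0 \<cdot> dom S c)" using leqD[OF c(2)] by simp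
  also have "\<dots> = (e \<cdot> e) \<cdot> a0 \<cdot> dom S c" by (simp add: mul_assoc)
  also have "\<dots> = c" using leqD[OF c(2)] e by (simp add: idem_idem)
  finally have "c \<sqsubseteq> e \<cdot> a" using leq_mul_left[OF c(3), of e] by simp
  then show ?thesis using filter_up[OF A c(1)] by blast
qed

definition translate :: "'a \<Rightarrow> 'a set \<Rightarrow> 'a set" where
  "translate s A = {y. \<exists>a\<in>A. s \<cdot> a \<sqsubseteq> y}"

lemma translateI: "\<lbrakk>a \<in> A; s \<cdot> a \<sqsubseteq> y\<rbrakk> \<Longrightarrow> y \<in> translate s A"
  unfolding translate_def by blast

lemma inv_mul_mul: "\<lbrakk>s \<in> car S; a \<in> car S\<rbrakk> \<Longrightarrow> inv S s \<cdot> (s \<cdot> a) = dom S s \<cdot> a"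
  by (simp add: dom_def mul_assoc)

lemma translate_filter:
  assumes A: "proper_filter S A" and s [simp]: "s \<in> car S" and d: "\<And>a. a \<in> A \<Longrightarrow> dom S s \<cdot> a \<in> A"
  shows "proper_filter S (translate s A)"
  unfolding proper_filter_def
proof (intro conjI ballI allI impI)
  have [simp]: "a \<in> car S" if "a \<in> A" for a using filter_car[OF A that] .
  show "translate s A \<subseteq> car S" unfolding translate_def using leq_car by blast
  obtain a where "a \<in> A" using filter_nonempty[OF A] by blast
  then show "translate s A \<noteq> {}" using translateI[of a A s "s \<cdot> a"] by auto
  show "b \<in> translate s A" if "a \<in> translate s A" "a \<sqsubseteq> b" for a b
    using that leq_trans unfolding translate_def by blast
  show "\<exists>c\<in>translate s A. c \<sqsubseteq> a \<and> c \<sqsubseteq> b" if ab: "a \<in> translate s A" "b \<in> translate s A" for a b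
  proof -
    obtain x y where xy: "x \<in> A" "s \<cdot> x \<sqsubseteq> a" "y \<in> A" "s \<cdot> y \<sqsubseteq> b" using ab unfolding translate_def by blast
    obtain z where z: "z \<in> A" "z \<sqsubseteq> x" "z \<sqsubseteq> y" using filter_directed[OF A xy(1,3)] by blast
    have "s \<cdot> z \<sqsubseteq> a" "s \<cdot> z \<sqsubseteq> b" using z xy leq_mul_left[OF _ s] leq_trans by blast+
    moreover have "s \<cdot> z \<in> translate s A" using z by (intro translateI) auto
    ultimately show ?thesis by blast
  qed
  show "\<zero> \<notin> translate s A"
  proof
    assume "\<zero> \<in> translate s A"
    then obtain a where a: "a \<in> A" "s \<cdot> a \<sqsubseteq> \<zero>" unfolding translate_def by blast
    then have "s \<cdot> a = \<zero>" using leq_zer by blast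
    then have "dom S s \<cdot> a = \<zero>" using a inv_mul_mul[of s a] by simp
    then show False using d[OF a(1)] filter_zer[OF A] by simp
  qed
qed

lemma translate_translate:
  assumes A: "proper_filter S A" and s [simp]: "s \<in> car S" and d: "\<And>a. a \<in> A \<Longrightarrow> dom S s \<cdot> a \<in> A"
  shows "translate (inv S s) (translate s A) = A"
proof (intro equalityI subsetI)
  fix y assume "y \<in> translate (inv S s) (translate s A)"
  then obtain z a where z: "inv S s \<cdot> z \<sqsubseteq> y" "a \<in> A" "s \<cdot> a \<sqsubseteq> z" unfolding translate_def by blast
  have "dom S s \<cdot> a \<sqsubseteq> y"
    using leq_trans[OF leq_mul_left[OF z(3), of "inv S s"] z(1)] inv_mul_mul filter_car[OF A z(2)] by simp
  then show "y \<in> A" using d[OF z(2)] filter_up[OF A] by blast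
next
  fix a assume a: "a \<in> A"
  note [simp] = filter_car[OF A a]
  have "s \<cdot> a \<in> translate s A" using a by (intro translateI) auto
  moreover have "inv S s \<cdot> (s \<cdot> a) \<sqsubseteq> a" by (simp add: inv_mul_mul leqI')
  ultimately show "a \<in> translate (inv S s) (translate s A)" by (rule translateI)
qed

lemma translate_ran:
  assumes A: "proper_filter S A" and s [simp]: "s \<in> car S" and d: "\<And>a. a \<in> A \<Longrightarrow> dom S s \<cdot> a \<in> A"
    and F: "proper_filter S F" "translate s A \<subseteq> F" and f: "f \<in> F"
  shows "dom S (inv S s) \<cdot> f \<in> F"
proof -
  obtain a where a: "a \<in> A" using filter_nonempty[OF A] by blast
  note [simp] = filter_car[OF A a]
  have sa: "s \<cdot> a \<in> F" using translateI[OF a, of s "s \<cdot> a"] F(2) by auto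
  have "ran S s \<cdot> (s \<cdot> a) = s \<cdot> a" by (simp add: mul_assoc[symmetric])
  then show ?thesis using filter_left_idem[OF F(1) _ sa _ f, of "ran S s"] sa by simp
qed

lemma translate_ultrafilter:
  assumes A: "ultrafilter S A" and s [simp]: "s \<in> car S" and d: "\<And>a. a \<in> A \<Longrightarrow> dom S s \<cdot> a \<in> A"
  shows "ultrafilter S (translate s A)"
  unfolding ultrafilter_def
proof (intro conjI allI impI)
  note A' = ultrafilter_filter[OF A]
  show "proper_filter S (translate s A)" by (rule translate_filter[OF A' s d])
  fix F assume F: "proper_filter S F \<and> translate s A \<subseteq> F"
  then have dF: "dom S (inv S s) \<cdot> f \<in> F" if "f \<in> F" for f using translate_ran[OF A' s d] that by blast
  have "translate (inv S s) (translate s A) \<subseteq> translate (inv S s) F"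
    using F unfolding translate_def by blast
  then have "A \<subseteq> translate (inv S s) F" using translate_translate[OF A' s d] by simp
  then have "translate (inv S s) F = A"
    using F dF by (intro ultrafilter_maximal[OF A] translate_filter) auto
  then show "F = translate s A" using translate_translate[of F "inv S s"] F dF by simp
qed

lemma coverD: "cover S a C \<Longrightarrow> a \<in> car S" "cover S a C \<Longrightarrow> finite C" "\<lbrakk>cover S a C; c \<in> C\<rbrakk> \<Longrightarrow> c \<sqsubseteq> a"
  "\<lbrakk>cover S a C; x \<noteq> \<zero>; x \<sqsubseteq> a\<rbrakk> \<Longrightarrow> \<exists>c\<in>C. \<exists>y. y \<noteq> \<zero> \<and> y \<sqsubseteq> x \<and> y \<sqsubseteq> c"
  unfolding cover_def by auto

text \<open>Covers can be restricted along \<open>s \<cdot> a \<sqsubseteq> b\<close> and then pulled back along \<open>s\<close>.\<close>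
lemma cover_translate:
  assumes C: "cover S b C" and s [simp]: "s \<in> car S" and a [simp]: "a \<in> car S"
    and da: "dom S s \<cdot> a = a" and sab: "s \<cdot> a \<sqsubseteq> b"
  shows "cover S a ((\<lambda>c. inv S s \<cdot> (c \<cdot> dom S (s \<cdot> a))) ` C)"
  unfolding cover_def
proof (intro conjI ballI allI impI)
  note [simp] = leq_car[OF coverD(3)[OF C]] coverD(1)[OF C]
  show "finite ((\<lambda>c. inv S s \<cdot> (c \<cdot> dom S (s \<cdot> a))) ` C)" using coverD(2)[OF C] by simp
  show "a \<in> car S" by simp
  have isa: "inv S s \<cdot> (s \<cdot> a) = a" using da by (simp add: inv_mul_mul)
  show "d \<sqsubseteq> a" if d: "d \<in> (\<lambda>c. inv S s \<cdot> (c \<cdot> dom S (s \<cdot> a))) ` C" for d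
  proof -
    obtain c where c: "c \<in> C" "d = inv S s \<cdot> (c \<cdot> dom S (s \<cdot> a))" using d by blast
    have "c \<cdot> dom S (s \<cdot> a) \<sqsubseteq> b \<cdot> dom S (s \<cdot> a)" using coverD(3)[OF C c(1)] by (intro leq_mul_right) auto
    then have "c \<cdot> dom S (s \<cdot> a) \<sqsubseteq> s \<cdot> a" using leqD[OF sab] by simp
    then show ?thesis using leq_mul_left[of "c \<cdot> dom S (s \<cdot> a)" "s \<cdot> a" "inv S s"] isa c by simp
  qed
  fix x assume x: "x \<noteq> \<zero> \<and> x \<sqsubseteq> a"
  then have [simp]: "x \<in> car S" using leq_car by blast
  have sx: "s \<cdot> x \<sqsubseteq> s \<cdot> a" using x by (intro leq_mul_left) auto
  have isx: "inv S s \<cdot> (s \<cdot> x) = x"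
  proof -
    have "dom S s \<cdot> (a \<cdot> dom S x) = a \<cdot> dom S x" using da by (simp add: mul_assoc[symmetric])
    then show ?thesis using x leqD[of x a] by (simp add: inv_mul_mul)
  qed
  then have "s \<cdot> x \<noteq> \<zero>" using x by auto
  then obtain c y where y: "c \<in> C" "y \<noteq> \<zero>" "y \<sqsubseteq> s \<cdot> x" "y \<sqsubseteq> c"
    using coverD(4)[OF C, of "s \<cdot> x"] leq_trans[OF sx sab] by blast
  then have [simp]: "y \<in> car S" using leq_car by blast
  have yd: "y \<sqsubseteq> c \<cdot> dom S (s \<cdot> a)"
    by (rule leq_mulI[OF y(4)]) (auto intro: leq_dom leq_trans[OF y(3) sx])
  have "s \<cdot> (inv S s \<cdot> y) = y"
  proof -
    have "s \<cdot> (inv S s \<cdot> (s \<cdot> x \<cdot> dom S y)) = s \<cdot> (inv S s \<cdot> (s \<cdot> x)) \<cdot> dom S y" by (simp add: mul_assoc)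
    then show ?thesis using isx leqD[OF y(3)] by simp
  qed
  then have "inv S s \<cdot> y \<noteq> \<zero>" using y(2) by auto
  moreover have "inv S s \<cdot> y \<sqsubseteq> x" using leq_mul_left[OF y(3), of "inv S s"] isx by simp
  moreover have "inv S s \<cdot> y \<sqsubseteq> inv S s \<cdot> (c \<cdot> dom S (s \<cdot> a))" using yd by (intro leq_mul_left) auto
  ultimately show "\<exists>d\<in>(\<lambda>c. inv S s \<cdot> (c \<cdot> dom S (s \<cdot> a))) ` C. \<exists>y. y \<noteq> \<zero> \<and> y \<sqsubseteq> x \<and> y \<sqsubseteq> d"
    using y(1) by blast
qed

lemma translate_tight:
  assumes A: "tight_filter S A" and s [simp]: "s \<in> car S" and d: "\<And>a. a \<in> A \<Longrightarrow> dom S s \<cdot> a \<in> A"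
  shows "tight_filter S (translate s A)"
  unfolding tight_filter_def
proof (intro conjI ballI allI impI)
  note A' = tight_filter_filter[OF A]
  show "proper_filter S (translate s A)" by (rule translate_filter[OF A' s d])
  fix b C assume b: "b \<in> translate s A" and C: "cover S b C"
  obtain a0 where a0: "a0 \<in> A" "s \<cdot> a0 \<sqsubseteq> b" using b unfolding translate_def by blast
  define a where "a = dom S s \<cdot> a0"
  have [simp]: "a0 \<in> car S" using filter_car[OF A' a0(1)] .
  have a: "a \<in> A" "a \<in> car S" using d[OF a0(1)] unfolding a_def by auto
  have da: "dom S s \<cdot> a = a" unfolding a_def by (simp add: mul_assoc[symmetric] idem_idem)
  have sa: "s \<cdot> a = s \<cdot> a0" unfolding a_def by (simp add: mul_assoc[symmetric])
  have "cover S a ((\<lambda>c. inv S s \<cdot> (c \<cdot> dom S (s \<cdot> a))) ` C)"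
    by (rule cover_translate[OF C s a(2) da]) (simp add: sa a0)
  then obtain c where c: "c \<in> C" "inv S s \<cdot> (c \<cdot> dom S (s \<cdot> a)) \<in> A"
    using A a(1) unfolding tight_filter_def by blast
  have [simp]: "c \<in> car S" using coverD(3)[OF C c(1)] leq_car by blast
  have "s \<cdot> (inv S s \<cdot> (c \<cdot> dom S (s \<cdot> a))) = ran S s \<cdot> (c \<cdot> dom S (s \<cdot> a))" using a by (simp add: ran_def mul_assoc)
  also have "\<dots> \<sqsubseteq> c \<cdot> dom S (s \<cdot> a)" using a by (intro leqI') auto
  also have "\<dots> \<sqsubseteq> c" using a by (intro leqI) auto
  finally have "c \<in> translate s A" using c(2) translateI by blast
  then show "C \<inter> translate s A \<noteq> {}" using c(1) by blast
qed

lemma setinv_iff: "A \<subseteq> car S \<Longrightarrow> y \<in> setinv S A \<longleftrightarrow> y \<in> car S \<and> inv S y \<in> A"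
  unfolding setinv_def by force

lemma setinv_car: "A \<subseteq> car S \<Longrightarrow> setinv S A \<subseteq> car S" unfolding setinv_def by auto

lemma setinv_setinv: "A \<subseteq> car S \<Longrightarrow> setinv S (setinv S A) = A"
  unfolding setinv_def by force

lemma filter_subset: "proper_filter S A \<Longrightarrow> A \<subseteq> car S" unfolding proper_filter_def by blast

lemma setinv_filter: assumes A: "proper_filter S A" shows "proper_filter S (setinv S A)"
  unfolding proper_filter_def
proof (intro conjI ballI allI impI)
  note iff = setinv_iff[OF filter_subset[OF A]]
  show "setinv S A \<subseteq> car S" using filter_subset[OF A] setinv_car by blast
  show "setinv S A \<noteq> {}" using filter_nonempty[OF A] unfolding setinv_def by blast
  show "b \<in> setinv S A" if "a \<in> setinv S A" "a \<sqsubseteq> b" for a b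
    using that filter_up[OF A] leq_inv leq_car unfolding iff by blast
  show "\<exists>c\<in>setinv S A. c \<sqsubseteq> a \<and> c \<sqsubseteq> b" if ab: "a \<in> setinv S A" "b \<in> setinv S A" for a b
  proof -
    have *: "a \<in> car S" "inv S a \<in> A" "b \<in> car S" "inv S b \<in> A" using ab unfolding iff by auto
    obtain c where c: "c \<in> A" "c \<sqsubseteq> inv S a" "c \<sqsubseteq> inv S b" using filter_directed[OF A *(2,4)] by blast
    then have "inv S c \<sqsubseteq> a" "inv S c \<sqsubseteq> b" using leq_inv[OF c(2)] leq_inv[OF c(3)] * by simp_all
    then show ?thesis using c(1) unfolding setinv_def by blast
  qed
  show "\<zero> \<notin> setinv S A" unfolding iff using filter_zer[OF A] by simp
qed

lemma setinv_ultrafilter: assumes A: "ultrafilter S A" shows "ultrafilter S (setinv S A)"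
  unfolding ultrafilter_def
proof (intro conjI allI impI)
  note A' = ultrafilter_filter[OF A]
  show "proper_filter S (setinv S A)" by (rule setinv_filter[OF A'])
  fix F assume F: "proper_filter S F \<and> setinv S A \<subseteq> F"
  then have "setinv S (setinv S A) \<subseteq> setinv S F" unfolding setinv_def by blast
  then have "setinv S F = A"
    using setinv_setinv[OF filter_subset[OF A']] F by (intro ultrafilter_maximal[OF A] setinv_filter) auto
  then show "F = setinv S A" using setinv_setinv[OF filter_subset] F by blast
qed

lemma setinv_tight: assumes A: "tight_filter S A" shows "tight_filter S (setinv S A)"
  unfolding tight_filter_def
proof (intro conjI allI ballI impI)
  note A' = tight_filter_filter[OF A]
  note iff = setinv_iff[OF filter_subset[OF A']]
  show "proper_filter S (setinv S A)" by (rule setinv_filter[OF A'])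
  fix a C assume a: "a \<in> setinv S A" and C: "cover S a C"
  have [simp]: "a \<in> car S" "inv S a \<in> A" using a unfolding iff by auto
  have "cover S (inv S a) (inv S ` C)"
    unfolding cover_def
  proof (intro conjI ballI allI impI)
    show "c \<sqsubseteq> inv S a" if "c \<in> inv S ` C" for c using that coverD(3)[OF C] leq_inv by blast
    fix x assume x: "x \<noteq> \<zero> \<and> x \<sqsubseteq> inv S a"
    then have [simp]: "x \<in> car S" using leq_car by blast
    have "inv S x \<noteq> \<zero>" using x inv_inv[of x] by force
    moreover have "inv S x \<sqsubseteq> a" using x leq_inv[of x "inv S a"] by simp
    ultimately obtain c y where y: "c \<in> C" "y \<noteq> \<zero>" "y \<sqsubseteq> inv S x" "y \<sqsubseteq> c"
      using coverD(4)[OF C] by blast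
    have [simp]: "y \<in> car S" using y leq_car by blast
    have "inv S y \<noteq> \<zero>" using y(2) inv_inv[of y] by force
    moreover have "inv S y \<sqsubseteq> x" "inv S y \<sqsubseteq> inv S c" using leq_inv[OF y(3)] leq_inv[OF y(4)] by auto
    ultimately show "\<exists>c\<in>inv S ` C. \<exists>y. y \<noteq> \<zero> \<and> y \<sqsubseteq> x \<and> y \<sqsubseteq> c" using y(1) by blast
  qed (use coverD(2)[OF C] in auto)
  then obtain c where c: "c \<in> C" "inv S c \<in> A"
    using A \<open>inv S a \<in> A\<close> unfolding tight_filter_def by blast
  then show "C \<inter> setinv S A \<noteq> {}" using coverD(3)[OF C c(1)] leq_car iff by blast
qed

lemma composable_dom:
  assumes U: "proper_filter S U" and V: "proper_filter S V" and c: "composable S U V"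
    and u: "u \<in> U" and v: "v \<in> V"
  shows "dom S u \<cdot> v \<in> V"
proof -
  note [simp] = filter_car[OF U u] filter_car[OF V v]
  have "inv S u \<cdot> u \<in> setmul S (setinv S U) U"
    unfolding setmul_def setinv_def using u by blast
  moreover have "inv S u \<cdot> u \<sqsubseteq> dom S u" by (simp add: dom_def)
  ultimately have "dom S u \<in> upclose S (setmul S (setinv S U) U)"
    unfolding upclose_def by blast
  then have "dom S u \<in> upclose S (setmul S V (setinv S V))" using c unfolding composable_def by simp
  then obtain x y where xy: "x \<in> V" "y \<in> V" "x \<cdot> inv S y \<sqsubseteq> dom S u"
    unfolding upclose_def setmul_def setinv_def by blast
  obtain w' where w': "w' \<in> V" "w' \<sqsubseteq> x" "w' \<sqsubseteq> y" using filter_directed[OF V xy(1,2)] by blast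
  obtain w where w: "w \<in> V" "w \<sqsubseteq> w'" "w \<sqsubseteq> v" using filter_directed[OF V w'(1) v] by blast
  have wx: "w \<sqsubseteq> x" "w \<sqsubseteq> y" using w w' leq_trans by blast+
  have [simp]: "w \<in> car S" using w leq_car by blast
  have "w \<cdot> inv S w \<cdot> w \<sqsubseteq> x \<cdot> inv S y \<cdot> v" by (intro leq_mul leq_inv wx w)
  also have "\<dots> \<sqsubseteq> dom S u \<cdot> v" by (intro leq_mul_right xy) auto
  finally have "w \<sqsubseteq> dom S u \<cdot> v" by (simp add: mul_inv_mul)
  then show ?thesis using filter_up[OF V w(1)] by blast
qed

lemma gprod_translate:
  assumes U: "proper_filter S U" and V: "proper_filter S V" and c: "composable S U V" and u: "u \<in> U"
  shows "gprod S U V = translate u V"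
proof (intro equalityI subsetI)
  fix y assume "y \<in> gprod S U V"
  then obtain x v where xv: "x \<in> U" "v \<in> V" "x \<cdot> v \<sqsubseteq> y"
    unfolding gprod_def upclose_def setmul_def by blast
  obtain w where w: "w \<in> U" "w \<sqsubseteq> u" "w \<sqsubseteq> x" using filter_directed[OF U u xv(1)] by blast
  note [simp] = filter_car[OF U u] filter_car[OF V xv(2)] filter_car[OF U w(1)]
  have "u \<cdot> (dom S w \<cdot> v) = w \<cdot> v" using leqD[OF w(2)] by (simp add: mul_assoc[symmetric])
  also have "\<dots> \<sqsubseteq> x \<cdot> v" using w by (intro leq_mul_right) auto
  also note xv(3)
  finally show "y \<in> translate u V" using composable_dom[OF U V c w(1) xv(2)] translateI by blast
next
  fix y assume "y \<in> translate u V"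
  then show "y \<in> gprod S U V" using u unfolding translate_def gprod_def upclose_def setmul_def by blast
qed

lemma gprod_ultrafilter:
  assumes "ultrafilter S U" "ultrafilter S V" "composable S U V"
  shows "ultrafilter S (gprod S U V)"
proof -
  note U = ultrafilter_filter[OF assms(1)] and V = ultrafilter_filter[OF assms(2)]
  obtain u where u: "u \<in> U" using filter_nonempty[OF U] by blast
  show ?thesis unfolding gprod_translate[OF U V assms(3) u]
    using composable_dom[OF U V assms(3) u] filter_car[OF U u] by (intro translate_ultrafilter assms) auto
qed

lemma composable_setinv:
  assumes "U \<subseteq> car S" shows "composable S (setinv S U) U" "composable S U (setinv S U)"
  unfolding composable_def using setinv_setinv[OF assms] by auto

lemma composable_iff_gprod: "composable S U V \<longleftrightarrow> gprod S (setinv S U) U = gprod S V (setinv S V)"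
  unfolding composable_def gprod_def by simp

lemma ultrafilter_mul_idem:
  assumes V: "ultrafilter S V" and e: "idem S e" and nz: "\<And>v. v \<in> V \<Longrightarrow> v \<cdot> e \<noteq> \<zero>" and v: "v \<in> V"
  shows "v \<cdot> e \<in> V"
proof -
  note V' = ultrafilter_filter[OF V] and [simp] = idem_car[OF e]
  let ?F = "{y. \<exists>v\<in>V. v \<cdot> e \<sqsubseteq> y}"
  have "proper_filter S ?F"
    unfolding proper_filter_def
  proof (intro conjI ballI allI impI)
    show "?F \<subseteq> car S" using leq_car by blast
    show "?F \<noteq> {}" using v filter_car[OF V' v] by (auto intro!: exI[of _ "v \<cdot> e"] bexI[of _ v])
    show "b \<in> ?F" if "a \<in> ?F" "a \<sqsubseteq> b" for a b using that leq_trans by blast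
    show "\<exists>c\<in>?F. c \<sqsubseteq> a \<and> c \<sqsubseteq> b" if ab: "a \<in> ?F" "b \<in> ?F" for a b
    proof -
      obtain x y where xy: "x \<in> V" "y \<in> V" "x \<cdot> e \<sqsubseteq> a" "y \<cdot> e \<sqsubseteq> b" using ab by blast
      obtain z where z: "z \<in> V" "z \<sqsubseteq> x" "z \<sqsubseteq> y" using filter_directed[OF V' xy(1,2)] by blast
      have "z \<cdot> e \<sqsubseteq> a" "z \<cdot> e \<sqsubseteq> b" using z xy leq_mul_right[of _ _ e] leq_trans idem_car[OF e] by blast+
      moreover have "z \<cdot> e \<in> ?F" using z filter_car[OF V' z(1)] by (auto intro!: bexI[of _ z])
      ultimately show ?thesis by blast
    qed
    show "\<zero> \<notin> ?F" using nz leq_zer by blast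
  qed
  moreover have "V \<subseteq> ?F"
  proof
    fix x assume x: "x \<in> V"
    then have "x \<cdot> e \<sqsubseteq> x" using filter_car[OF V' x] e by (intro leqI) auto
    then show "x \<in> ?F" using x by blast
  qed
  ultimately have "?F = V" by (rule ultrafilter_maximal[OF V])
  moreover have "v \<cdot> e \<in> ?F" using v filter_car[OF V' v] by (auto intro!: bexI[of _ v])
  ultimately show ?thesis by blast
qed

end

locale filter_preimage = isg_hom S T h for S :: "'a isg" and T :: "'b isg" and h +
  fixes pre :: "'b set \<Rightarrow> 'a set"
  defines "pre \<equiv> \<lambda>V. {s \<in> car S. h s \<in> V}"
  assumes pre_filter: "\<And>V. ultrafilter T V \<Longrightarrow> proper_filter S (pre V)"
    and pre_inj: "\<And>U V. \<lbrakk>ultrafilter T U; ultrafilter T V; pre U = pre V\<rbrakk> \<Longrightarrow> U = V"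
begin

lemma pre_iff: "s \<in> pre V \<longleftrightarrow> s \<in> car S \<and> h s \<in> V" unfolding pre_def by simp

lemma pre_gprod:
  assumes U: "ultrafilter T U" and V: "ultrafilter T V" and c: "composable T U V"
  shows "pre (gprod T U V) = gprod S (pre U) (pre V)"
proof (intro equalityI subsetI)
  note U' = T.ultrafilter_filter[OF U] and V' = T.ultrafilter_filter[OF V]
  let ?W = "gprod T U V"
  note W = T.gprod_ultrafilter[OF U V c]
  note W' = T.ultrafilter_filter[OF W]
  obtain a b where a: "a \<in> pre U" and b: "b \<in> pre V"
    using S.filter_nonempty[OF pre_filter[OF U]] S.filter_nonempty[OF pre_filter[OF V]] by blast
  have [simp]: "a \<in> car S" "b \<in> car S" and ha: "h a \<in> U" and hb: "h b \<in> V" using a b pre_iff by auto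
  have Wt: "?W = T.translate (h a) V" by (rule T.gprod_translate[OF U' V' c ha])
  fix s assume s: "s \<in> pre ?W"
  have "mul S a b \<in> pre ?W"
    unfolding Wt pre_iff using hb by (auto simp: hom_mul intro!: T.translateI[of "h b"])
  then obtain t where t: "t \<in> pre ?W" "leq S t s" "leq S t (mul S a b)"
    using S.filter_directed[OF pre_filter[OF W] s] by blast
  have [simp]: "t \<in> car S" using t S.leq_car by blast
  have "T.translate (inv T (h a)) ?W = V"
    unfolding Wt by (rule T.translate_translate[OF V']) (use T.composable_dom[OF U' V' c ha] in auto)
  moreover have "h (mul S (inv S a) t) \<in> T.translate (inv T (h a)) ?W"
    using t(1) unfolding pre_iff by (intro T.translateI[of "h t"]) (auto simp: hom_mul hom_inv)
  ultimately have "mul S (inv S a) t \<in> pre V" unfolding pre_iff by simp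
  moreover have "mul S a (mul S (inv S a) t) = t"
  proof -
    have eq: "mul S a (mul S (inv S a) t) = mul S (ran S a) t" by (simp add: ran_def S.mul_assoc)
    also have "\<dots> = mul S (ran S a) (mul S (mul S a b) (dom S t))" using S.leqD[OF t(3)] by simp
    also have "\<dots> = mul S (mul S (mul S (ran S a) a) b) (dom S t)"
      by (simp only: S.mul_assoc S.ran_car S.dom_car S.mul_car \<open>a \<in> car S\<close> \<open>b \<in> car S\<close> \<open>t \<in> car S\<close>)
    also have "\<dots> = t" using S.leqD[OF t(3)] by simp
    finally show ?thesis .
  qed
  ultimately show "s \<in> gprod S (pre U) (pre V)"
    using a t(2) unfolding gprod_def upclose_def setmul_def by force
next
  fix s assume "s \<in> gprod S (pre U) (pre V)"
  then obtain a b where ab: "a \<in> pre U" "b \<in> pre V" "leq S (mul S a b) s"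
    unfolding gprod_def upclose_def setmul_def by blast
  then have "leq T (mul T (h a) (h b)) (h s)" using hom_leq[OF ab(3)] hom_mul unfolding pre_iff by simp
  then show "s \<in> pre (gprod T U V)"
    using ab S.leq_car(2)[OF ab(3)] unfolding pre_iff gprod_def upclose_def setmul_def by blast
qed

lemma pre_setinv: assumes "ultrafilter T U" shows "pre (setinv T U) = setinv S (pre U)"
proof -
  have "U \<subseteq> car T" using assms T.ultrafilter_filter T.filter_subset by blast
  moreover have "pre U \<subseteq> car S" unfolding pre_def by blast
  ultimately show ?thesis using pre_iff by (auto simp: T.setinv_iff S.setinv_iff hom_inv)
qed

lemma pre_composable:
  assumes U: "ultrafilter T U" and V: "ultrafilter T V"
  shows "composable T U V \<longleftrightarrow> composable S (pre U) (pre V)"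
proof -
  have Uc: "U \<subseteq> car T" "V \<subseteq> car T" using assms T.ultrafilter_filter T.filter_subset by blast+
  note iU = T.setinv_ultrafilter[OF U] and iV = T.setinv_ultrafilter[OF V]
  note cU = T.composable_setinv(1)[OF Uc(1)] and cV = T.composable_setinv(2)[OF Uc(2)]
  have "composable S (pre U) (pre V) \<longleftrightarrow> pre (gprod T (setinv T U) U) = pre (gprod T V (setinv T V))"
    unfolding S.composable_iff_gprod pre_gprod[OF iU U cU] pre_gprod[OF V iV cV] pre_setinv[OF U] pre_setinv[OF V] ..
  then show ?thesis
    unfolding T.composable_iff_gprod
    using pre_inj[OF T.gprod_ultrafilter[OF iU U cU] T.gprod_ultrafilter[OF V iV cV]] by auto
qed

end

section \<open>Quotient by an additive ideal\<close>

definition prime_filter :: "'a isg \<Rightarrow> 'a set \<Rightarrow> bool" where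
  "prime_filter S U \<longleftrightarrow> proper_filter S U \<and> (\<forall>x y z. is_join S {x, y} z \<and> z \<in> U \<longrightarrow> x \<in> U \<or> y \<in> U)"

lemma prime_filter_filter: "prime_filter S U \<Longrightarrow> proper_filter S U"
  and prime_filter_prime: "\<lbrakk>prime_filter S U; is_join S {x, y} z; z \<in> U\<rbrakk> \<Longrightarrow> x \<in> U \<or> y \<in> U"
  unfolding prime_filter_def by auto

locale bisg_ideal = bisg B for B :: "'b isg" (structure) +
  fixes I :: "'b set"
  assumes ideal: "additive_ideal B I" and zer_ideal [simp]: "\<zero> \<in> I"
begin

lemma ideal_car [simp]: "x \<in> I \<Longrightarrow> x \<in> car B"
  and ideal_mul [simp]: "\<lbrakk>x \<in> I; s \<in> car B\<rbrakk> \<Longrightarrow> s \<cdot> x \<in> I"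
  and ideal_mul' [simp]: "\<lbrakk>x \<in> I; s \<in> car B\<rbrakk> \<Longrightarrow> x \<cdot> s \<in> I"
  using ideal unfolding additive_ideal_def by auto

lemma ideal_down: "\<lbrakk>y \<in> I; x \<sqsubseteq> y\<rbrakk> \<Longrightarrow> x \<in> I"
  using leqD[of x y] leq_car[of x y] ideal_mul'[of y "dom B x"] by simp

lemma ideal_join: assumes j: "is_join B {x, y} z" and x: "x \<in> I" "y \<in> I" shows "z \<in> I"
  using ideal x bounded_compatible[OF is_join2[OF j]] join_eq[OF j] unfolding additive_ideal_def by metis

abbreviation "eps \<equiv> ideal_congruence B I"
abbreviation "Q \<equiv> quotient_isg B eps"
abbreviation "cl a \<equiv> eps `` {a}"

lemma eps_iff: "(a, b) \<in> eps \<longleftrightarrow> (\<exists>c u v. u \<in> I \<and> v \<in> I \<and> is_join B {c, u} a \<and> is_join B {c, v} b)"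
proof
  assume "(a, b) \<in> eps"
  then obtain c where "c \<sqsubseteq> a" "c \<sqsubseteq> b" "diff B a c \<in> I" "diff B b c \<in> I" unfolding ideal_congruence_def by blast
  then show "\<exists>c u v. u \<in> I \<and> v \<in> I \<and> is_join B {c, u} a \<and> is_join B {c, v} b" using diff_join by blast
next
  assume "\<exists>c u v. u \<in> I \<and> v \<in> I \<and> is_join B {c, u} a \<and> is_join B {c, v} b"
  then obtain c u v where *: "u \<in> I" "v \<in> I" "is_join B {c, u} a" "is_join B {c, v} b" by blast
  then have "diff B a c \<in> I" "diff B b c \<in> I" using diff_leq_join ideal_down by blast+
  moreover have "c \<sqsubseteq> a" "c \<sqsubseteq> b" using * is_join2 by blast+
  ultimately show "(a, b) \<in> eps" unfolding ideal_congruence_def using leq_car by blast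
qed

lemma eps_car: "(a, b) \<in> eps \<Longrightarrow> a \<in> car B" "(a, b) \<in> eps \<Longrightarrow> b \<in> car B"
  unfolding ideal_congruence_def by auto

lemma eps_refl: "a \<in> car B \<Longrightarrow> (a, a) \<in> eps"
  unfolding eps_iff using is_join_zer zer_ideal by blast

lemma eps_sym: "(a, b) \<in> eps \<Longrightarrow> (b, a) \<in> eps"
  unfolding eps_iff by blast

lemma eps_trans:
  assumes "(a, b) \<in> eps" "(b, z) \<in> eps" shows "(a, z) \<in> eps"
proof -
  obtain c u v where 1: "u \<in> I" "v \<in> I" "is_join B {c, u} a" "is_join B {c, v} b"
    using assms(1) unfolding eps_iff by blast
  obtain e w t where 2: "w \<in> I" "t \<in> I" "is_join B {e, w} b" "is_join B {e, t} z"
    using assms(2) unfolding eps_iff by blast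
  have cb: "c \<sqsubseteq> b" "e \<sqsubseteq> b" using is_join2 1(4) 2(3) by blast+
  note [simp] = leq_car[OF cb(1)] leq_car[OF cb(2)]
  let ?p = "c \<cdot> dom B e"
  have pe: "?p = e \<cdot> dom B c"
  proof -
    have "?p = b \<cdot> (dom B c \<cdot> dom B e)" using leqD[OF cb(1)] by (metis \<open>b \<in> car B\<close> \<open>c \<in> car B\<close> \<open>e \<in> car B\<close> dom_car mul_assoc)
    also have "\<dots> = b \<cdot> dom B e \<cdot> dom B c" by (simp add: idem_commute[of "dom B c"] mul_assoc)
    finally show ?thesis using leqD[OF cb(2)] by simp
  qed
  have extend: "\<exists>m\<in>I. is_join B {p, m} x" if j: "is_join B {c', u'} x" and j': "is_join B {p, v'} c'" and I: "u' \<in> I" "v' \<in> I" for c' u' v' x p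
  proof -
    have le: "p \<sqsubseteq> x" "v' \<sqsubseteq> x" "u' \<sqsubseteq> x" "c' \<sqsubseteq> x" using is_join2[OF j] is_join2[OF j'] leq_trans by blast+
    obtain m where m: "is_join B {v', u'} m" "m \<sqsubseteq> x" using is_join2_exists_bounded[OF le(2,3)] by blast
    have "is_join B {p, m} x" unfolding is_join_def
    proof (intro conjI ballI impI)
      fix y assume y: "y \<in> car B" "\<forall>x\<in>{p, m}. x \<sqsubseteq> y"
      then have "v' \<sqsubseteq> y" "u' \<sqsubseteq> y" "p \<sqsubseteq> y" using is_join2[OF m(1)] leq_trans by blast+
      then show "x \<sqsubseteq> y" using is_join2_least[OF j] is_join2_least[OF j'] by blast
    qed (use le m leq_car in auto)
    then show ?thesis using ideal_join[OF m(1)] I by blast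
  qed
  have "is_join B {?p, w \<cdot> dom B c} c"
    using is_join2_mul'[OF 2(3), of "dom B c"] leq_dom_mul[OF cb(1)] pe by simp
  moreover have "is_join B {?p, v \<cdot> dom B e} e"
    using is_join2_mul'[OF 1(4), of "dom B e"] leq_dom_mul[OF cb(2)] by simp
  ultimately obtain m n where "m \<in> I" "is_join B {?p, m} a" "n \<in> I" "is_join B {?p, n} z"
    using extend[OF 1(3)] extend[OF 2(4)] 1(1,2) 2(1,2) by (metis dom_car ideal_mul' \<open>c \<in> car B\<close> \<open>e \<in> car B\<close>)
  then show ?thesis unfolding eps_iff by blast
qed

lemma eps_mul_left: "(a, b) \<in> eps \<Longrightarrow> s \<in> car B \<Longrightarrow> (s \<cdot> a, s \<cdot> b) \<in> eps"
  unfolding eps_iff using is_join2_mul ideal_mul by meson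

lemma eps_mul_right: "(a, b) \<in> eps \<Longrightarrow> s \<in> car B \<Longrightarrow> (a \<cdot> s, b \<cdot> s) \<in> eps"
  unfolding eps_iff using is_join2_mul' ideal_mul' by meson

lemma eps_mul: "\<lbrakk>(a, b) \<in> eps; (c, d) \<in> eps\<rbrakk> \<Longrightarrow> (a \<cdot> c, b \<cdot> d) \<in> eps"
  using eps_trans eps_mul_right[of a b c] eps_mul_left[of c d b] eps_car by blast

lemma equiv_eps: "equiv (car B) eps"
  by (rule equivI) (auto simp: refl_on_def sym_def trans_def intro: eps_refl eps_sym eps_trans dest: eps_car)

lemma cl_eq_iff: "\<lbrakk>a \<in> car B; b \<in> car B\<rbrakk> \<Longrightarrow> cl a = cl b \<longleftrightarrow> (a, b) \<in> eps"
  using equiv_eps eq_equiv_class_iff by metis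

lemma car_Q: "X \<in> car Q \<longleftrightarrow> (\<exists>a\<in>car B. X = cl a)"
  unfolding quotient_isg_def by (auto simp: quotient_def)

lemma car_QE: assumes "X \<in> car Q" obtains a where "a \<in> car B" "X = cl a"
  using assms car_Q by blast

lemma cl_car [simp]: "a \<in> car B \<Longrightarrow> cl a \<in> car Q" using car_Q by blast

lemma zer_Q: "zer Q = cl \<zero>" unfolding quotient_isg_def by simp

lemma mul_Q: assumes "a \<in> car B" "b \<in> car B" shows "mul Q (cl a) (cl b) = cl (a \<cdot> b)"
proof -
  have some: "(x, SOME y. y \<in> cl x) \<in> eps" if "x \<in> car B" for x
    using someI[of "\<lambda>y. y \<in> cl x" x] eps_refl[OF that] by simp
  have "(a \<cdot> b, (SOME y. y \<in> cl a) \<cdot> (SOME y. y \<in> cl b)) \<in> eps" using some assms by (intro eps_mul) auto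
  then show ?thesis unfolding quotient_isg_def using cl_eq_iff eps_car by (simp) (metis cl_eq_iff eps_car)
qed

lemma Q_idem_lift:
  assumes a: "a \<in> car B" and "mul Q (cl a) (cl a) = cl a" shows "\<exists>e. idem B e \<and> cl a = cl e"
proof -
  note [simp] = a
  let ?x = "inv B (a \<cdot> a)"
  let ?e = "a \<cdot> ?x \<cdot> a"
  have aa: "(a \<cdot> a, a) \<in> eps" using assms by (simp add: mul_Q cl_eq_iff)
  have "?e \<cdot> ?e = a \<cdot> (?x \<cdot> (a \<cdot> a) \<cdot> ?x) \<cdot> a" by (simp add: mul_assoc)
  then have "?e \<cdot> ?e = ?e" using inv_mul_inv[of "a \<cdot> a"] by simp
  then have "idem B ?e" unfolding idem_def by simp
  moreover have "(?e, a) \<in> eps"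
  proof -
    have "(a \<cdot> a \<cdot> ?x \<cdot> (a \<cdot> a), ?e) \<in> eps" by (intro eps_mul aa eps_refl) simp
    then have "(a \<cdot> a, ?e) \<in> eps" using mul_inv_mul[of "a \<cdot> a"] by simp
    then show ?thesis using aa eps_sym eps_trans by blast
  qed
  ultimately show ?thesis using cl_eq_iff[of ?e a] by auto
qed

lemma Q_isg: "inverse_semigroup Q"
proof (rule inverse_semigroupI)
  show "zer Q \<in> car Q" by (simp add: zer_Q)
  fix X assume "X \<in> car Q"
  then obtain a where a: "a \<in> car B" "X = cl a" using car_Q by blast
  then show "mul Q (zer Q) X = zer Q" "mul Q X (zer Q) = zer Q" by (simp_all add: zer_Q mul_Q)
  show "\<exists>Y\<in>car Q. mul Q (mul Q X Y) X = X \<and> mul Q (mul Q Y X) Y = Y"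
    using a by (intro bexI[of _ "cl (inv B a)"]) (auto simp: mul_Q mul_inv_mul inv_mul_inv)
  fix Y assume "Y \<in> car Q"
  then obtain b where b: "b \<in> car B" "Y = cl b" using car_Q by blast
  then show "mul Q X Y \<in> car Q" using a by (simp add: mul_Q)
  show "mul Q X Y = mul Q Y X" if XX: "mul Q X X = X" and YY: "mul Q Y Y = Y"
  proof -
    obtain e f where "idem B e" "X = cl e" "idem B f" "Y = cl f"
      using Q_idem_lift[of a] Q_idem_lift[of b] XX YY a b by metis
    then show ?thesis using idem_commute by (simp add: mul_Q)
  qed
  fix Z assume "Z \<in> car Q"
  then obtain c where "c \<in> car B" "Z = cl c" using car_Q by blast
  then show "mul Q (mul Q X Y) Z = mul Q X (mul Q Y Z)" using a b by (simp add: mul_Q mul_assoc)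
qed

lemma cl_hom: "hom B Q (\<lambda>a. cl a)"
  unfolding hom_def using mul_Q zer_Q cl_car by simp

end

sublocale bisg_ideal \<subseteq> Q: isg "quotient_isg B (ideal_congruence B I)"
  by unfold_locales (rule Q_isg)

sublocale bisg_ideal \<subseteq> cl: isg_hom B "quotient_isg B (ideal_congruence B I)" "\<lambda>a. ideal_congruence B I `` {a}"
  by unfold_locales (rule cl_hom)

context bisg_ideal begin

lemma cl_zer_iff: assumes "a \<in> car B" shows "cl a = zer Q \<longleftrightarrow> a \<in> I"
proof -
  have "(a, \<zero>) \<in> eps \<longleftrightarrow> a \<in> I"
  proof
    assume "(a, \<zero>) \<in> eps"
    then obtain c u v where c: "u \<in> I" "is_join B {c, u} a" "is_join B {c, v} \<zero>" unfolding eps_iff by blast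
    then have "c = \<zero>" using is_join2 leq_zer by blast
    then show "a \<in> I" using ideal_join[OF c(2)] c(1) by simp
  next
    assume "a \<in> I"
    then have "is_join B {\<zero>, a} a" "is_join B {\<zero>, \<zero>} \<zero>" using is_join_zer[of a] is_join_zer[of \<zero>] by (simp_all add: insert_commute)
    then show "(a, \<zero>) \<in> eps" unfolding eps_iff using \<open>a \<in> I\<close> zer_ideal by blast
  qed
  then show ?thesis using assms cl_eq_iff[of a \<zero>] by simp
qed

lemma Q_leq_lift:
  assumes a: "a \<in> car B" "b \<in> car B" and le: "leq Q (cl a) (cl b)"
  shows "\<exists>c. c \<sqsubseteq> a \<and> c \<sqsubseteq> b \<and> cl c = cl a"
proof -
  have "cl a = mul Q (cl b) (dom Q (cl a))" using le by (rule Q.leqD)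
  also have "\<dots> = cl (b \<cdot> dom B a)" using a by (simp add: mul_Q flip: cl.hom_dom)
  finally have "(a, b \<cdot> dom B a) \<in> eps" using a by (simp add: cl_eq_iff)
  then obtain c u v where c: "u \<in> I" "is_join B {c, u} a" "is_join B {c, v} (b \<cdot> dom B a)" unfolding eps_iff by blast
  have "c \<sqsubseteq> a" "c \<sqsubseteq> b" using is_join2[OF c(2)] is_join2[OF c(3)] leqI[of "dom B a" b] a leq_trans by auto
  moreover have "(c, a) \<in> eps" unfolding eps_iff
    using c(1,2) is_join_zer[OF leq_car(1)[OF \<open>c \<sqsubseteq> a\<close>]] zer_ideal by blast
  ultimately show ?thesis using cl_eq_iff leq_car by blast
qed

lemma ultrafilter_preimage:
  assumes V: "ultrafilter Q V"
  shows "prime_filter B {b \<in> car B. cl b \<in> V}" "{b \<in> car B. cl b \<in> V} \<inter> I = {}"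
proof -
  let ?U = "{b \<in> car B. cl b \<in> V}"
  note V' = Q.ultrafilter_filter[OF V]
  show disj: "?U \<inter> I = {}" using cl_zer_iff Q.filter_zer[OF V'] by fastforce
  have U: "proper_filter B ?U"
    unfolding proper_filter_def
  proof (intro conjI ballI allI impI)
    obtain X where X: "X \<in> V" using Q.filter_nonempty[OF V'] by blast
    obtain x where "x \<in> car B" "X = cl x" by (rule car_QE[OF Q.filter_car[OF V' X]])
    then show "?U \<noteq> {}" using X by blast
    show "b \<in> ?U" if "a \<in> ?U" "a \<sqsubseteq> b" for a b
      using that Q.filter_up[OF V' _ cl.hom_leq[OF that(2)]] leq_car by blast
    show "\<exists>c\<in>?U. c \<sqsubseteq> a \<and> c \<sqsubseteq> b" if ab: "a \<in> ?U" "b \<in> ?U" for a b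
    proof -
      obtain X where X: "X \<in> V" "leq Q X (cl a)" "leq Q X (cl b)"
        using Q.filter_directed[OF V', of "cl a" "cl b"] ab by blast
      obtain x where x: "x \<in> car B" "X = cl x" by (rule car_QE[OF Q.filter_car[OF V' X(1)]])
      obtain c where c: "c \<sqsubseteq> x" "c \<sqsubseteq> a" "cl c = X" using Q_leq_lift[of x a] x X(2) ab by blast
      have "c \<in> car B" using c leq_car by blast
      then obtain d where "d \<sqsubseteq> c" "d \<sqsubseteq> b" "cl d = X" using Q_leq_lift[of c b] c(3) X(3) ab by blast
      then have "d \<in> ?U" "d \<sqsubseteq> a" "d \<sqsubseteq> b" using X(1) leq_car leq_trans[OF _ c(2)] by blast+
      then show ?thesis by blast
    qed
    show "\<zero> \<notin> ?U" using disj zer_ideal by blast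
  qed auto
  show "prime_filter B ?U"
    unfolding prime_filter_def
  proof (intro conjI U allI impI)
    fix x y z assume xyz: "is_join B {x, y} z \<and> z \<in> ?U"
    then have xz: "x \<sqsubseteq> z" "y \<sqsubseteq> z" and z: "z \<in> ?U" using is_join2 by blast+
    note [simp] = leq_car[OF xz(1)] leq_car[OF xz(2)]
    have kill: "\<exists>f\<in>?U. f \<cdot> dom B w \<in> I" if w: "w \<sqsubseteq> z" "w \<notin> ?U" for w
    proof (rule ccontr)
      assume no: "\<not> ?thesis"
      have [simp]: "w \<in> car B" using w leq_car by blast
      have "mul Q v (cl (dom B w)) \<noteq> zer Q" if v: "v \<in> V" for v
      proof -
        obtain f where "f \<in> car B" "v = cl f" by (rule car_QE[OF Q.filter_car[OF V' v]])
        then show ?thesis using no v cl_zer_iff[of "f \<cdot> dom B w"] by (auto simp: mul_Q)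
      qed
      then have "mul Q (cl z) (cl (dom B w)) \<in> V"
        using z by (intro Q.ultrafilter_mul_idem[OF V]) (auto intro: cl.hom_idem)
      then show False using w z leqD[OF w(1)] by (simp add: mul_Q)
    qed
    show "x \<in> ?U \<or> y \<in> ?U"
    proof (rule ccontr)
      assume "\<not> ?thesis"
      then obtain f g where f: "f \<in> ?U" "f \<cdot> dom B x \<in> I" and g: "g \<in> ?U" "g \<cdot> dom B y \<in> I"
        using kill[OF xz(1)] kill[OF xz(2)] by blast
      obtain h' where h': "h' \<in> ?U" "h' \<sqsubseteq> f" "h' \<sqsubseteq> g" using filter_directed[OF U f(1) g(1)] by blast
      obtain h where h: "h \<in> ?U" "h \<sqsubseteq> h'" "h \<sqsubseteq> z" using filter_directed[OF U h'(1) z] by blast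
      have [simp]: "h \<in> car B" using h by blast
      have "h \<cdot> dom B x \<sqsubseteq> f \<cdot> dom B x" "h \<cdot> dom B y \<sqsubseteq> g \<cdot> dom B y"
        using leq_mul_right[OF leq_trans[OF h(2) h'(2)], of "dom B x"]
          leq_mul_right[OF leq_trans[OF h(2) h'(3)], of "dom B y"] by simp_all
      then have "h \<cdot> dom B x \<in> I" "h \<cdot> dom B y \<in> I" using f g ideal_down by blast+
      moreover have "is_join B {h \<cdot> dom B x, h \<cdot> dom B y} (h \<cdot> dom B z)"
        using xyz by (intro is_join2_mul is_join2_dom) auto
      moreover have "h \<cdot> dom B z = h" using h(3) by (intro dom_absorb leq_dom) auto
      ultimately have "h \<in> I" using ideal_join by metis
      then show False using h(1) disj by blast
    qed
  qed
qed

lemma prime_image: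
  assumes U: "prime_filter B U" and disj: "U \<inter> I = {}"
  shows prime_image_ultrafilter: "ultrafilter Q ((\<lambda>a. cl a) ` U)"
    and prime_image_iff: "\<And>b. b \<in> car B \<Longrightarrow> cl b \<in> (\<lambda>a. cl a) ` U \<longleftrightarrow> b \<in> U"
proof -
  note U' = prime_filter_filter[OF U]
  note Uc = filter_car[OF U']
  show sat: "cl b \<in> (\<lambda>a. cl a) ` U \<longleftrightarrow> b \<in> U" if b: "b \<in> car B" for b
  proof
    assume "cl b \<in> (\<lambda>a. cl a) ` U"
    then obtain a where a: "a \<in> U" "cl b = cl a" by blast
    then have "(a, b) \<in> eps" using cl_eq_iff[of a b] Uc b by simp
    then obtain c u v where c: "u \<in> I" "is_join B {c, u} a" "is_join B {c, v} b" unfolding eps_iff by blast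
    then have "c \<in> U" using prime_filter_prime[OF U c(2) a(1)] disj by blast
    then show "b \<in> U" using filter_up[OF U'] is_join2[OF c(3)] by blast
  qed simp
  let ?V = "(\<lambda>a. cl a) ` U"
  have V: "proper_filter Q ?V"
    unfolding proper_filter_def
  proof (intro conjI ballI allI impI)
    show "?V \<subseteq> car Q" using Uc by auto
    show "?V \<noteq> {}" using filter_nonempty[OF U'] by blast
    show "zer Q \<notin> ?V" using sat[of \<zero>] filter_zer[OF U'] by simp
    show "Y \<in> ?V" if XY: "X \<in> ?V" "leq Q X Y" for X Y
    proof -
      obtain a where a: "a \<in> U" "X = cl a" using XY by blast
      obtain b where b: "b \<in> car B" "Y = cl b" by (rule car_QE[OF Q.leq_car(2)[OF XY(2)]])
      obtain c where c: "c \<sqsubseteq> a" "c \<sqsubseteq> b" "cl c = cl a" using Q_leq_lift[of a b] a b Uc XY(2) by blast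
      then have "c \<in> U" using sat[of c] a leq_car by auto
      then show ?thesis using b filter_up[OF U' _ c(2)] by blast
    qed
    show "\<exists>Z\<in>?V. leq Q Z X \<and> leq Q Z Y" if "X \<in> ?V" "Y \<in> ?V" for X Y
      using that filter_directed[OF U'] cl.hom_leq by blast
  qed
  show "ultrafilter Q ?V"
    unfolding ultrafilter_def
  proof (intro conjI V allI impI)
    fix F assume F: "proper_filter Q F \<and> ?V \<subseteq> F"
    have "Y \<in> ?V" if Y: "Y \<in> F" for Y
    proof -
      have FF: "proper_filter Q F" using F by blast
      obtain b where b: "b \<in> car B" "Y = cl b" by (rule car_QE[OF Q.filter_car[OF FF Y]])
      obtain u where u: "u \<in> U" using filter_nonempty[OF U'] by blast
      then have uF: "cl u \<in> F" using F by blast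
      obtain Z where Z: "Z \<in> F" "leq Q Z (cl u)" "leq Q Z Y" using Q.filter_directed[OF FF uF Y] by blast
      obtain z where z: "z \<in> car B" "Z = cl z" by (rule car_QE[OF Q.filter_car[OF FF Z(1)]])
      obtain c where c: "c \<sqsubseteq> z" "c \<sqsubseteq> u" "cl c = Z" using Q_leq_lift[of z u] z Z(2) Uc[OF u] by blast
      have "c \<in> car B" using c leq_car by blast
      then obtain d where d: "d \<sqsubseteq> c" "d \<sqsubseteq> b" "cl d = Z" using Q_leq_lift[of c b] c(3) Z(3) b by blast
      have du: "d \<sqsubseteq> u" using d c leq_trans by blast
      note [simp] = leq_car[OF du] diff_car[OF du]
      have "diff B u d \<notin> U"
      proof
        assume "diff B u d \<in> U"
        then have "cl (diff B u d) \<in> F" using F by blast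
        then obtain X where X: "X \<in> F" "leq Q X (cl (diff B u d))" "leq Q X (cl d)"
          using Q.filter_directed[OF FF _ Z(1)] d(3) by blast
        have [simp]: "X \<in> car Q" using Q.filter_car[OF FF X(1)] .
        have "leq Q (dom Q X) (cl (dom B (diff B u d)))" "leq Q (dom Q X) (cl (dom B d))"
          using Q.leq_dom[OF X(2)] Q.leq_dom[OF X(3)] by (simp_all add: cl.hom_dom)
        then have "leq Q (dom Q X) (mul Q (cl (dom B (diff B u d))) (cl (dom B d)))"
          by (intro Q.idem_glb cl.hom_idem) auto
        then have "leq Q (dom Q X) (zer Q)" using diff_dom[OF du] by (simp add: mul_Q)
        then have "dom Q X = zer Q" by (rule Q.leq_zer)
        then have "X = zer Q" using Q.mul_dom[of X] Q.mul_zer[of X] by simp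
        then show False using X(1) Q.filter_zer[OF FF] by blast
      qed
      then have "d \<in> U" using prime_filter_prime[OF U diff_join[OF du] u] by blast
      then show ?thesis using filter_up[OF U' _ d(2)] b by blast
    qed
    then show "F = ?V" using F by blast
  qed
qed

lemma image_preimage:
  assumes V: "proper_filter Q V" shows "(\<lambda>a. cl a) ` {b \<in> car B. cl b \<in> V} = V"
proof (intro equalityI subsetI)
  fix X assume X: "X \<in> V"
  obtain x where "x \<in> car B" "X = cl x" by (rule car_QE[OF Q.filter_car[OF V X]])
  then show "X \<in> (\<lambda>a. cl a) ` {b \<in> car B. cl b \<in> V}" using X by blast
qed auto

end

section \<open>Prime filters of the Booleanization\<close>

lemma (in isg) leq_mul_meet:
  assumes "z \<sqsubseteq> x \<cdot> e" "z \<sqsubseteq> x \<cdot> f" and e: "idem S e" and f: "idem S f" and x: "x \<in> car S"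
  shows "z \<sqsubseteq> x \<cdot> (e \<cdot> f)"
proof -
  have "dom S z \<sqsubseteq> dom S x \<cdot> f" using leq_dom[OF assms(2)] f x by (simp add: dom_mul_idem)
  then have "dom S z \<sqsubseteq> f" using leq_trans idem_mul_leq(2)[of "dom S x" f] f x by auto
  then have "z \<sqsubseteq> x \<cdot> e \<cdot> f" by (rule leq_mulI[OF assms(1) f])
  then show ?thesis using e f x by (simp add: mul_assoc)
qed

context bisg begin

lemma prime_filter_meet:
  assumes U: "prime_filter S U" and x: "x \<in> car S" and e: "idem S e" and f: "idem S f"
  shows "x \<cdot> (e \<cdot> f) \<in> U \<longleftrightarrow> x \<cdot> e \<in> U \<and> x \<cdot> f \<in> U"
proof
  note U' = prime_filter_filter[OF U]
  assume "x \<cdot> (e \<cdot> f) \<in> U"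
  moreover have "x \<cdot> (e \<cdot> f) \<sqsubseteq> x \<cdot> e" "x \<cdot> (e \<cdot> f) \<sqsubseteq> x \<cdot> f"
    using idem_mul_leq[OF e f] x by (auto intro: leq_mul_left)
  ultimately show "x \<cdot> e \<in> U \<and> x \<cdot> f \<in> U" using filter_up[OF U'] by blast
next
  note U' = prime_filter_filter[OF U]
  assume "x \<cdot> e \<in> U \<and> x \<cdot> f \<in> U"
  then obtain z where "z \<in> U" "z \<sqsubseteq> x \<cdot> e" "z \<sqsubseteq> x \<cdot> f" using filter_directed[OF U'] by blast
  then show "x \<cdot> (e \<cdot> f) \<in> U" using leq_mul_meet[OF _ _ e f x] filter_up[OF U'] by blast
qed

lemma prime_filter_join:
  assumes U: "prime_filter S U" and x: "x \<in> car S" and j: "is_join S {e, f} g"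
  shows "x \<cdot> g \<in> U \<longleftrightarrow> x \<cdot> e \<in> U \<or> x \<cdot> f \<in> U"
  using prime_filter_prime[OF U is_join2_mul[OF j x]] filter_up[OF prime_filter_filter[OF U]]
    is_join2[OF is_join2_mul[OF j x]] by blast

lemma prime_filter_diff:
  assumes U: "prime_filter S U" and x: "x \<in> car S" and ef: "e \<sqsubseteq> f" and f: "idem S f"
  shows "x \<cdot> diff S f e \<in> U \<longleftrightarrow> x \<cdot> f \<in> U \<and> x \<cdot> e \<notin> U"
proof -
  have e: "idem S e" and d: "idem S (diff S f e)" using leq_idem[OF ef f] leq_idem[OF diff_leq[OF ef] f] by auto
  have "diff S f e \<cdot> e = \<zero>" using diff_dom[OF ef] e d by simp
  then have "\<not> (x \<cdot> diff S f e \<in> U \<and> x \<cdot> e \<in> U)"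
    using prime_filter_meet[OF U x d e] x filter_zer[OF prime_filter_filter[OF U]] by simp
  then show ?thesis using prime_filter_join[OF U x diff_join[OF ef]] by blast
qed

lemma prime_filter_finite_join:
  assumes U: "prime_filter S U"
  shows "finite X \<Longrightarrow> is_join S X j \<Longrightarrow> j \<in> U \<Longrightarrow> X \<inter> U \<noteq> {}"
proof (induction X arbitrary: j rule: finite_induct)
  case empty
  then have "j = \<zero>" using is_join_unique is_join_empty by blast
  then show ?case using empty filter_zer[OF prime_filter_filter[OF U]] by blast
next
  case (insert x F)
  have up: "y \<sqsubseteq> j" if "y \<in> insert x F" for y using is_join_upper[OF insert.prems(1) that] .
  have jF: "is_join S F (join S F)" using insert.hyps up by (intro bounded_join_exists[of F j]) auto
  have "join S F \<sqsubseteq> j" using is_join_least[OF jF] is_join_car[OF insert.prems(1)] up by blast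
  then have "is_join S {x, join S F} j"
    unfolding is_join_def using up[of x] is_join_car[OF insert.prems(1)]
  proof (intro conjI ballI impI)
    fix u assume u: "u \<in> car S" "\<forall>y\<in>{x, join S F}. y \<sqsubseteq> u"
    show "j \<sqsubseteq> u" by (rule is_join_least[OF insert.prems(1)]) (use u is_join_upper[OF jF] leq_trans in blast)+
  qed auto
  then show ?case using prime_filter_prime[OF U _ insert.prems(2)] insert.IH[OF jF] by blast
qed

lemma prime_filter_translate:
  assumes U: "prime_filter S U" and s [simp]: "s \<in> car S" and d: "\<And>u. u \<in> U \<Longrightarrow> dom S s \<cdot> u \<in> U"
  shows "prime_filter S (translate s U)"
  unfolding prime_filter_def
proof (intro conjI allI impI)
  note U' = prime_filter_filter[OF U]
  show "proper_filter S (translate s U)" by (rule translate_filter[OF U' s d])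
  fix x y z assume xyz: "is_join S {x, y} z \<and> z \<in> translate s U"
  then obtain u where u: "u \<in> U" "s \<cdot> u \<sqsubseteq> z" unfolding translate_def by blast
  have [simp]: "u \<in> car S" using filter_car[OF U' u(1)] .
  have "dom S s \<cdot> u \<sqsubseteq> inv S s \<cdot> z" using leq_mul_left[OF u(2), of "inv S s"] by (simp add: inv_mul_mul)
  then have "inv S s \<cdot> z \<in> U" using d[OF u(1)] filter_up[OF U'] by blast
  moreover have "is_join S {inv S s \<cdot> x, inv S s \<cdot> y} (inv S s \<cdot> z)" using xyz is_join2_mul by simp
  ultimately have "inv S s \<cdot> x \<in> U \<or> inv S s \<cdot> y \<in> U" using prime_filter_prime[OF U] by blast
  moreover have "w \<in> translate s U" if "inv S s \<cdot> w \<in> U" "w \<sqsubseteq> z" for w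
  proof (rule translateI[OF that(1)])
    have "w \<in> car S" using that(2) leq_car by blast
    then have "s \<cdot> (inv S s \<cdot> w) = ran S s \<cdot> w" by (simp add: ran_def mul_assoc)
    then show "s \<cdot> (inv S s \<cdot> w) \<sqsubseteq> w" using leqI'[of "ran S s" w] \<open>w \<in> car S\<close> by simp
  qed
  ultimately show "x \<in> translate s U \<or> y \<in> translate s U" using is_join2 xyz by blast
qed

lemma prime_filter_setinv:
  assumes U: "prime_filter S U" shows "prime_filter S (setinv S U)"
  unfolding prime_filter_def
proof (intro conjI allI impI)
  note U' = prime_filter_filter[OF U]
  show "proper_filter S (setinv S U)" by (rule setinv_filter[OF U'])
  fix x y z assume xyz: "is_join S {x, y} z \<and> z \<in> setinv S U"
  then have "is_join S {inv S x, inv S y} (inv S z)" "inv S z \<in> U"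
    using is_join2_inv setinv_iff[OF filter_subset[OF U']] by blast+
  then have "inv S x \<in> U \<or> inv S y \<in> U" using prime_filter_prime[OF U] by blast
  moreover have "x \<in> car S" "y \<in> car S" using xyz is_join2 leq_car by blast+
  ultimately show "x \<in> setinv S U \<or> y \<in> setinv S U" using setinv_iff[OF filter_subset[OF U']] by blast
qed

end

context isg begin

definition eventually_below :: "'a set \<Rightarrow> ('a \<Rightarrow> bool) \<Rightarrow> bool" where
  "eventually_below D P \<longleftrightarrow> (\<exists>h0\<in>D. \<forall>h\<in>D. h \<sqsubseteq> h0 \<longrightarrow> P h)"

definition idem_base :: "'a set \<Rightarrow> bool" where
  "idem_base D \<longleftrightarrow> (\<forall>h\<in>D. idem S h \<and> h \<noteq> \<zero>) \<and> (\<forall>h\<in>D. \<forall>k\<in>D. \<exists>l\<in>D. l \<sqsubseteq> h \<and> l \<sqsubseteq> k)"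

lemma eventually_below_conj:
  assumes D: "idem_base D" shows "eventually_below D (\<lambda>h. P h \<and> R h) \<longleftrightarrow> eventually_below D P \<and> eventually_below D R"
proof
  assume "eventually_below D P \<and> eventually_below D R"
  then obtain h k where *: "h \<in> D" "\<forall>l\<in>D. l \<sqsubseteq> h \<longrightarrow> P l" "k \<in> D" "\<forall>l\<in>D. l \<sqsubseteq> k \<longrightarrow> R l"
    unfolding eventually_below_def by blast
  obtain l where l: "l \<in> D" "l \<sqsubseteq> h" "l \<sqsubseteq> k" using D *(1,3) unfolding idem_base_def by blast
  then show "eventually_below D (\<lambda>h. P h \<and> R h)" unfolding eventually_below_def
    using * leq_trans[OF _ l(2)] leq_trans[OF _ l(3)] by (intro bexI[of _ l]) auto
qed (auto simp: eventually_below_def)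

lemma eventually_below_mono:
  "\<lbrakk>eventually_below D P; \<And>h. h \<in> D \<Longrightarrow> P h \<Longrightarrow> R h\<rbrakk> \<Longrightarrow> eventually_below D R"
  unfolding eventually_below_def by blast

lemma eventually_below_combine:
  "\<lbrakk>idem_base D; eventually_below D P; eventually_below D R; \<And>h. \<lbrakk>h \<in> D; P h; R h\<rbrakk> \<Longrightarrow> T h\<rbrakk> \<Longrightarrow> eventually_below D T"
  using eventually_below_mono[of D "\<lambda>h. P h \<and> R h" T] by (simp add: eventually_below_conj)

lemma eventually_below_ex: "\<lbrakk>idem_base D; eventually_below D P\<rbrakk> \<Longrightarrow> \<exists>h\<in>D. P h"
  unfolding eventually_below_def idem_base_def by (meson idem_car leq_refl)

lemma filter_idem_base: assumes A: "proper_filter S A" shows "idem_base (dom S ` A)"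
  unfolding idem_base_def
proof (intro conjI ballI)
  fix h assume "h \<in> dom S ` A"
  then obtain a where a: "a \<in> A" "h = dom S a" by blast
  then show "idem S h" using filter_car[OF A] by simp
  show "h \<noteq> \<zero>"
  proof
    assume "h = \<zero>"
    then have "a = \<zero>" using mul_dom[OF filter_car[OF A a(1)]] a filter_car[OF A a(1)] by simp
    then show False using a filter_zer[OF A] by simp
  qed
  fix k assume "k \<in> dom S ` A"
  then obtain b where b: "b \<in> A" "k = dom S b" by blast
  obtain c where "c \<in> A" "c \<sqsubseteq> a" "c \<sqsubseteq> b" using filter_directed[OF A a(1) b(1)] by blast
  then show "\<exists>l\<in>dom S ` A. l \<sqsubseteq> h \<and> l \<sqsubseteq> k" using a b leq_dom by blast
qed

end

context booleanization begin

definition rep :: "'b \<Rightarrow> ('a \<times> 'a) set" where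
  "rep = (SOME \<psi>. hom B pbij \<psi> \<and> (\<forall>s\<in>car S. \<psi> (\<beta> s) = S.wagner_preston s) \<and>
     (\<forall>x y z. is_join B {x, y} z \<longrightarrow> \<psi> z = \<psi> x \<union> \<psi> y))"

lemma rep_props: "hom B pbij rep" "\<forall>s\<in>car S. rep (\<beta> s) = S.wagner_preston s"
    "\<And>x y z. is_join B {x, y} z \<Longrightarrow> rep z = rep x \<union> rep y"
  using someI_ex[OF representation_exists] unfolding rep_def[symmetric] by blast+

lemma rep_mul: "\<lbrakk>x \<in> car B; y \<in> car B\<rbrakk> \<Longrightarrow> rep (mul B x y) = rep y O rep x"
  and rep_zer: "rep (zer B) = {}"
  using rep_props(1) unfolding hom_def by auto

lemma rep_join_iff: "is_join B {x, y} z \<Longrightarrow> p \<in> rep z \<longleftrightarrow> p \<in> rep x \<or> p \<in> rep y"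
  using rep_props(3) by blast

lemma rep_idem: assumes e: "idem B e" shows "rep e \<subseteq> Id"
proof -
  have "rep e \<in> car pbij" using rep_props(1) e unfolding hom_def by simp
  moreover have "rep e O rep e = rep e" using rep_mul[of e e] e B.idem_idem[OF e] by simp
  ultimately show ?thesis using pbij_idem[of "rep e"] by auto
qed

lemma rep_leq: assumes "leq B x y" shows "rep x \<subseteq> rep y"
  using rep_props(3)[OF B.is_join_absorb[OF assms]] by blast

lemma rep_beta_iff:
  "\<lbrakk>s \<in> car S\<rbrakk> \<Longrightarrow> (t, u) \<in> rep (\<beta> s) \<longleftrightarrow> t \<in> car S \<and> t \<noteq> zer S \<and> mul S (dom S s) t = t \<and> u = mul S s t"
  using rep_props(2) S.wagner_preston_iff by simp

lemma rep_beta_idem_iff: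
  "\<lbrakk>idem S k; idem S h; h \<noteq> zer S\<rbrakk> \<Longrightarrow> (h, h) \<in> rep (\<beta> k) \<longleftrightarrow> leq S h k"
  using rep_beta_iff[of k h h] S.idem_leq_iff[of h k] by auto

lemma rep_meet_iff:
  "\<lbrakk>idem B e; idem B f\<rbrakk> \<Longrightarrow> (h, h) \<in> rep (mul B e f) \<longleftrightarrow> (h, h) \<in> rep e \<and> (h, h) \<in> rep f"
  using rep_idem[of e] rep_idem[of f] by (auto simp: rep_mul)

lemma rep_diff_iff:
  assumes ef: "leq B e f" and f: "idem B f"
  shows "(h, h) \<in> rep (diff B f e) \<longleftrightarrow> (h, h) \<in> rep f \<and> (h, h) \<notin> rep e"
proof -
  have e: "idem B e" and d: "idem B (diff B f e)" using B.leq_idem[OF ef f] B.leq_idem[OF B.diff_leq[OF ef] f] by auto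
  have "mul B (diff B f e) e = zer B" using B.diff_dom[OF ef] e d by simp
  then have "\<not> ((h, h) \<in> rep (diff B f e) \<and> (h, h) \<in> rep e)" using rep_meet_iff[OF d e] rep_zer by simp
  then show ?thesis using rep_join_iff[OF B.diff_join[OF ef]] by blast
qed

text \<open>A generator is decided by whether some element of \<open>D\<close> lies below it; directedness of \<open>D\<close> carries this over
  to Boolean combinations.\<close>
lemma eventually_rep_decided:
  assumes D: "S.idem_base D" "D \<noteq> {}"
  shows "f \<in> gen_idems \<Longrightarrow> S.eventually_below D (\<lambda>h. (h, h) \<in> rep f) \<or> S.eventually_below D (\<lambda>h. (h, h) \<notin> rep f)"
proof (induction rule: gen_idems.induct)
  case (base k)
  have iff: "(h, h) \<in> rep (\<beta> k) \<longleftrightarrow> leq S h k" if "h \<in> D" for h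
    using that D unfolding S.idem_base_def by (intro rep_beta_idem_iff[OF base]) auto
  show ?case
  proof (cases "\<exists>h\<in>D. leq S h k")
    case True
    then obtain h0 where h0: "h0 \<in> D" "leq S h0 k" by blast
    then have "\<forall>h\<in>D. leq S h h0 \<longrightarrow> (h, h) \<in> rep (\<beta> k)" using iff S.leq_trans[OF _ h0(2)] by blast
    then show ?thesis using h0(1) unfolding S.eventually_below_def by blast
  next
    case False
    then show ?thesis using iff D(2) unfolding S.eventually_below_def by blast
  qed
next
  case (meet e f)
  have iff: "(h, h) \<in> rep (mul B e f) \<longleftrightarrow> (h, h) \<in> rep e \<and> (h, h) \<in> rep f" for h
    using meet rep_meet_iff by simp
  let ?Q = "\<lambda>h. (h, h) \<in> rep (mul B e f)"
  have "S.eventually_below D ?Q" if "S.eventually_below D (\<lambda>h. (h, h) \<in> rep e)" "S.eventually_below D (\<lambda>h. (h, h) \<in> rep f)"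
    by (rule S.eventually_below_combine[OF D(1) that]) (use iff in blast)
  moreover have "S.eventually_below D (\<lambda>h. \<not> ?Q h)" if "S.eventually_below D (\<lambda>h. (h, h) \<notin> rep e)"
    by (rule S.eventually_below_mono[OF that]) (use iff in blast)
  moreover have "S.eventually_below D (\<lambda>h. \<not> ?Q h)" if "S.eventually_below D (\<lambda>h. (h, h) \<notin> rep f)"
    by (rule S.eventually_below_mono[OF that]) (use iff in blast)
  ultimately show ?case using meet(3,4) by blast
next
  case (join e f g)
  note iff = rep_join_iff[OF join(3)]
  let ?Q = "\<lambda>h. (h, h) \<in> rep g"
  have "S.eventually_below D (\<lambda>h. \<not> ?Q h)" if "S.eventually_below D (\<lambda>h. (h, h) \<notin> rep e)" "S.eventually_below D (\<lambda>h. (h, h) \<notin> rep f)"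
    by (rule S.eventually_below_combine[OF D(1) that]) (use iff in blast)
  moreover have "S.eventually_below D ?Q" if "S.eventually_below D (\<lambda>h. (h, h) \<in> rep e)"
    by (rule S.eventually_below_mono[OF that]) (use iff in blast)
  moreover have "S.eventually_below D ?Q" if "S.eventually_below D (\<lambda>h. (h, h) \<in> rep f)"
    by (rule S.eventually_below_mono[OF that]) (use iff in blast)
  ultimately show ?case using join(4,5) by blast
next
  case (diff e f)
  note iff = rep_diff_iff[OF diff(3) gen_idems_idem[OF diff(2)]]
  let ?Q = "\<lambda>h. (h, h) \<in> rep (diff B f e)"
  have "S.eventually_below D ?Q" if "S.eventually_below D (\<lambda>h. (h, h) \<notin> rep e)" "S.eventually_below D (\<lambda>h. (h, h) \<in> rep f)"
    by (rule S.eventually_below_combine[OF D(1) that]) (use iff in blast)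
  moreover have "S.eventually_below D (\<lambda>h. \<not> ?Q h)" if "S.eventually_below D (\<lambda>h. (h, h) \<in> rep e)"
    by (rule S.eventually_below_mono[OF that]) (use iff in blast)
  moreover have "S.eventually_below D (\<lambda>h. \<not> ?Q h)" if "S.eventually_below D (\<lambda>h. (h, h) \<notin> rep f)"
    by (rule S.eventually_below_mono[OF that]) (use iff in blast)
  ultimately show ?case using diff(4,5) by blast
qed

lemma prime_filter_iff_eventually:
  fixes U s defines "D \<equiv> {h. idem S h \<and> mul B (\<beta> s) (\<beta> h) \<in> U}"
  assumes U: "prime_filter B U" and s [simp]: "s \<in> car S" and sU: "\<beta> s \<in> U"
  shows "S.idem_base D" "f \<in> gen_idems \<Longrightarrow> mul B (\<beta> s) f \<in> U \<longleftrightarrow> S.eventually_below D (\<lambda>h. (h, h) \<in> rep f)"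
proof -
  note U' = prime_filter_filter[OF U]
  show D: "S.idem_base D"
    unfolding S.idem_base_def
  proof (intro conjI ballI)
    fix h assume h: "h \<in> D"
    then show "idem S h" unfolding D_def by blast
    show "h \<noteq> zer S" using h B.filter_zer[OF U'] unfolding D_def by auto
    fix k assume k: "k \<in> D"
    have hk: "idem S h" "idem S k" using h k unfolding D_def by auto
    then have "mul S h k \<in> D"
      using h k B.prime_filter_meet[OF U, of "\<beta> s" "\<beta> h" "\<beta> k"] S.idem_mul[OF hk] hom_idem
      unfolding D_def by (simp add: hom_mul)
    then show "\<exists>l\<in>D. leq S l h \<and> leq S l k" using S.idem_mul_leq[OF hk] by blast
  qed
  have "mul B (\<beta> s) (\<beta> (dom S s)) = \<beta> s" by (simp add: S.dom_car flip: hom_mul)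
  then have "dom S s \<in> D" unfolding D_def using sU by simp
  then have ne: "D \<noteq> {}" by blast
  note dec = eventually_rep_decided[OF D ne]
  note conj = S.eventually_below_conj[OF D]
  show "mul B (\<beta> s) f \<in> U \<longleftrightarrow> S.eventually_below D (\<lambda>h. (h, h) \<in> rep f)" if "f \<in> gen_idems"
    using that
  proof (induction rule: gen_idems.induct)
    case (base k)
    have iff: "(h, h) \<in> rep (\<beta> k) \<longleftrightarrow> leq S h k" if "h \<in> D" for h
      using that D unfolding S.idem_base_def by (intro rep_beta_idem_iff[OF base]) auto
    show ?case
    proof
      assume "mul B (\<beta> s) (\<beta> k) \<in> U"
      then have "k \<in> D" using base unfolding D_def by simp
      then show "S.eventually_below D (\<lambda>h. (h, h) \<in> rep (\<beta> k))" unfolding S.eventually_below_def using iff by blast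
    next
      assume "S.eventually_below D (\<lambda>h. (h, h) \<in> rep (\<beta> k))"
      then obtain h where h: "h \<in> D" "leq S h k" using S.eventually_below_ex[OF D] iff by blast
      then have "leq B (mul B (\<beta> s) (\<beta> h)) (mul B (\<beta> s) (\<beta> k))" by (intro B.leq_mul_left hom_leq) auto
      then show "mul B (\<beta> s) (\<beta> k) \<in> U" using h(1) B.filter_up[OF U'] unfolding D_def by blast
    qed
  next
    case (meet e f)
    then show ?case
      using B.prime_filter_meet[OF U, of "\<beta> s" e f] conj[of "\<lambda>h. (h, h) \<in> rep e" "\<lambda>h. (h, h) \<in> rep f"]
      by (simp add: rep_meet_iff)
  next
    case (join e f g)
    have "S.eventually_below D (\<lambda>h. (h, h) \<in> rep e \<or> (h, h) \<in> rep f) \<longleftrightarrow>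
        S.eventually_below D (\<lambda>h. (h, h) \<in> rep e) \<or> S.eventually_below D (\<lambda>h. (h, h) \<in> rep f)" (is "?L \<longleftrightarrow> ?R")
    proof
      assume ?L
      have "S.eventually_below D (\<lambda>h. (h, h) \<in> rep f)" if "S.eventually_below D (\<lambda>h. (h, h) \<notin> rep e)"
        by (rule S.eventually_below_combine[OF D \<open>?L\<close> that]) blast
      then show ?R using dec[OF join(1)] by blast
    qed (auto elim: S.eventually_below_mono)
    then show ?case using join rep_join_iff[OF join(3)] B.prime_filter_join[OF U _ join(3), of "\<beta> s"] by simp
  next
    case (diff e f)
    have "S.eventually_below D (\<lambda>h. (h, h) \<in> rep f \<and> (h, h) \<notin> rep e) \<longleftrightarrow>
        S.eventually_below D (\<lambda>h. (h, h) \<in> rep f) \<and> \<not> S.eventually_below D (\<lambda>h. (h, h) \<in> rep e)"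
      unfolding conj using dec[OF diff(1)] S.eventually_below_ex[OF D]
        conj[of "\<lambda>h. (h, h) \<in> rep e" "\<lambda>h. (h, h) \<notin> rep e"] by blast
    then show ?case using diff rep_diff_iff[OF diff(3)] B.prime_filter_diff[OF U _ diff(3), of "\<beta> s"] by simp
  qed
qed

lemma prime_filter_preimage:
  assumes U: "prime_filter B U" shows "proper_filter S {s \<in> car S. \<beta> s \<in> U}"
  unfolding proper_filter_def
proof (intro conjI ballI allI impI)
  note U' = prime_filter_filter[OF U]
  let ?A = "{s \<in> car S. \<beta> s \<in> U}"
  have "x \<in> U \<longrightarrow> ?A \<noteq> {}" if "x \<in> generated" for x
    using that
  proof (induction rule: generated.induct)
    case (base s e)
    have "leq B (mul B (\<beta> s) e) (\<beta> s)" using base by (intro B.leqI) auto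
    then show ?case using base(1) B.filter_up[OF U'] by blast
  next
    case (join x y z)
    then show ?case using prime_filter_prime[OF U join(3)] by blast
  qed
  then show "?A \<noteq> {}" using B.filter_nonempty[OF U'] B.filter_car[OF U'] generated_eq by metis
  show "b \<in> ?A" if "a \<in> ?A" "leq S a b" for a b
    using that B.filter_up[OF U' _ hom_leq[OF that(2)]] S.leq_car by blast
  show "zer S \<notin> ?A" using B.filter_zer[OF U'] by simp
  show "\<exists>c\<in>?A. leq S c a \<and> leq S c b" if ab: "a \<in> ?A" "b \<in> ?A" for a b
  proof -
    have [simp]: "a \<in> car S" "b \<in> car S" and aU: "\<beta> a \<in> U" and bU: "\<beta> b \<in> U" using ab by auto
    let ?D = "{h. idem S h \<and> mul B (\<beta> a) (\<beta> h) \<in> U}"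
    obtain c where c: "c \<in> U" "leq B c (\<beta> a)" "leq B c (\<beta> b)" using B.filter_directed[OF U' aU bU] by blast
    have [simp]: "c \<in> car B" using c B.leq_car by blast
    let ?f = "dom B c"
    have ca: "mul B (\<beta> a) ?f = c" and cb: "mul B (\<beta> b) ?f = c" using c B.leq_dom_mul by auto
    have f: "?f \<in> gen_idems" by (simp add: idem_gen)
    note D = prime_filter_iff_eventually(1)[OF U \<open>a \<in> car S\<close> aU]
    have "S.eventually_below ?D (\<lambda>h. (h, h) \<in> rep ?f)"
      using prime_filter_iff_eventually(2)[OF U \<open>a \<in> car S\<close> aU f] ca c(1) by simp
    moreover have "S.eventually_below ?D (\<lambda>h. (h, h) \<in> rep (\<beta> (dom S a)))"
      using prime_filter_iff_eventually(2)[OF U \<open>a \<in> car S\<close> aU gen_idems.base[of "dom S a"]] aU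
      by (simp add: S.dom_car flip: hom_mul)
    ultimately obtain h where h: "h \<in> ?D" "(h, h) \<in> rep ?f" "(h, h) \<in> rep (\<beta> (dom S a))"
      using S.eventually_below_ex[OF D] S.eventually_below_conj[OF D, of "\<lambda>h. (h, h) \<in> rep ?f" "\<lambda>h. (h, h) \<in> rep (\<beta> (dom S a))"] by blast
    have hid: "idem S h" "mul B (\<beta> a) (\<beta> h) \<in> U" using h(1) by auto
    have "(h, mul S a h) \<in> rep (\<beta> a)"
      using h(3) rep_beta_iff[of "dom S a" h h] rep_beta_iff[of a h "mul S a h"] by (simp add: S.dom_car)
    then have "(h, mul S a h) \<in> rep (mul B (\<beta> a) ?f)" using h(2) by (auto simp: rep_mul)
    then have "(h, mul S a h) \<in> rep (mul B (\<beta> b) ?f)" using ca cb by simp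
    then have "(h, mul S a h) \<in> rep (\<beta> b)" using rep_leq[OF B.leqI[of ?f "\<beta> b"]] by auto
    then have eq: "mul S a h = mul S b h" using rep_beta_iff[of b h] by simp
    have "leq S (mul S a h) a" "leq S (mul S a h) b"
      using S.leqI[OF hid(1), of a] S.leqI[OF hid(1), of b] unfolding eq[symmetric] by auto
    moreover have "mul S a h \<in> ?A" using hid by (simp add: hom_mul)
    ultimately show ?thesis by blast
  qed
qed auto

lemma prime_filter_determined:
  assumes U: "prime_filter B U" and V: "prime_filter B V" and eq: "{s \<in> car S. \<beta> s \<in> U} = {s \<in> car S. \<beta> s \<in> V}"
  shows "U = V"
proof -
  have eq': "\<beta> t \<in> U \<longleftrightarrow> \<beta> t \<in> V" if "t \<in> car S" for t using eq that by blast
  have *: "mul B (\<beta> s) e \<in> U \<longleftrightarrow> mul B (\<beta> s) e \<in> V" if "e \<in> gen_idems" "s \<in> car S" for e s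
    using that
  proof (induction rule: gen_idems.induct)
    case (base e)
    then have "\<beta> (mul S s e) \<in> U \<longleftrightarrow> \<beta> (mul S s e) \<in> V" by (intro eq') auto
    then show ?case using base by (simp add: hom_mul)
  next
    case (meet e f)
    then show ?case using B.prime_filter_meet[OF U, of "\<beta> s" e f] B.prime_filter_meet[OF V, of "\<beta> s" e f] by simp
  next
    case (join e f g)
    then show ?case
      using B.prime_filter_join[OF U _ join(3), of "\<beta> s"] B.prime_filter_join[OF V _ join(3), of "\<beta> s"] by simp
  next
    case (diff e f)
    then show ?case
      using B.prime_filter_diff[OF U _ diff(3), of "\<beta> s"] B.prime_filter_diff[OF V _ diff(3), of "\<beta> s"] by simp
  qed
  have "x \<in> U \<longleftrightarrow> x \<in> V" if "x \<in> generated" for x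
    using that
  proof (induction rule: generated.induct)
    case (base s e)
    then show ?case using * by blast
  next
    case (join x y z)
    then show ?case
      using prime_filter_prime[OF U join(3)] prime_filter_prime[OF V join(3)] B.is_join2[OF join(3)]
        B.filter_up[OF prime_filter_filter[OF U]] B.filter_up[OF prime_filter_filter[OF V]] by blast
  qed
  then show ?thesis
    using generated_eq B.filter_car[OF prime_filter_filter[OF U]] B.filter_car[OF prime_filter_filter[OF V]] by blast
qed

text \<open>The prime filter of \<open>B\<close> extending a filter \<open>A\<close> of \<open>S\<close>: germs at the points \<open>dom a\<close>, \<open>a \<in> A\<close>.\<close>

definition extension :: "'a set \<Rightarrow> 'b set" where
  "extension A = {b. \<exists>s\<in>A. \<exists>e. idem B e \<and> S.eventually_below (dom S ` A) (\<lambda>h. (h, h) \<in> rep e) \<and> leq B (mul B (\<beta> s) e) b}"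

lemma extension_point:
  assumes A: "proper_filter S A" and s: "s \<in> A" and e: "idem B e"
    and ev: "S.eventually_below (dom S ` A) (\<lambda>h. (h, h) \<in> rep e)"
  shows "\<exists>a\<in>A. leq S a s \<and> (dom S a, a) \<in> rep (mul B (\<beta> s) e)"
proof -
  obtain a0 where a0: "a0 \<in> A" "\<forall>h\<in>dom S ` A. leq S h (dom S a0) \<longrightarrow> (h, h) \<in> rep e"
    using ev unfolding S.eventually_below_def by blast
  obtain a where a: "a \<in> A" "leq S a a0" "leq S a s" using S.filter_directed[OF A a0(1) s] by blast
  note [simp] = S.leq_car[OF a(3)] e
  have "(dom S a, dom S a) \<in> rep e" using a0(2) a S.leq_dom by blast
  moreover have "dom S a \<noteq> zer S" using S.filter_idem_base[OF A] a(1) unfolding S.idem_base_def by blast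
  then have "(dom S a, a) \<in> rep (\<beta> s)"
    using S.leq_dom[OF a(3)] S.leqD[OF a(3)] by (simp add: rep_beta_iff S.idem_leq_iff)
  ultimately show ?thesis using a by (auto simp: rep_mul)
qed

lemma eventually_rep_dom:
  assumes A: "proper_filter S A" and s: "s \<in> A"
  shows "S.eventually_below (dom S ` A) (\<lambda>h. (h, h) \<in> rep (\<beta> (dom S s)))"
  unfolding S.eventually_below_def
proof (intro bexI ballI impI)
  fix h assume h: "h \<in> dom S ` A" "leq S h (dom S s)"
  have "idem S h" "h \<noteq> zer S" using S.filter_idem_base[OF A] h(1) unfolding S.idem_base_def by blast+
  then show "(h, h) \<in> rep (\<beta> (dom S s))" using rep_beta_idem_iff h(2) S.filter_car[OF A s] by simp
qed (use s in blast)

lemma extension_prime_filter: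
  assumes A: "proper_filter S A" shows "prime_filter B (extension A)"
proof -
  let ?D = "dom S ` A" and ?U = "extension A"
  let ?ev = "\<lambda>e. S.eventually_below ?D (\<lambda>h. (h, h) \<in> rep e)"
  note D = S.filter_idem_base[OF A] and Ac = S.filter_car[OF A]
  have ne: "?D \<noteq> {}" using S.filter_nonempty[OF A] by blast
  note ev_dom = eventually_rep_dom[OF A]
  have ev_meet: "?ev (mul B e f)" if "idem B e" "idem B f" "?ev e" "?ev f" for e f
    using that S.eventually_below_conj[OF D, of "\<lambda>h. (h, h) \<in> rep e" "\<lambda>h. (h, h) \<in> rep f"] by (simp add: rep_meet_iff)
  have U: "proper_filter B ?U"
    unfolding proper_filter_def
  proof (intro conjI ballI allI impI)
    show "?U \<subseteq> car B" unfolding extension_def using B.leq_car by blast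
    obtain a where a: "a \<in> A" using S.filter_nonempty[OF A] by blast
    have "mul B (\<beta> a) (\<beta> (dom S a)) \<in> ?U"
      unfolding extension_def using a ev_dom[OF a] Ac[OF a]
      by (auto intro!: bexI[of _ a] exI[of _ "\<beta> (dom S a)"] hom_idem)
    then show "?U \<noteq> {}" by blast
    show "y \<in> ?U" if "x \<in> ?U" "leq B x y" for x y
      using that B.leq_trans unfolding extension_def by blast
    show "\<exists>z\<in>?U. leq B z x \<and> leq B z y" if xy: "x \<in> ?U" "y \<in> ?U" for x y
    proof -
      obtain s e where s: "s \<in> A" "idem B e" "?ev e" "leq B (mul B (\<beta> s) e) x" using xy unfolding extension_def by blast
      obtain t f where t: "t \<in> A" "idem B f" "?ev f" "leq B (mul B (\<beta> t) f) y" using xy unfolding extension_def by blast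
      obtain r where r: "r \<in> A" "leq S r s" "leq S r t" using S.filter_directed[OF A s(1) t(1)] by blast
      note [simp] = Ac[OF r(1)]
      let ?z = "mul B (\<beta> r) (mul B e f)"
      have "leq B ?z (mul B (\<beta> s) e)" "leq B ?z (mul B (\<beta> t) f)"
        using r s t by (auto intro!: B.leq_mul hom_leq B.idem_mul_leq)
      then have "leq B ?z x" "leq B ?z y" using s t B.leq_trans by blast+
      moreover have "?z \<in> ?U"
        unfolding extension_def using r(1) ev_meet[OF s(2) t(2) s(3) t(3)] s(2) t(2) B.idem_mul[OF s(2) t(2)]
        by (auto intro!: bexI[of _ r] exI[of _ "mul B e f"])
      ultimately show ?thesis by blast
    qed
    show "zer B \<notin> ?U"
    proof
      assume "zer B \<in> ?U"
      then obtain s e where s: "s \<in> A" "idem B e" "?ev e" "leq B (mul B (\<beta> s) e) (zer B)" unfolding extension_def by blast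
      then show False using extension_point[OF A s(1-3)] rep_leq[OF s(4)] rep_zer by blast
    qed
  qed
  show ?thesis
    unfolding prime_filter_def
  proof (intro conjI U allI impI)
    fix x y z assume xyz: "is_join B {x, y} z \<and> z \<in> ?U"
    then have xz: "leq B x z" "leq B y z" using B.is_join2 by blast+
    note [simp] = B.leq_car[OF xz(1)] B.leq_car[OF xz(2)]
    obtain s e where s: "s \<in> A" "idem B e" "?ev e" "leq B (mul B (\<beta> s) e) z" using xyz unfolding extension_def by blast
    have [simp]: "s \<in> car S" "e \<in> car B" using Ac s by auto
    let ?w = "mul B (\<beta> s) e"
    have ew: "?ev (dom B ?w)"
      using ev_meet[OF _ s(2) ev_dom[OF s(1)] s(3)] s(2) hom_idem by (simp add: B.dom_mul_idem hom_dom)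
    have xin: "u \<in> ?U" if u: "leq B u z" "?ev (dom B u)" for u
    proof -
      note [simp] = B.leq_car[OF u(1)]
      have "mul B ?w (dom B u) = mul B (mul B z (dom B ?w)) (dom B u)" using B.leqD[OF s(4)] by simp
      also have "\<dots> = mul B (mul B z (dom B u)) (dom B ?w)"
        using B.idem_commute[of "dom B ?w" "dom B u"] by (simp add: B.mul_assoc)
      also have "\<dots> = mul B u (dom B ?w)" using B.leqD[OF u(1)] by simp
      finally have "leq B (mul B ?w (dom B u)) u" using B.leqI[of "dom B ?w" u] by simp
      then have "leq B (mul B (\<beta> s) (mul B e (dom B u))) u" by (simp add: B.mul_assoc)
      then show ?thesis unfolding extension_def using s(1) ev_meet[OF s(2) _ s(3) u(2)] B.idem_mul[OF s(2), of "dom B u"] by auto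
    qed
    have "?ev (dom B z)"
      by (rule S.eventually_below_mono[OF ew]) (use rep_leq[OF B.leq_dom[OF s(4)]] in blast)
    then have "S.eventually_below ?D (\<lambda>h. (h, h) \<in> rep (dom B x) \<or> (h, h) \<in> rep (dom B y))"
      using rep_join_iff[OF B.is_join2_dom[of x y z]] xyz by simp
    then have "?ev (dom B y)" if "S.eventually_below ?D (\<lambda>h. (h, h) \<notin> rep (dom B x))"
      by (rule S.eventually_below_combine[OF D _ that]) blast
    then have "?ev (dom B x) \<or> ?ev (dom B y)"
      using eventually_rep_decided[OF D ne idem_gen[of "dom B x"]] by auto
    then show "x \<in> ?U \<or> y \<in> ?U" using xin xz by blast
  qed
qed

lemma extension_preimage:
  assumes A: "proper_filter S A" shows "{s \<in> car S. \<beta> s \<in> extension A} = A"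
proof (intro equalityI subsetI)
  fix t assume "t \<in> {s \<in> car S. \<beta> s \<in> extension A}"
  then obtain s e where t: "t \<in> car S" and s: "s \<in> A" "idem B e"
      "S.eventually_below (dom S ` A) (\<lambda>h. (h, h) \<in> rep e)" "leq B (mul B (\<beta> s) e) (\<beta> t)"
    unfolding extension_def by blast
  obtain a where a: "a \<in> A" "(dom S a, a) \<in> rep (mul B (\<beta> s) e)" using extension_point[OF A s(1-3)] by blast
  then have "(dom S a, a) \<in> rep (\<beta> t)" using rep_leq[OF s(4)] by blast
  then have "leq S a t" unfolding leq_def using t S.filter_car[OF A a(1)] by (simp add: rep_beta_iff)
  then show "t \<in> A" using S.filter_up[OF A a(1)] by blast
next
  fix s assume s: "s \<in> A"
  note [simp] = S.filter_car[OF A s]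
  note eventually_rep_dom[OF A s]
  moreover have "mul B (\<beta> s) (\<beta> (dom S s)) = \<beta> s" by (simp add: S.dom_car flip: hom_mul)
  ultimately have "\<beta> s \<in> extension A" unfolding extension_def using s hom_idem[of "dom S s"]
    by (auto intro!: bexI[of _ s] exI[of _ "\<beta> (dom S s)"])
  then show "s \<in> {s \<in> car S. \<beta> s \<in> extension A}" by simp
qed

end

section \<open>Tight filters and the Cuntz--Krieger ideal\<close>

context booleanization begin

lemma cover_join:
  assumes C: "cover S a C"
  shows "is_join B (\<beta> ` C) (join B (\<beta> ` C))" "leq B (join B (\<beta> ` C)) (\<beta> a)"
proof -
  have le: "leq B x (\<beta> a)" if "x \<in> \<beta> ` C" for x using that S.coverD(3)[OF C] hom_leq by blast
  then show j: "is_join B (\<beta> ` C) (join B (\<beta> ` C))"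
    using S.coverD(2)[OF C] by (intro B.bounded_join_exists[of _ "\<beta> a"]) auto
  show "leq B (join B (\<beta> ` C)) (\<beta> a)" using B.is_join_least[OF j] le S.coverD(1)[OF C] by simp
qed

lemma CK_generators_car: "CK_generators S B \<beta> \<subseteq> car B"
  unfolding CK_generators_def using cover_join(2) B.diff_car by blast

lemma zer_CK_generators: "zer B \<in> CK_generators S B \<beta>"
proof -
  have C: "cover S (zer S) {}" unfolding cover_def using S.leq_zer by auto
  have "join B (\<beta> ` {}) = zer B" using B.join_eq[OF B.is_join_empty] by simp
  then have "leq B (diff B (\<beta> (zer S)) (join B (\<beta> ` {}))) (zer B)" using B.diff_leq[of "zer B" "zer B"] by simp
  then have "diff B (\<beta> (zer S)) (join B (\<beta> ` {})) = zer B" by (rule B.leq_zer)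
  then show ?thesis unfolding CK_generators_def using C S.zer_car by (metis (mono_tags, lifting) mem_Collect_eq)
qed

lemma CK_ideal_ideal: "additive_ideal B (CK_ideal S B \<beta>)"
proof -
  have join: "join B {x, y} \<in> car B" if "x \<in> car B" "y \<in> car B" "compatible B x y" for x y
    using B.is_join_car[OF B.is_join2_exists[OF that]] .
  have "additive_ideal B (car B)" unfolding additive_ideal_def using join by simp
  then have sub: "CK_ideal S B \<beta> \<subseteq> car B" unfolding CK_ideal_def using CK_generators_car by blast
  show ?thesis
    unfolding additive_ideal_def
  proof (intro conjI ballI impI sub)
    fix x s assume "x \<in> CK_ideal S B \<beta>" "s \<in> car B"
    then show "mul B s x \<in> CK_ideal S B \<beta>" "mul B x s \<in> CK_ideal S B \<beta>"
      unfolding CK_ideal_def additive_ideal_def by blast+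
  next
    fix x y assume "x \<in> CK_ideal S B \<beta>" "y \<in> CK_ideal S B \<beta>" "compatible B x y"
    then show "join B {x, y} \<in> CK_ideal S B \<beta>" unfolding CK_ideal_def additive_ideal_def by blast
  qed
qed

lemma CK_generators_sub: "CK_generators S B \<beta> \<subseteq> CK_ideal S B \<beta>"
  unfolding CK_ideal_def by blast

lemma CK_ideal_least: "\<lbrakk>additive_ideal B J; CK_generators S B \<beta> \<subseteq> J\<rbrakk> \<Longrightarrow> CK_ideal S B \<beta> \<subseteq> J"
  unfolding CK_ideal_def by blast

definition tight_prime :: "'b set \<Rightarrow> bool" where
  "tight_prime U \<longleftrightarrow> prime_filter B U \<and> tight_filter S {s \<in> car S. \<beta> s \<in> U}"

lemma tight_prime_setinv:
  assumes "tight_prime U" shows "tight_prime (setinv B U)"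
proof -
  have U: "prime_filter B U" and t: "tight_filter S {s \<in> car S. \<beta> s \<in> U}" using assms unfolding tight_prime_def by auto
  note Uc = B.filter_subset[OF prime_filter_filter[OF U]]
  have "{s \<in> car S. \<beta> s \<in> setinv B U} = setinv S {s \<in> car S. \<beta> s \<in> U}"
    by (auto simp: B.setinv_iff[OF Uc] S.setinv_iff hom_inv)
  then show ?thesis unfolding tight_prime_def using B.prime_filter_setinv[OF U] S.setinv_tight[OF t] by simp
qed

lemma tight_prime_translate:
  assumes "tight_prime U" and s [simp]: "s \<in> car S" and d: "\<And>u. u \<in> U \<Longrightarrow> mul B (dom B (\<beta> s)) u \<in> U"
  shows "tight_prime (B.translate (\<beta> s) U)"
proof -
  have U: "prime_filter B U" and t: "tight_filter S {s \<in> car S. \<beta> s \<in> U}" using assms unfolding tight_prime_def by auto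
  note U' = prime_filter_filter[OF U]
  let ?A = "{s \<in> car S. \<beta> s \<in> U}"
  have dA: "mul S (dom S s) a \<in> ?A" if "a \<in> ?A" for a using that d[of "\<beta> a"] by (simp add: hom_mul hom_dom S.dom_car)
  have "{t \<in> car S. \<beta> t \<in> B.translate (\<beta> s) U} = S.translate s ?A"
  proof (intro equalityI subsetI)
    fix t assume "t \<in> {t \<in> car S. \<beta> t \<in> B.translate (\<beta> s) U}"
    then obtain u where t [simp]: "t \<in> car S" and u: "u \<in> U" "leq B (mul B (\<beta> s) u) (\<beta> t)"
      unfolding B.translate_def by blast
    have "mul B (inv B (\<beta> s)) (mul B (\<beta> s) u) = mul B (dom B (\<beta> s)) u"
      using B.filter_car[OF U' u(1)] by (intro B.inv_mul_mul) auto
    then have "leq B (mul B (dom B (\<beta> s)) u) (\<beta> (mul S (inv S s) t))"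
      using B.leq_mul_left[OF u(2), of "inv B (\<beta> s)"] by (simp add: hom_mul hom_inv)
    then have "mul S (inv S s) t \<in> ?A" using d[OF u(1)] B.filter_up[OF U'] by simp
    moreover have "mul S s (mul S (inv S s) t) = mul S (ran S s) t" by (simp add: ran_def S.mul_assoc)
    then have "leq S (mul S s (mul S (inv S s) t)) t" using S.leqI'[of "ran S s" t] by simp
    ultimately show "t \<in> S.translate s ?A" by (rule S.translateI)
  next
    fix t assume "t \<in> S.translate s ?A"
    then obtain a where a: "a \<in> car S" "\<beta> a \<in> U" "leq S (mul S s a) t" unfolding S.translate_def by blast
    have "\<beta> t \<in> B.translate (\<beta> s) U" using hom_leq[OF a(3)] a by (intro B.translateI[OF a(2)]) (simp add: hom_mul)
    then show "t \<in> {t \<in> car S. \<beta> t \<in> B.translate (\<beta> s) U}" using S.leq_car[OF a(3)] by blast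
  qed
  then show ?thesis
    unfolding tight_prime_def using B.prime_filter_translate[OF U _ d] S.translate_tight[OF t s dA] by simp
qed

text \<open>If \<open>\<beta> s \<cdot> w\<close> lies in a tight prime filter, then \<open>w\<close> lies in its translate by \<open>s\<inverse>\<close>, again tight.\<close>
lemma tight_prime_mul:
  assumes b: "b \<in> generated" and x [simp]: "x \<in> car B" and no: "\<And>U. tight_prime U \<Longrightarrow> x \<notin> U"
  shows "tight_prime U \<Longrightarrow> mul B b x \<notin> U"
  using b
proof (induction arbitrary: U rule: generated.induct)
  case (base s e)
  note [simp] = base(1,2)
  have U: "prime_filter B U" using base unfolding tight_prime_def by auto
  note U' = prime_filter_filter[OF U]
  let ?i = "inv S s"
  show ?case
  proof
    assume in_U: "mul B (mul B (\<beta> s) e) x \<in> U"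
    let ?w = "mul B e x"
    have bi: "inv B (\<beta> ?i) = \<beta> s" "dom B (\<beta> ?i) = ran B (\<beta> s)" by (simp_all add: hom_inv)
    have sw: "mul B (\<beta> s) ?w \<in> U" using in_U by (simp add: B.mul_assoc)
    have "mul B (ran B (\<beta> s)) (mul B (\<beta> s) ?w) = mul B (\<beta> s) ?w" by (simp add: B.mul_assoc[symmetric] B.ran_car)
    then have d: "mul B (dom B (\<beta> ?i)) u \<in> U" if "u \<in> U" for u
      using B.filter_left_idem[OF U' _ sw _ that, of "ran B (\<beta> s)"] sw bi by simp
    have "tight_prime (B.translate (\<beta> ?i) U)" by (rule tight_prime_translate[OF base(3) _ d]) simp_all
    moreover have "leq B (mul B (\<beta> ?i) (mul B (\<beta> s) ?w)) x"
    proof -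
      have "mul B (\<beta> ?i) (mul B (\<beta> s) ?w) = mul B (mul B (dom B (\<beta> s)) e) x"
        by (simp add: hom_inv dom_def B.mul_assoc)
      then show ?thesis using B.leqI'[of "mul B (dom B (\<beta> s)) e" x] B.idem_mul[of "dom B (\<beta> s)" e] by simp
    qed
    then have "x \<in> B.translate (\<beta> ?i) U" by (rule B.translateI[OF sw])
    ultimately show False using no by blast
  qed
next
  case (join u v z)
  have U: "prime_filter B U" using join unfolding tight_prime_def by auto
  show ?case using prime_filter_prime[OF U B.is_join2_mul'[OF join(3) x]] join by blast
qed

lemma tight_iff_disjoint:
  assumes U: "prime_filter B U"
  shows "tight_filter S {s \<in> car S. \<beta> s \<in> U} \<longleftrightarrow> U \<inter> CK_ideal S B \<beta> = {}"
proof
  assume disj: "U \<inter> CK_ideal S B \<beta> = {}"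
  show "tight_filter S {s \<in> car S. \<beta> s \<in> U}"
    unfolding tight_filter_def
  proof (intro conjI prime_filter_preimage[OF U] ballI allI impI)
    fix a C assume a: "a \<in> {s \<in> car S. \<beta> s \<in> U}" and C: "cover S a C"
    note j = cover_join[OF C]
    have "diff B (\<beta> a) (join B (\<beta> ` C)) \<in> CK_generators S B \<beta>" unfolding CK_generators_def using a C by blast
    then have "diff B (\<beta> a) (join B (\<beta> ` C)) \<notin> U" using CK_generators_sub disj by blast
    then have "join B (\<beta> ` C) \<in> U" using prime_filter_prime[OF U B.diff_join[OF j(2)]] a by blast
    then have "\<beta> ` C \<inter> U \<noteq> {}"
      using S.coverD(2)[OF C] by (intro B.prime_filter_finite_join[OF U _ j(1)]) auto
    then show "C \<inter> {s \<in> car S. \<beta> s \<in> U} \<noteq> {}" using S.coverD(3)[OF C] S.leq_car by blast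
  qed
next
  assume t: "tight_filter S {s \<in> car S. \<beta> s \<in> U}"
  let ?J = "{x \<in> car B. \<forall>U. tight_prime U \<longrightarrow> x \<notin> U}"
  have left: "mul B b x \<in> ?J" if "x \<in> ?J" "b \<in> car B" for x b
    using that tight_prime_mul[OF generated_eq[OF that(2)], of x] by auto
  have inv: "inv B x \<in> ?J" if x: "x \<in> ?J" for x
  proof -
    have "inv B x \<notin> U" if "tight_prime U" for U
    proof
      assume "inv B x \<in> U"
      moreover have "prime_filter B U" using that unfolding tight_prime_def by blast
      ultimately have "x \<in> setinv B U"
        using x B.setinv_iff[OF B.filter_subset[OF prime_filter_filter]] by blast
      then show False using x tight_prime_setinv[OF that] by blast
    qed
    then show ?thesis using x by simp
  qed
  have "additive_ideal B ?J"
    unfolding additive_ideal_def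
  proof (intro conjI ballI impI)
    fix x s assume x: "x \<in> ?J" and s: "s \<in> car B"
    show "mul B s x \<in> ?J" by (rule left[OF x s])
    have "inv B (mul B (inv B s) (inv B x)) \<in> ?J" by (intro inv left x) (use s in simp)
    then show "mul B x s \<in> ?J" using x s by (simp add: B.inv_mul)
  next
    fix x y assume x: "x \<in> ?J" and y: "y \<in> ?J" and c: "compatible B x y"
    then have j: "is_join B {x, y} (join B {x, y})" using B.is_join2_exists by blast
    then show "join B {x, y} \<in> ?J"
      using x y B.is_join_car[OF j] prime_filter_prime[OF _ j] unfolding tight_prime_def by blast
  qed blast
  moreover have "CK_generators S B \<beta> \<subseteq> ?J"
  proof
    fix g assume g: "g \<in> CK_generators S B \<beta>"
    then obtain a C where a: "a \<in> car S" and C: "cover S a C" and gd: "g = diff B (\<beta> a) (join B (\<beta> ` C))"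
      unfolding CK_generators_def by blast
    note j = cover_join[OF C]
    have gc: "g \<in> car B" using g CK_generators_car by blast
    have "g \<notin> U" if U: "tight_prime U" for U
    proof
      assume gU: "g \<in> U"
      have "prime_filter B U" using U unfolding tight_prime_def by blast
      note U' = prime_filter_filter[OF this]
      have "\<beta> a \<in> U" using B.filter_up[OF U' gU] B.diff_leq[OF j(2)] gd by blast
      then obtain c where c: "c \<in> C" "\<beta> c \<in> U" using U a C unfolding tight_prime_def tight_filter_def by blast
      have "join B (\<beta> ` C) \<in> U" using B.filter_up[OF U' c(2)] B.is_join_upper[OF j(1)] c(1) by blast
      then obtain z where z: "z \<in> U" "leq B z g" "leq B z (join B (\<beta> ` C))" using B.filter_directed[OF U' gU] by blast
      have "z = zer B"
        by (rule B.disjoint_dom_bounded[OF gc _ _ z(2,3)]) (use B.diff_dom[OF j(2)] B.leq_car[OF j(2)] gd in auto)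
      then show False using z(1) B.filter_zer[OF U'] by blast
    qed
    then show "g \<in> ?J" using gc by blast
  qed
  ultimately have "CK_ideal S B \<beta> \<subseteq> ?J" by (rule CK_ideal_least)
  moreover have "tight_prime U" using U t unfolding tight_prime_def by blast
  ultimately show "U \<inter> CK_ideal S B \<beta> = {}" by blast
qed

end

sublocale booleanization \<subseteq> CK: bisg_ideal B "CK_ideal S B \<beta>"
  using CK_ideal_ideal zer_CK_generators CK_generators_sub by unfold_locales auto

context booleanization begin

abbreviation T where "T \<equiv> exel_completion S B \<beta>"

definition stone_to_tight :: "'b set set \<Rightarrow> 'a set" where
  "stone_to_tight V = {s \<in> car S. CK.cl (\<beta> s) \<in> V}"

lemma T_eq: "T = CK.Q" unfolding exel_completion_def ..

lemma isg_T: "isg T" unfolding T_eq by (rule CK.Q.isg_axioms)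

lemma stone_to_tight_eq: "stone_to_tight V = {s \<in> car S. \<beta> s \<in> {b \<in> car B. CK.cl b \<in> V}}"
  unfolding stone_to_tight_def by auto

lemma stone_to_tight_filter: assumes "ultrafilter T V" shows "tight_filter S (stone_to_tight V)"
proof -
  note V = CK.ultrafilter_preimage[OF assms[unfolded T_eq]]
  show ?thesis unfolding stone_to_tight_eq by (rule tight_iff_disjoint[OF V(1), THEN iffD2, OF V(2)])
qed

lemma stone_to_tight_inj: assumes U: "ultrafilter T U" and V: "ultrafilter T V" and eq: "stone_to_tight U = stone_to_tight V" shows "U = V"
proof -
  let ?pre = "\<lambda>V. {b \<in> car B. CK.cl b \<in> V}"
  have "?pre U = ?pre V"
    by (rule prime_filter_determined[OF CK.ultrafilter_preimage(1)[OF U[unfolded T_eq]]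
          CK.ultrafilter_preimage(1)[OF V[unfolded T_eq]] eq[unfolded stone_to_tight_eq]])
  then have "(\<lambda>a. CK.cl a) ` ?pre U = (\<lambda>a. CK.cl a) ` ?pre V" by (rule arg_cong)
  then show ?thesis
    unfolding CK.image_preimage[OF CK.Q.ultrafilter_filter[OF U[unfolded T_eq]]]
      CK.image_preimage[OF CK.Q.ultrafilter_filter[OF V[unfolded T_eq]]] .
qed

definition tight_to_stone :: "'a set \<Rightarrow> 'b set set" where
  "tight_to_stone A = (\<lambda>a. CK.cl a) ` extension A"

lemma tight_to_stone_props:
  assumes A: "tight_filter S A"
  shows tight_to_stone_ultrafilter: "ultrafilter T (tight_to_stone A)" and stone_to_tight_inverse: "stone_to_tight (tight_to_stone A) = A"
    and tight_to_stone_iff: "b \<in> car B \<Longrightarrow> CK.cl b \<in> tight_to_stone A \<longleftrightarrow> b \<in> extension A"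
proof -
  note A' = S.tight_filter_filter[OF A]
  note E = extension_prime_filter[OF A'] and pre = extension_preimage[OF A']
  have disj: "extension A \<inter> CK_ideal S B \<beta> = {}" using tight_iff_disjoint[OF E] A pre by simp
  show "ultrafilter T (tight_to_stone A)" unfolding T_eq tight_to_stone_def by (rule CK.prime_image_ultrafilter[OF E disj])
  show iff: "CK.cl b \<in> tight_to_stone A \<longleftrightarrow> b \<in> extension A" if "b \<in> car B" for b
    unfolding tight_to_stone_def by (rule CK.prime_image_iff[OF E disj that])
  have "stone_to_tight (tight_to_stone A) = {s \<in> car S. \<beta> s \<in> extension A}" unfolding stone_to_tight_def using iff hom_car by blast
  then show "stone_to_tight (tight_to_stone A) = A" using pre by simp
qed

lemma stone_to_tight_bij: "bij_betw stone_to_tight {U. ultrafilter T U} {A. tight_filter S A}"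
  unfolding bij_betw_def
proof
  show "inj_on stone_to_tight {U. ultrafilter T U}" by (rule inj_onI, rule stone_to_tight_inj) simp_all
  show "stone_to_tight ` {U. ultrafilter T U} = {A. tight_filter S A}"
  proof (intro equalityI subsetI)
    fix A assume "A \<in> {A. tight_filter S A}"
    then have A: "tight_filter S A" by simp
    show "A \<in> stone_to_tight ` {U. ultrafilter T U}"
      by (rule image_eqI[of _ _ "tight_to_stone A"]) (simp_all add: stone_to_tight_inverse[OF A] tight_to_stone_ultrafilter[OF A])
  qed (use stone_to_tight_filter in blast)
qed

lemma hom_T: "hom S T (\<lambda>s. CK.cl (\<beta> s))"
  using CK.cl_hom hom unfolding T_eq hom_def by simp

lemma stone_to_tight_groupoid:
  assumes U: "ultrafilter T U" and V: "ultrafilter T V"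
  shows stone_to_tight_composable: "composable T U V \<longleftrightarrow> composable S (stone_to_tight U) (stone_to_tight V)"
    and stone_to_tight_gprod: "composable T U V \<Longrightarrow> stone_to_tight (gprod T U V) = gprod S (stone_to_tight U) (stone_to_tight V)"
proof -
  interpret T: isg T by (rule isg_T)
  interpret filter_preimage S T "\<lambda>s. CK.cl (\<beta> s)" stone_to_tight
  proof unfold_locales
    show "stone_to_tight \<equiv> \<lambda>V. {s \<in> car S. CK.cl (\<beta> s) \<in> V}"
      by (rule eq_reflection) (simp add: fun_eq_iff stone_to_tight_def)
    show "proper_filter S {s \<in> car S. CK.cl (\<beta> s) \<in> V}" if "ultrafilter T V" for V
      using S.tight_filter_filter[OF stone_to_tight_filter[OF that]] unfolding stone_to_tight_def .
    show "U = V" if "ultrafilter T U" "ultrafilter T V"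
      "{s \<in> car S. CK.cl (\<beta> s) \<in> U} = {s \<in> car S. CK.cl (\<beta> s) \<in> V}" for U V
      using stone_to_tight_inj[OF that(1,2)] that(3) unfolding stone_to_tight_def by blast
  qed (rule hom_T)
  show "composable T U V \<longleftrightarrow> composable S (stone_to_tight U) (stone_to_tight V)" by (rule pre_composable[OF U V])
  show "composable T U V \<Longrightarrow> stone_to_tight (gprod T U V) = gprod S (stone_to_tight U) (stone_to_tight V)" by (rule pre_gprod[OF U V])
qed

lemma topspace_stone: "topspace (stone_topology T) = {U. ultrafilter T U}"
proof -
  interpret T: isg T by (rule isg_T)
  have "\<exists>a\<in>car T. a \<in> U" if "ultrafilter T U" for U
    using T.filter_nonempty[OF T.ultrafilter_filter[OF that]] T.filter_car[OF T.ultrafilter_filter[OF that]] by blast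
  then show ?thesis unfolding stone_topology_def topology_generated_by_topspace by blast
qed

lemma patch_open:
  "\<lbrakk>a \<in> car S; finite C; \<And>c. c \<in> C \<Longrightarrow> leq S c a\<rbrakk> \<Longrightarrow>
    openin (patch_topology S) {A. tight_filter S A \<and> a \<in> A \<and> (\<forall>c\<in>C. c \<notin> A)}"
  unfolding patch_topology_def by (rule topology_generated_by_Basis) blast

lemma topspace_patch: "topspace (patch_topology S) = {A. tight_filter S A}"
proof
  show "topspace (patch_topology S) \<subseteq> {A. tight_filter S A}"
    unfolding patch_topology_def topology_generated_by_topspace by blast
  show "{A. tight_filter S A} \<subseteq> topspace (patch_topology S)"
  proof
    fix A assume "A \<in> {A. tight_filter S A}"
    then have A: "tight_filter S A" by simp
    obtain a where a: "a \<in> A" using S.filter_nonempty[OF S.tight_filter_filter[OF A]] by blast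
    have "a \<in> car S" using a S.filter_car[OF S.tight_filter_filter[OF A]] by blast
    then have "{A. tight_filter S A \<and> a \<in> A \<and> (\<forall>c\<in>{}. c \<notin> A)} \<subseteq> topspace (patch_topology S)"
      by (intro openin_subset patch_open) auto
    then show "A \<in> topspace (patch_topology S)" using A a by blast
  qed
qed

lemma stone_to_tight_continuous: "continuous_map (stone_topology T) (patch_topology S) stone_to_tight"
proof -
  let ?X = "stone_topology T"
  have st: "openin ?X {U. ultrafilter T U \<and> CK.cl b \<in> U}" if "b \<in> car B" for b
    unfolding stone_topology_def using that by (intro topology_generated_by_Basis) (auto simp: T_eq)
  have op: "openin ?X (stone_to_tight -` {A. tight_filter S A \<and> a \<in> A \<and> (\<forall>c\<in>C. c \<notin> A)} \<inter> topspace ?X)"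
    if a: "a \<in> car S" "finite C" "\<forall>c\<in>C. leq S c a" for a C
  proof -
    let ?d = "\<lambda>c. diff B (\<beta> a) (\<beta> c)"
    have le: "leq B (\<beta> c) (\<beta> a)" if "c \<in> C" for c using that a hom_leq by blast
    have eq: "\<beta> c \<notin> U \<longleftrightarrow> ?d c \<in> U" if "c \<in> C" "prime_filter B U" "\<beta> a \<in> U" for c U
    proof -
      note U' = prime_filter_filter[OF that(2)] and l = le[OF that(1)]
      have "\<not> (\<beta> c \<in> U \<and> ?d c \<in> U)"
      proof
        assume "\<beta> c \<in> U \<and> ?d c \<in> U"
        then obtain z where z: "z \<in> U" "leq B z (?d c)" "leq B z (\<beta> c)" using B.filter_directed[OF U'] by blast
        have "z = zer B"
          by (rule B.disjoint_dom_bounded[OF B.diff_car[OF l] _ B.diff_dom[OF l] z(2,3)]) (use B.leq_car[OF l] in auto)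
        then show False using z(1) B.filter_zer[OF U'] by blast
      qed
      then show ?thesis using prime_filter_prime[OF that(2) B.diff_join[OF l] that(3)] by blast
    qed
    have "stone_to_tight -` {A. tight_filter S A \<and> a \<in> A \<and> (\<forall>c\<in>C. c \<notin> A)} \<inter> topspace ?X =
        {U. ultrafilter T U \<and> CK.cl (\<beta> a) \<in> U} \<inter> ((\<Inter>c\<in>C. {U. ultrafilter T U \<and> CK.cl (?d c) \<in> U}) \<inter> topspace ?X)"
      (is "?L = ?R")
    proof (intro set_eqI)
      fix V
      show "V \<in> ?L \<longleftrightarrow> V \<in> ?R"
      proof (cases "ultrafilter T V \<and> CK.cl (\<beta> a) \<in> V")
        case True
        then have V: "prime_filter B {b \<in> car B. CK.cl b \<in> V}" using CK.ultrafilter_preimage(1) unfolding T_eq by blast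
        have "CK.cl (\<beta> c) \<notin> V \<longleftrightarrow> CK.cl (?d c) \<in> V" if "c \<in> C" for c
          using eq[OF that V] True a(1) B.leq_car[OF le[OF that]] B.diff_car[OF le[OF that]] by simp
        moreover have "c \<in> car S" if "c \<in> C" for c using that a S.leq_car by blast
        ultimately show ?thesis using True stone_to_tight_filter[of V] a(1) unfolding topspace_stone stone_to_tight_def by auto
      next
        case False
        then show ?thesis unfolding topspace_stone stone_to_tight_def by auto
      qed
    qed
    moreover have "openin ?X ((\<Inter>c\<in>C. {U. ultrafilter T U \<and> CK.cl (?d c) \<in> U}) \<inter> topspace ?X)"
      using a(2) st[OF B.diff_car[OF le]] by (intro openin_INT) auto
    ultimately show ?thesis using st[of "\<beta> a"] a(1) by (simp add: openin_Int)
  qed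
  have "stone_to_tight ` topspace ?X \<subseteq> topspace (patch_topology S)" using stone_to_tight_filter unfolding topspace_stone topspace_patch by blast
  then show ?thesis
    unfolding patch_topology_def
    by (intro continuous_on_generated_topo) (use op in \<open>auto simp: topology_generated_by_topspace\<close>)
qed

lemma extension_open_idem:
  assumes "e \<in> gen_idems"
  shows "\<forall>s\<in>car S. openin (patch_topology S) {A. tight_filter S A \<and> mul B (\<beta> s) e \<in> extension A} \<and>
      openin (patch_topology S) {A. tight_filter S A \<and> s \<in> A \<and> mul B (\<beta> s) e \<notin> extension A}"
  using assms
proof (induction rule: gen_idems.induct)
  case (base k)
  show ?case
  proof
    fix s assume s: "s \<in> car S"
    have "leq S (mul S s k) s" using base s by (intro S.leqI)
    moreover have "mul B (\<beta> s) (\<beta> k) \<in> extension A \<longleftrightarrow> mul S s k \<in> A" if "tight_filter S A" for A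
    proof -
      have "mul S s k \<in> car S" using s base by simp
      then have "\<beta> (mul S s k) \<in> extension A \<longleftrightarrow> mul S s k \<in> A"
        using extension_preimage[OF S.tight_filter_filter[OF that]] by blast
      then show ?thesis using s base by (simp add: hom_mul)
    qed
    ultimately show "openin (patch_topology S) {A. tight_filter S A \<and> mul B (\<beta> s) (\<beta> k) \<in> extension A} \<and>
      openin (patch_topology S) {A. tight_filter S A \<and> s \<in> A \<and> mul B (\<beta> s) (\<beta> k) \<notin> extension A}"
      using patch_open[of "mul S s k" "{}"] patch_open[of s "{mul S s k}"] s base
      by (simp cong: conj_cong)
  qed
next
  case (meet e f)
  show ?case
  proof
    fix s assume s: "s \<in> car S"
    have iff: "mul B (\<beta> s) (mul B e f) \<in> extension A \<longleftrightarrow> mul B (\<beta> s) e \<in> extension A \<and> mul B (\<beta> s) f \<in> extension A"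
      if "tight_filter S A" for A
      using meet s by (intro B.prime_filter_meet extension_prime_filter S.tight_filter_filter that) auto
    have eq: "{A. tight_filter S A \<and> mul B (\<beta> s) (mul B e f) \<in> extension A} =
        {A. tight_filter S A \<and> mul B (\<beta> s) e \<in> extension A} \<inter> {A. tight_filter S A \<and> mul B (\<beta> s) f \<in> extension A}"
      "{A. tight_filter S A \<and> s \<in> A \<and> mul B (\<beta> s) (mul B e f) \<notin> extension A} =
        {A. tight_filter S A \<and> s \<in> A \<and> mul B (\<beta> s) e \<notin> extension A} \<union> {A. tight_filter S A \<and> s \<in> A \<and> mul B (\<beta> s) f \<notin> extension A}"
      using iff by blast+
    show "openin (patch_topology S) {A. tight_filter S A \<and> mul B (\<beta> s) (mul B e f) \<in> extension A} \<and>
      openin (patch_topology S) {A. tight_filter S A \<and> s \<in> A \<and> mul B (\<beta> s) (mul B e f) \<notin> extension A}"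
      unfolding eq using meet s by blast
  qed
next
  case (join e f g)
  show ?case
  proof
    fix s assume s: "s \<in> car S"
    have iff: "mul B (\<beta> s) g \<in> extension A \<longleftrightarrow> mul B (\<beta> s) e \<in> extension A \<or> mul B (\<beta> s) f \<in> extension A"
      if "tight_filter S A" for A
      using join s by (intro B.prime_filter_join extension_prime_filter S.tight_filter_filter that) auto
    have eq: "{A. tight_filter S A \<and> mul B (\<beta> s) g \<in> extension A} =
        {A. tight_filter S A \<and> mul B (\<beta> s) e \<in> extension A} \<union> {A. tight_filter S A \<and> mul B (\<beta> s) f \<in> extension A}"
      "{A. tight_filter S A \<and> s \<in> A \<and> mul B (\<beta> s) g \<notin> extension A} =
        {A. tight_filter S A \<and> s \<in> A \<and> mul B (\<beta> s) e \<notin> extension A} \<inter> {A. tight_filter S A \<and> s \<in> A \<and> mul B (\<beta> s) f \<notin> extension A}"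
      using iff by blast+
    show "openin (patch_topology S) {A. tight_filter S A \<and> mul B (\<beta> s) g \<in> extension A} \<and>
      openin (patch_topology S) {A. tight_filter S A \<and> s \<in> A \<and> mul B (\<beta> s) g \<notin> extension A}"
      unfolding eq using join s by blast
  qed
next
  case (diff e f)
  show ?case
  proof
    fix s assume s: "s \<in> car S"
    let ?g = "diff B f e"
    have iff: "mul B (\<beta> s) ?g \<in> extension A \<longleftrightarrow> mul B (\<beta> s) f \<in> extension A \<and> mul B (\<beta> s) e \<notin> extension A"
      if "tight_filter S A" for A
      using diff s by (intro B.prime_filter_diff extension_prime_filter S.tight_filter_filter that) auto
    have sA: "s \<in> A" if A: "tight_filter S A" and h: "mul B (\<beta> s) h \<in> extension A" "idem B h" for A h
    proof -
      note A' = S.tight_filter_filter[OF A]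
      have "\<beta> s \<in> extension A"
        using B.filter_up[OF prime_filter_filter[OF extension_prime_filter[OF A']] h(1) B.leqI[OF h(2)]] s by simp
      then show ?thesis using extension_preimage[OF A'] s by blast
    qed
    have ef: "idem B e" "idem B f" using diff by auto
    have eq: "{A. tight_filter S A \<and> mul B (\<beta> s) ?g \<in> extension A} =
        {A. tight_filter S A \<and> mul B (\<beta> s) f \<in> extension A} \<inter> {A. tight_filter S A \<and> s \<in> A \<and> mul B (\<beta> s) e \<notin> extension A}"
      "{A. tight_filter S A \<and> s \<in> A \<and> mul B (\<beta> s) ?g \<notin> extension A} =
        {A. tight_filter S A \<and> s \<in> A \<and> mul B (\<beta> s) f \<notin> extension A} \<union> {A. tight_filter S A \<and> mul B (\<beta> s) e \<in> extension A}"
      using iff sA ef by blast+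
    show "openin (patch_topology S) {A. tight_filter S A \<and> mul B (\<beta> s) ?g \<in> extension A} \<and>
      openin (patch_topology S) {A. tight_filter S A \<and> s \<in> A \<and> mul B (\<beta> s) ?g \<notin> extension A}"
      unfolding eq using diff s by blast
  qed
qed

lemma extension_open: "b \<in> generated \<Longrightarrow> openin (patch_topology S) {A. tight_filter S A \<and> b \<in> extension A}"
proof (induction rule: generated.induct)
  case (base s e)
  then show ?case using extension_open_idem by blast
next
  case (join x y z)
  have "z \<in> extension A \<longleftrightarrow> x \<in> extension A \<or> y \<in> extension A" if "tight_filter S A" for A
    using prime_filter_prime[OF extension_prime_filter[OF S.tight_filter_filter[OF that]] join(3)]
      B.filter_up[OF prime_filter_filter[OF extension_prime_filter[OF S.tight_filter_filter[OF that]]]]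
      B.is_join2[OF join(3)] by blast
  then have "{A. tight_filter S A \<and> z \<in> extension A} =
    {A. tight_filter S A \<and> x \<in> extension A} \<union> {A. tight_filter S A \<and> y \<in> extension A}" by blast
  then show ?case using join by (simp add: openin_Un)
qed

lemma tight_to_stone_continuous: "continuous_map (patch_topology S) (stone_topology T) tight_to_stone"
proof -
  let ?Y = "patch_topology S"
  have op: "openin ?Y (tight_to_stone -` {U. ultrafilter T U \<and> X \<in> U} \<inter> topspace ?Y)" if X: "X \<in> car T" for X
  proof -
    obtain b where b: "b \<in> car B" "X = CK.cl b" by (rule CK.car_QE[OF X[unfolded T_eq]])
    have "tight_to_stone -` {U. ultrafilter T U \<and> X \<in> U} \<inter> topspace ?Y = {A. tight_filter S A \<and> b \<in> extension A}"
      unfolding topspace_patch b(2) using tight_to_stone_ultrafilter tight_to_stone_iff[OF _ b(1)] by blast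
    then show ?thesis using extension_open[OF generated_eq[OF b(1)]] by simp
  qed
  have "tight_to_stone ` topspace ?Y \<subseteq> topspace (stone_topology T)" using tight_to_stone_ultrafilter unfolding topspace_stone topspace_patch by blast
  then show ?thesis
    unfolding stone_topology_def
    by (intro continuous_on_generated_topo) (use op in \<open>auto simp: topology_generated_by_topspace\<close>)
qed

lemma stone_to_tight_homeomorphic: "homeomorphic_map (stone_topology T) (patch_topology S) stone_to_tight"
proof -
  have "tight_to_stone (stone_to_tight U) = U" if "ultrafilter T U" for U
    using stone_to_tight_inj[OF tight_to_stone_ultrafilter[OF stone_to_tight_filter[OF that]] that stone_to_tight_inverse[OF stone_to_tight_filter[OF that]]] .
  then have "homeomorphic_maps (stone_topology T) (patch_topology S) stone_to_tight tight_to_stone"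
    unfolding homeomorphic_maps_def topspace_stone topspace_patch
    using stone_to_tight_continuous tight_to_stone_continuous stone_to_tight_inverse by simp
  then show ?thesis unfolding homeomorphic_map_maps by blast
qed

end

theorem theorem1p4:
  fixes S :: "'a isg" and B :: "'b isg" and \<beta> :: "'a \<Rightarrow> 'b"
  assumes "inverse_semigroup S"
    and "is_booleanization S B \<beta>"
  shows "\<exists>\<phi>. stone_tight_iso (exel_completion S B \<beta>) S \<phi>"
proof -
  interpret booleanization S B \<beta> using assms by unfold_locales
  show ?thesis
    unfolding stone_tight_iso_def
    using stone_to_tight_bij stone_to_tight_composable stone_to_tight_gprod stone_to_tight_homeomorphic by blast
qed

end
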